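(* The assignment $L\mapsto C^\bullet(L,\mathbb K)$, $f\mapsto f^\ast$, where $C^\bullet(L,\mathbb K)$ is the standard complex of $L$ with values in the trivial representation $\mathbb K$ and $f^\ast$ is the pullback map defined in the context, is a contravariant functor from the category of hemistrict Lie 2-algebras to the category of cochain complexes.
   Context: $\mathbb K=\mathbb R$ or $\mathbb C$; 2-term cochain complexes sit in degrees $-1,0$; $|x|$ is the degree of $x$. **Hemistrict Lie 2-algebra** $L=(\vec L,[-,-],h_2)$: a 2-term complex $\vec L=(L^{-1}\xrightarrow dL^0)$ over $\mathbb K$, a degree-$0$ bilinear bracket on $L^\bullet$ (zero on $L^{-1}\times L^{-1}$) with $d[x,y]=[dx,y]+(-1)^{|x|}[x,dy]$ and $[x,[y,z]]=[[x,y],z]+(-1)^{|x||y|}[y,[x,z]]$, and a symmetric bilinear map $h_2:L^0\times L^0\to L^{-1}$ such that $[x,y]+[y,x]=dh_2(x,y)$, $[x,\alpha]+[\alpha,x]=h_2(x,d\alpha)$, $[h_2(x,y),z]=0$, $[x,h_2(y,z)]=h_2([x,y],z)+h_2(y,[x,z])$ for $x,y,z\in L^0,\alpha\in L^{-1}$. **Morphism** $f=(f_1,f_2):L'\to L$: a cochain map $f_1:\vec L'\to\vec L$ and a bilinear map $f_2:L'^0\times L'^0\to L^{-1}$ such that $[f_1(x'),f_1(y')]-f_1([x',y']')$ equals $df_2(x',y')$ for $x',y'\in L'^0$, equals $f_2(dx',y')$ for $x'\in L'^{-1},y'\in L'^0$, and equals $f_2(x',dy')$ for $x'\in L'^0,y'\in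 L'^{-1}$; and for $x',y',z'\in L'^0$ $$h_2(f_1(x'),f_1(y'))-f_1(h_2'(x',y'))=f_2(x',y')+f_2(y',x'),$$ $$[f_1(x'),f_2(y',z')]-[f_1(y'),f_2(x',z')]-[f_2(x',y'),f_1(z')]=f_2([x',y']',z')+f_2(y',[x',z']')-f_2(x',[y',z']').$$ Composition: $(f\circ f')_1=f_1\circ f_1'$, $(f\circ f')_2(x'',y'')=f_2(f_1'(x''),f_1'(y''))+f_1(f_2'(x'',y''))$. **Standard complex** $C^\bullet(L,\mathbb K)$ (trivial representation, $\mathbb K$ in degree $0$ with zero actions): for $n\ge0$, $C^n(L,\mathbb K)$ is the space of tuples $\omega=(\omega_0,\dots,\omega_{\lfloor n/2\rfloor})$ of linear maps $\omega_k:(L^0)^{\otimes(n-2k)}\otimes S^k(L^{-1})\to\mathbb K$ ($S^k$ the ordinary symmetric power) satisfying $$\omega_k(\cdots,x_i,x_{i+1},\cdots\mid\cdots)+\omega_k(\cdots,x_{i+1},x_i,\cdots\mid\cdots)=-\omega_{k+1}(\cdots,\widehat{x_i},\widehat{x_{i+1}},\cdots\mid h_2(x_i,x_{i+1}),\cdots)$$ for $1\le i\le n-2k-1$. The differential $D:C^n\to C^{n+1}$ is $$(D\omega)_k(x_1,\dots,x_{n+1-2k}\mid\alpha_1,\dots,\alpha_k)=\sum_{j=1}^k\omega_{k-1}(d\alpha_j,x_1,\dots,x_{n+1-2k}\mid\cdots,\widehat{\alpha_j},\cdots)$$ $$+\sum_{i<j}(-1)^i\omega_k(\cdots,\widehat{x_i},\cdots,\widehat{x_j},[x_i,x_j],\cdots\mid\alpha_1,\dots,\alpha_k)+\sum_{i=1}^{n+1-2k}\sum_{j=1}^k(-1)^{i+1}\omega_k(\cdots,\widehat{x_i},\cdots\mid\cdots,[\alpha_j,x_i],\cdots),$$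 where $[x_i,x_j]$ (resp. $[\alpha_j,x_i]$) takes the place of $x_j$ (resp. $\alpha_j$). **Pullback** $f^\ast:C^n(L,\mathbb K)\to C^n(L',\mathbb K)$ for a morphism $f:L'\to L$: $$(f^\ast\omega)_k(x_1',\dots,x_{n-2k}'\mid\alpha_1',\dots,\alpha_k')=\sum_{q=0}^{\lfloor n/2\rfloor-k}(-1)^q\sum\mathrm{sgn}(i_1<j_1;\cdots;i_q<j_q)\,\omega_{k+q}\big(\cdots\mid f_2(x_{i_1}',x_{j_1}'),\dots,f_2(x_{i_q}',x_{j_q}'),f_1(\alpha_1'),\dots,f_1(\alpha_k')\big),$$ where the inner sum is over all families of $q$ pairwise disjoint pairs $i_a<j_a$ in $\{1,\dots,n-2k\}$ with $i_1<\cdots<i_q$, the arguments to the left of the bar are $f_1(x_1'),\dots,f_1(x_{n-2k}')$ in order with those of index in $\{i_1,j_1,\dots,i_q,j_q\}$ omitted (the $q=0$ term is $\omega_k(f_1(x_1'),\dots,f_1(x'_{n-2k})\mid f_1(\alpha_1'),\dots,f_1(\alpha_k'))$), and $$\mathrm{sgn}(i_1<j_1;\cdots;i_q<j_q)=(-1)^{\sum_a(i_a+j_a)+\sum_{a<b}\mathrm{int}((i_a,j_a),(i_b,j_b))},$$ with $\mathrm{int}((i_a,j_a),(i_b,j_b))=1$ if $i_a<i_b<j_a<j_b$ and $0$ otherwise. *)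

theory Defs
  imports Complex_Main "HOL-Library.Multiset" "HOL-Library.FuncSet" "HOL-Algebra.Module"
begin

section \<open>Categories and contravariant functors\<close>

text \<open>Hom-sets are indexed by a pair of objects and need not be disjoint;
  \<open>Cmp C X Y Z g f\<close> is the composite of \<open>f \<in> Hom C X Y\<close> and \<open>g \<in> Hom C Y Z\<close>.\<close>

record ('o, 'm) category =
  Obj :: "'o set"
  Hom :: "'o \<Rightarrow> 'o \<Rightarrow> 'm set"
  Id  :: "'o \<Rightarrow> 'm"
  Cmp :: "'o \<Rightarrow> 'o \<Rightarrow> 'o \<Rightarrow> 'm \<Rightarrow> 'm \<Rightarrow> 'm"

locale category =
  fixes C :: "('o, 'm) category"
  assumes Id_in_Hom: "X \<in> Obj C \<Longrightarrow> Id C X \<in> Hom C X X"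
    and Cmp_in_Hom:
      "\<lbrakk>X \<in> Obj C; Y \<in> Obj C; Z \<in> Obj C; f \<in> Hom C X Y; g \<in> Hom C Y Z\<rbrakk>
        \<Longrightarrow> Cmp C X Y Z g f \<in> Hom C X Z"
    and Cmp_Id_right: "\<lbrakk>X \<in> Obj C; Y \<in> Obj C; f \<in> Hom C X Y\<rbrakk> \<Longrightarrow> Cmp C X X Y f (Id C X) = f"
    and Cmp_Id_left: "\<lbrakk>X \<in> Obj C; Y \<in> Obj C; f \<in> Hom C X Y\<rbrakk> \<Longrightarrow> Cmp C X Y Y (Id C Y) f = f"
    and Cmp_assoc:
      "\<lbrakk>W \<in> Obj C; X \<in> Obj C; Y \<in> Obj C; Z \<in> Obj C;
        f \<in> Hom C W X; g \<in> Hom C X Y; h \<in> Hom C Y Z\<rbrakk>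
        \<Longrightarrow> Cmp C W Y Z h (Cmp C W X Y g f) = Cmp C W X Z (Cmp C X Y Z h g) f"

locale contravariant_functor = C: category C + D: category D
  for C :: "('o1, 'm1) category" and D :: "('o2, 'm2) category" +
  fixes F :: "'o1 \<Rightarrow> 'o2" and Fm :: "'o1 \<Rightarrow> 'o1 \<Rightarrow> 'm1 \<Rightarrow> 'm2"
  assumes F_Obj: "X \<in> Obj C \<Longrightarrow> F X \<in> Obj D"
    and Fm_Hom: "\<lbrakk>X \<in> Obj C; Y \<in> Obj C; f \<in> Hom C X Y\<rbrakk> \<Longrightarrow> Fm X Y f \<in> Hom D (F Y) (F X)"
    and Fm_Id: "X \<in> Obj C \<Longrightarrow> Fm X X (Id C X) = Id D (F X)"
    and Fm_Cmp:
      "\<lbrakk>X \<in> Obj C; Y \<in> Obj C; Z \<in> Obj C; f \<in> Hom C X Y; g \<in> Hom C Y Z\<rbrakk>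
        \<Longrightarrow> Fm X Z (Cmp C X Y Z g f) = Cmp D (F Z) (F Y) (F X) (Fm X Y f) (Fm Y Z g)"

section \<open>Vector spaces\<close>

text \<open>A field type as a one-dimensional module over itself. As a module record extends a ring
  record, the same constant serves as the ring of scalars. The fields \<open>mult\<close> and \<open>one\<close>
  of the other module records play no role.\<close>

definition scalars :: "('k::field, 'k) module" where
  "scalars = \<lparr>carrier = UNIV, mult = (*), one = 1, zero = 0, add = (+), smult = (*)\<rparr>"

abbreviation vspace :: "('k::field, 'v) module \<Rightarrow> bool" where
  "vspace V \<equiv> module scalars V"

definition linear_maps :: "('k::field, 'v) module \<Rightarrow> ('k, 'w) module \<Rightarrow> ('v \<Rightarrow> 'w) set" where
  "linear_maps V W = {f \<in> carrier V \<rightarrow> carrier W.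
     (\<forall>x\<in>carrier V. \<forall>y\<in>carrier V. f (x \<oplus>\<^bsub>V\<^esub> y) = f x \<oplus>\<^bsub>W\<^esub> f y) \<and>
     (\<forall>c. \<forall>x\<in>carrier V. f (c \<odot>\<^bsub>V\<^esub> x) = c \<odot>\<^bsub>W\<^esub> f x)}"

definition bilinear_maps ::
  "('k::field, 'u) module \<Rightarrow> ('k, 'v) module \<Rightarrow> ('k, 'w) module \<Rightarrow> ('u \<Rightarrow> 'v \<Rightarrow> 'w) set" where
  "bilinear_maps U V W = {b.
     (\<forall>x\<in>carrier U. b x \<in> linear_maps V W) \<and>
     (\<forall>y\<in>carrier V. (\<lambda>x. b x y) \<in> linear_maps U W)}"

section \<open>The category of cochain complexes\<close>

record ('k, 'w) cochain_complex =
  space :: "int \<Rightarrow> ('k, 'w) module"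
  diff :: "int \<Rightarrow> 'w \<Rightarrow> 'w"

definition is_cochain_complex :: "('k::field, 'w) cochain_complex \<Rightarrow> bool" where
  "is_cochain_complex A \<longleftrightarrow>
     (\<forall>n. vspace (space A n)) \<and>
     (\<forall>n. diff A n \<in> linear_maps (space A n) (space A (n + 1))) \<and>
     (\<forall>n. \<forall>x\<in>carrier (space A n). diff A (n + 1) (diff A n x) = \<zero>\<^bsub>space A (n + 1 + 1)\<^esub>)"

text \<open>Functions are made extensional, here and for Lie 2-algebras, so that equality of morphisms
  is equality on the carriers.\<close>

definition cochain_maps ::
  "('k::field, 'w) cochain_complex \<Rightarrow> ('k, 'w) cochain_complex \<Rightarrow> (int \<Rightarrow> 'w \<Rightarrow> 'w) set" where
  "cochain_maps A B = {\<phi>.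
     (\<forall>n. \<phi> n \<in> linear_maps (space A n) (space B n) \<inter> extensional (carrier (space A n))) \<and>
     (\<forall>n. \<forall>x\<in>carrier (space A n). \<phi> (n + 1) (diff A n x) = diff B n (\<phi> n x))}"

definition cochain_complexes ::
  "(('k::field, 'w) cochain_complex, int \<Rightarrow> 'w \<Rightarrow> 'w) category" where
  "cochain_complexes =
     \<lparr>Obj = {A. is_cochain_complex A},
      Hom = cochain_maps,
      Id = (\<lambda>A n. \<lambda>x\<in>carrier (space A n). x),
      Cmp = (\<lambda>A B C \<psi> \<phi> n. \<lambda>x\<in>carrier (space A n). \<psi> n (\<phi> n x))\<rparr>"

section \<open>The category of hemistrict Lie 2-algebras\<close>

text \<open>The degree-0 bracket splits into its components on \<open>L\<^sup>0 \<times> L\<^sup>0\<close> (\<open>br\<close>),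
  \<open>L\<^sup>0 \<times> L\<^sup>-\<^sup>1\<close> (\<open>brR\<close>) and \<open>L\<^sup>-\<^sup>1 \<times> L\<^sup>0\<close> (\<open>brL\<close>); it vanishes on \<open>L\<^sup>-\<^sup>1 \<times> L\<^sup>-\<^sup>1\<close>.\<close>

record ('k, 'a, 'b) hl2a =
  Lm :: "('k, 'a) module"
  L0 :: "('k, 'b) module"
  dd :: "'a \<Rightarrow> 'b"
  br :: "'b \<Rightarrow> 'b \<Rightarrow> 'b"
  brR :: "'b \<Rightarrow> 'a \<Rightarrow> 'a"
  brL :: "'a \<Rightarrow> 'b \<Rightarrow> 'a"
  h2 :: "'b \<Rightarrow> 'b \<Rightarrow> 'a"

text \<open>The graded identities \<open>d[x,y] = [dx,y] + (-1)\<^bsup>|x|\<^esup>[x,dy]\<close> and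
  \<open>[x,[y,z]] = [[x,y],z] + (-1)\<^bsup>|x||y|\<^esup>[y,[x,z]]\<close> are written out by degree: in \<open>derivation_LL\<close>
  the left-hand side \<open>d[\<alpha>,\<beta>]\<close> is zero, and the second identity
  is trivial as soon as two arguments have degree -1, so no sign survives.\<close>

locale hemistrict_lie_2_algebra =
  fixes L :: "('k::field, 'a, 'b) hl2a"
  assumes Lm_vspace: "vspace (Lm L)"
    and L0_vspace: "vspace (L0 L)"
    and dd_linear: "dd L \<in> linear_maps (Lm L) (L0 L)"
    and br_bilinear: "br L \<in> bilinear_maps (L0 L) (L0 L) (L0 L)"
    and brR_bilinear: "brR L \<in> bilinear_maps (L0 L) (Lm L) (Lm L)"
    and brL_bilinear: "brL L \<in> bilinear_maps (Lm L) (L0 L) (Lm L)"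
    and h2_bilinear: "h2 L \<in> bilinear_maps (L0 L) (L0 L) (Lm L)"
    and derivation_R: "\<lbrakk>x \<in> carrier (L0 L); \<alpha> \<in> carrier (Lm L)\<rbrakk>
      \<Longrightarrow> dd L (brR L x \<alpha>) = br L x (dd L \<alpha>)"
    and derivation_L: "\<lbrakk>\<alpha> \<in> carrier (Lm L); x \<in> carrier (L0 L)\<rbrakk>
      \<Longrightarrow> dd L (brL L \<alpha> x) = br L (dd L \<alpha>) x"
    and derivation_LL: "\<lbrakk>\<alpha> \<in> carrier (Lm L); \<beta> \<in> carrier (Lm L)\<rbrakk>
      \<Longrightarrow> \<zero>\<^bsub>Lm L\<^esub> = brR L (dd L \<alpha>) \<beta> \<ominus>\<^bsub>Lm L\<^esub> brL L \<alpha> (dd L \<beta>)"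
    and Leibniz: "\<lbrakk>x \<in> carrier (L0 L); y \<in> carrier (L0 L); z \<in> carrier (L0 L)\<rbrakk>
      \<Longrightarrow> br L x (br L y z) = br L (br L x y) z \<oplus>\<^bsub>L0 L\<^esub> br L y (br L x z)"
    and Leibniz_1: "\<lbrakk>\<alpha> \<in> carrier (Lm L); y \<in> carrier (L0 L); z \<in> carrier (L0 L)\<rbrakk>
      \<Longrightarrow> brL L \<alpha> (br L y z) = brL L (brL L \<alpha> y) z \<oplus>\<^bsub>Lm L\<^esub> brR L y (brL L \<alpha> z)"
    and Leibniz_2: "\<lbrakk>x \<in> carrier (L0 L); \<alpha> \<in> carrier (Lm L); z \<in> carrier (L0 L)\<rbrakk>
      \<Longrightarrow> brR L x (brL L \<alpha> z) = brL L (brR L x \<alpha>) z \<oplus>\<^bsub>Lm L\<^esub> brL L \<alpha> (br L x z)"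
    and Leibniz_3: "\<lbrakk>x \<in> carrier (L0 L); y \<in> carrier (L0 L); \<alpha> \<in> carrier (Lm L)\<rbrakk>
      \<Longrightarrow> brR L x (brR L y \<alpha>) = brR L (br L x y) \<alpha> \<oplus>\<^bsub>Lm L\<^esub> brR L y (brR L x \<alpha>)"
    and h2_sym: "\<lbrakk>x \<in> carrier (L0 L); y \<in> carrier (L0 L)\<rbrakk> \<Longrightarrow> h2 L x y = h2 L y x"
    and br_anti: "\<lbrakk>x \<in> carrier (L0 L); y \<in> carrier (L0 L)\<rbrakk>
      \<Longrightarrow> br L x y \<oplus>\<^bsub>L0 L\<^esub> br L y x = dd L (h2 L x y)"
    and brR_brL_anti: "\<lbrakk>x \<in> carrier (L0 L); \<alpha> \<in> carrier (Lm L)\<rbrakk>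
      \<Longrightarrow> brR L x \<alpha> \<oplus>\<^bsub>Lm L\<^esub> brL L \<alpha> x = h2 L x (dd L \<alpha>)"
    and brL_h2: "\<lbrakk>x \<in> carrier (L0 L); y \<in> carrier (L0 L); z \<in> carrier (L0 L)\<rbrakk>
      \<Longrightarrow> brL L (h2 L x y) z = \<zero>\<^bsub>Lm L\<^esub>"
    and brR_h2: "\<lbrakk>x \<in> carrier (L0 L); y \<in> carrier (L0 L); z \<in> carrier (L0 L)\<rbrakk>
      \<Longrightarrow> brR L x (h2 L y z) = h2 L (br L x y) z \<oplus>\<^bsub>Lm L\<^esub> h2 L y (br L x z)"

text \<open>\<open>f1m\<close> and \<open>f10\<close> are the components of the cochain map \<open>f\<^sub>1\<close> in degrees -1 and 0.\<close>

record ('a, 'b) hl2a_mor =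
  f1m :: "'a \<Rightarrow> 'a"
  f10 :: "'b \<Rightarrow> 'b"
  f2 :: "'b \<Rightarrow> 'b \<Rightarrow> 'a"

locale hl2a_morphism =
  fixes L' L :: "('k::field, 'a, 'b) hl2a" and f :: "('a, 'b) hl2a_mor"
  assumes f1m_linear: "f1m f \<in> linear_maps (Lm L') (Lm L)"
    and f1m_ext: "f1m f \<in> extensional (carrier (Lm L'))"
    and f10_linear: "f10 f \<in> linear_maps (L0 L') (L0 L)"
    and f10_ext: "f10 f \<in> extensional (carrier (L0 L'))"
    and f1_dd: "\<alpha> \<in> carrier (Lm L') \<Longrightarrow> f10 f (dd L' \<alpha>) = dd L (f1m f \<alpha>)"
    and f2_bilinear: "f2 f \<in> bilinear_maps (L0 L') (L0 L') (Lm L)"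
    and f2_ext: "f2 f \<in> carrier (L0 L') \<rightarrow>\<^sub>E (carrier (L0 L') \<rightarrow>\<^sub>E carrier (Lm L))"
    and f1_br: "\<lbrakk>x \<in> carrier (L0 L'); y \<in> carrier (L0 L')\<rbrakk>
      \<Longrightarrow> br L (f10 f x) (f10 f y) \<ominus>\<^bsub>L0 L\<^esub> f10 f (br L' x y) = dd L (f2 f x y)"
    and f1_brL: "\<lbrakk>\<alpha> \<in> carrier (Lm L'); y \<in> carrier (L0 L')\<rbrakk>
      \<Longrightarrow> brL L (f1m f \<alpha>) (f10 f y) \<ominus>\<^bsub>Lm L\<^esub> f1m f (brL L' \<alpha> y) = f2 f (dd L' \<alpha>) y"
    and f1_brR: "\<lbrakk>x \<in> carrier (L0 L'); \<alpha> \<in> carrier (Lm L')\<rbrakk>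
      \<Longrightarrow> brR L (f10 f x) (f1m f \<alpha>) \<ominus>\<^bsub>Lm L\<^esub> f1m f (brR L' x \<alpha>) = f2 f x (dd L' \<alpha>)"
    and f1_h2: "\<lbrakk>x \<in> carrier (L0 L'); y \<in> carrier (L0 L')\<rbrakk>
      \<Longrightarrow> h2 L (f10 f x) (f10 f y) \<ominus>\<^bsub>Lm L\<^esub> f1m f (h2 L' x y) = f2 f x y \<oplus>\<^bsub>Lm L\<^esub> f2 f y x"
    and f2_br: "\<lbrakk>x \<in> carrier (L0 L'); y \<in> carrier (L0 L'); z \<in> carrier (L0 L')\<rbrakk>
      \<Longrightarrow> (brR L (f10 f x) (f2 f y z) \<ominus>\<^bsub>Lm L\<^esub> brR L (f10 f y) (f2 f x z))
            \<ominus>\<^bsub>Lm L\<^esub> brL L (f2 f x y) (f10 f z)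
        = (f2 f (br L' x y) z \<oplus>\<^bsub>Lm L\<^esub> f2 f y (br L' x z)) \<ominus>\<^bsub>Lm L\<^esub> f2 f x (br L' y z)"

definition hl2a_id :: "('k::field, 'a, 'b) hl2a \<Rightarrow> ('a, 'b) hl2a_mor" where
  "hl2a_id L =
     \<lparr>f1m = (\<lambda>\<alpha>\<in>carrier (Lm L). \<alpha>),
      f10 = (\<lambda>x\<in>carrier (L0 L). x),
      f2 = (\<lambda>x\<in>carrier (L0 L). \<lambda>y\<in>carrier (L0 L). \<zero>\<^bsub>Lm L\<^esub>)\<rparr>"

definition hl2a_comp ::
  "('k::field, 'a, 'b) hl2a \<Rightarrow> ('k, 'a, 'b) hl2a \<Rightarrow> ('k, 'a, 'b) hl2a
    \<Rightarrow> ('a, 'b) hl2a_mor \<Rightarrow> ('a, 'b) hl2a_mor \<Rightarrow> ('a, 'b) hl2a_mor" where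
  "hl2a_comp L'' L' L f f' =
     \<lparr>f1m = (\<lambda>\<alpha>\<in>carrier (Lm L''). f1m f (f1m f' \<alpha>)),
      f10 = (\<lambda>x\<in>carrier (L0 L''). f10 f (f10 f' x)),
      f2 = (\<lambda>x\<in>carrier (L0 L''). \<lambda>y\<in>carrier (L0 L'').
              f2 f (f10 f' x) (f10 f' y) \<oplus>\<^bsub>Lm L\<^esub> f1m f (f2 f' x y))\<rparr>"

definition hemistrict_lie_2_algebras ::
  "(('k::field, 'a, 'b) hl2a, ('a, 'b) hl2a_mor) category" where
  "hemistrict_lie_2_algebras =
     \<lparr>Obj = {L. hemistrict_lie_2_algebra L},
      Hom = (\<lambda>L' L. {f. hl2a_morphism L' L f}),
      Id = hl2a_id,
      Cmp = hl2a_comp\<rparr>"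

section \<open>The standard complex\<close>

text \<open>A cochain \<open>\<omega> = (\<omega>\<^sub>0, \<omega>\<^sub>1, \<dots>)\<close> is one function of two argument lists, the value
  \<open>\<omega>\<^sub>k(x\<^sub>1,\<dots>,x\<^sub>m | \<alpha>\<^sub>1,\<dots>,\<alpha>\<^sub>k)\<close> being \<open>\<omega> [x\<^sub>1,\<dots>,x\<^sub>m] [\<alpha>\<^sub>1,\<dots>,\<alpha>\<^sub>k]\<close>; so \<open>k\<close> is the length of the
  second list. Linear maps on \<open>(L\<^sup>0)\<^bsup>\<otimes>m\<^esup> \<otimes> S\<^bsup>k\<^esup>(L\<^sup>-\<^sup>1)\<close> are multilinear functions symmetric in the
  last \<open>k\<close> arguments. By convention \<open>\<omega>\<close> is zero on lists whose lengths do not fit the degree or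
  whose entries are not in the carriers. In particular only the zero cochain
  has negative degree. Positions in lists count from 0.\<close>

type_synonym ('k, 'a, 'b) cochain = "'b list \<Rightarrow> 'a list \<Rightarrow> 'k"

abbreviation args :: "('k::field, 'a, 'b) hl2a \<Rightarrow> 'b list \<Rightarrow> 'a list \<Rightarrow> bool" where
  "args L xs as \<equiv> xs \<in> lists (carrier (L0 L)) \<and> as \<in> lists (carrier (Lm L))"

definition cochains :: "('k::field, 'a, 'b) hl2a \<Rightarrow> int \<Rightarrow> ('k, 'a, 'b) cochain set" where
  "cochains L n = {\<omega>.
     (\<forall>xs as. \<not> (args L xs as \<and> int (length xs) + 2 * int (length as) = n) \<longrightarrow> \<omega> xs as = 0) \<and>
     (\<forall>xs as i. args L xs as \<and> i < length xs \<longrightarrow>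
        (\<lambda>x. \<omega> (xs[i := x]) as) \<in> linear_maps (L0 L) scalars) \<and>
     (\<forall>xs as j. args L xs as \<and> j < length as \<longrightarrow>
        (\<lambda>\<alpha>. \<omega> xs (as[j := \<alpha>])) \<in> linear_maps (Lm L) scalars) \<and>
     (\<forall>xs as bs. args L xs as \<and> mset as = mset bs \<longrightarrow> \<omega> xs as = \<omega> xs bs) \<and>
     (\<forall>xs as i. args L xs as \<and> Suc i < length xs \<longrightarrow>
        \<omega> xs as + \<omega> (xs[i := xs ! Suc i, Suc i := xs ! i]) as
          = - \<omega> (nths xs (- {i, Suc i})) (h2 L (xs ! i) (xs ! Suc i) # as))}"

text \<open>Counting positions from 0 shifts the signs \<open>(-1)\<^bsup>i\<^esup>\<close> and \<open>(-1)\<^bsup>i+1\<^esup>\<close> of the second and third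
  sum by one.\<close>

definition D :: "('k::field, 'a, 'b) hl2a \<Rightarrow> ('k, 'a, 'b) cochain \<Rightarrow> ('k, 'a, 'b) cochain" where
  "D L \<omega> = (\<lambda>xs as. if args L xs as then
       (\<Sum>j<length as. \<omega> (dd L (as ! j) # xs) (nths as (- {j})))
     + (\<Sum>j<length xs. \<Sum>i<j.
          (-1) ^ Suc i * \<omega> (nths (xs[j := br L (xs ! i) (xs ! j)]) (- {i})) as)
     + (\<Sum>i<length xs. \<Sum>j<length as.
          (-1) ^ i * \<omega> (nths xs (- {i})) (as[j := brL L (as ! j) (xs ! i)]))
     else 0)"

definition cochain_space ::
  "('k::field, 'a, 'b) hl2a \<Rightarrow> int \<Rightarrow> ('k, ('k, 'a, 'b) cochain) module" where
  "cochain_space L n =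
     \<lparr>carrier = cochains L n,
      mult = undefined, one = undefined,
      zero = (\<lambda>xs as. 0),
      add = (\<lambda>\<omega> \<eta> xs as. \<omega> xs as + \<eta> xs as),
      smult = (\<lambda>c \<omega> xs as. c * \<omega> xs as)\<rparr>"

definition standard_complex ::
  "('k::field, 'a, 'b) hl2a \<Rightarrow> ('k, ('k, 'a, 'b) cochain) cochain_complex" where
  "standard_complex L = \<lparr>space = cochain_space L, diff = (\<lambda>n. D L)\<rparr>"

section \<open>The pullback\<close>

text \<open>Families of \<open>q\<close> pairwise disjoint pairs \<open>i\<^sub>a < j\<^sub>a\<close> in \<open>{0..<m}\<close> with \<open>i\<^sub>1 < \<dots> < i\<^sub>q\<close>.\<close>

definition pair_families :: "nat \<Rightarrow> nat \<Rightarrow> (nat \<times> nat) list set" where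
  "pair_families m q = {ps. length ps = q \<and>
     (\<forall>(i, j)\<in>set ps. i < j \<and> j < m) \<and>
     distinct (map fst ps @ map snd ps) \<and>
     sorted_wrt (<) (map fst ps)}"

lemma finite_pair_families: "finite (pair_families m q)"
proof (rule finite_subset)
  show "pair_families m q \<subseteq> {ps. set ps \<subseteq> {..<m} \<times> {..<m} \<and> length ps = q}"
    unfolding pair_families_def by fastforce
  show "finite {ps. set ps \<subseteq> {..<m} \<times> {..<m} \<and> length ps = q}"
    by (rule finite_lists_length_eq) simp
qed

text \<open>The parity of \<open>i\<^sub>a + j\<^sub>a\<close> is not affected by counting from 0.\<close>

definition pair_sign :: "(nat \<times> nat) list \<Rightarrow> 'k::field" where
  "pair_sign ps = (-1) ^ ((\<Sum>(i, j)\<leftarrow>ps. i + j) +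
     card {(a, b). a < b \<and> b < length ps \<and>
       fst (ps ! a) < fst (ps ! b) \<and> fst (ps ! b) < snd (ps ! a) \<and> snd (ps ! a) < snd (ps ! b)})"

definition pullback ::
  "('k::field, 'a, 'b) hl2a \<Rightarrow> ('a, 'b) hl2a_mor \<Rightarrow> ('k, 'a, 'b) cochain \<Rightarrow> ('k, 'a, 'b) cochain" where
  "pullback L' f \<omega> = (\<lambda>xs as. if args L' xs as then
       (\<Sum>q = 0..length xs div 2. (-1) ^ q * (\<Sum>ps\<in>pair_families (length xs) q.
          pair_sign ps *
          \<omega> (map (f10 f) (nths xs (- (fst ` set ps \<union> snd ` set ps))))
            (map (\<lambda>(i, j). f2 f (xs ! i) (xs ! j)) ps @ map (f1m f) as)))
     else 0)"

definition pullback_map ::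
  "('k::field, 'a, 'b) hl2a \<Rightarrow> ('k, 'a, 'b) hl2a \<Rightarrow> ('a, 'b) hl2a_mor
    \<Rightarrow> int \<Rightarrow> ('k, 'a, 'b) cochain \<Rightarrow> ('k, 'a, 'b) cochain" where
  "pullback_map L' L f = (\<lambda>n. \<lambda>\<omega>\<in>cochains L n. pullback L' f \<omega>)"

end

theory Submission
  imports Defs "HOL-Library.Function_Algebras"
begin

text \<open>
  For a functional \<open>\<omega>\<close> of two argument lists write \<open>\<iota>\<^sub>x \<omega> = \<omega>(x, \<dots> | \<dots>)\<close> and
  \<open>\<kappa>\<^sub>\<alpha> \<omega> = \<omega>(\<dots> | \<alpha>, \<dots>)\<close> for the contractions with a first argument. All positions and
  signs can be hidden behind these two operations. A functional is determined by its iterated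
  contractions, so two operators agree as soon as they obey the same recursion under contraction;
  lemma \<open>contraction_unique\<close> carries out this induction once. The cochains are the functionals
  whose contractions are linear and satisfy \<open>\<iota>\<^sub>x \<iota>\<^sub>y + \<iota>\<^sub>y \<iota>\<^sub>x = - \<kappa>\<^bsub>h2(x,y)\<^esub>\<close> and
  \<open>\<kappa>\<^sub>\<alpha> \<kappa>\<^sub>\<beta> = \<kappa>\<^sub>\<beta> \<kappa>\<^sub>\<alpha>\<close> (lemma \<open>cochains_iff\<close>).

  The differential is governed by Cartan's formulas \<open>\<iota>\<^sub>x D + D \<iota>\<^sub>x = L\<^sub>x\<close> and
  \<open>\<kappa>\<^sub>\<alpha> D - D \<kappa>\<^sub>\<alpha> = L\<^sub>\<alpha>\<close> (lemmas \<open>\<iota>_D\<close> and \<open>\<kappa>_D\<close>), in which \<open>L\<^sub>x\<close> is a derivation of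
  degree 0 and \<open>L\<^sub>\<alpha>\<close> an operator of degree -1. Every axiom of a hemistrict Lie 2-algebra
  becomes a commutation rule: the Leibniz identities give \<open>[L\<^sub>x, L\<^sub>y] = L\<^bsub>[x,y]\<^esub>\<close> and
  \<open>[L\<^sub>x, L\<^sub>\<alpha>] = L\<^bsub>[x,\<alpha>]\<^esub>\<close>, the identities for \<open>h2\<close> make \<open>L\<^sub>x\<close> and \<open>D\<close> respect the cochain
  relations. The identity \<open>[d\<alpha>, \<beta>] = [\<alpha>, d\<beta>]\<close> gives \<open>L\<^sub>\<alpha> L\<^sub>\<beta> + L\<^sub>\<beta> L\<^sub>\<alpha> = 0\<close>. It then follows
  formally that \<open>D\<close> commutes with \<open>L\<^sub>x\<close>, anticommutes with \<open>L\<^sub>\<alpha>\<close> and has square zero.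

  The pullback is an expansion over partial matchings, and its sign is the sign of the permutation
  that moves the matched pairs to the front. Sorting the matchings by the partner of the first
  position gives the recursion
  \<open>\<iota>\<^sub>x f\<^sup>* = f\<^sup>* \<iota>\<^bsub>f(x)\<^esub> + (\<Sum>j. (-1)\<^sup>j (f\<^sup>* \<kappa>\<^bsub>f2(x,x\<^sub>j)\<^esub>)(\<dots> without x\<^sub>j \<dots>))\<close>
  (lemma \<open>\<iota>_pullback\<close>), after which the matchings never appear again. The sum is an instance of
  the operation \<open>wedge\<close>, the product of a family of functionals with the tautological 1-form; two
  such products anticommute (lemma \<open>wedge_anticommute\<close>), which is what makes the terms with two
  factors \<open>f2\<close> cancel. The pullback commutes with \<open>wedge\<close>, and it commutes with \<open>L\<^sub>x\<close> up to an explicit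
  defect (lemma \<open>Lie_pull\<close>); this defect is exactly what the extra term of the recursion
  contributes in Cartan's formula, whence \<open>D f\<^sup>* = f\<^sup>* D\<close> (lemma \<open>D_pull\<close>). Finally the pullback
  along a composite and the composite of the pullbacks obey the same recursion, because
  the second component of the composite is the sum of the two contributions that arise.
\<close>

section \<open>Contractions, the wedge operator and Lie derivatives\<close>

definition \<iota> :: "'b \<Rightarrow> ('k, 'a, 'b) cochain \<Rightarrow> ('k, 'a, 'b) cochain" where
  "\<iota> x \<omega> = (\<lambda>xs. \<omega> (x # xs))"

definition \<kappa> :: "'a \<Rightarrow> ('k, 'a, 'b) cochain \<Rightarrow> ('k, 'a, 'b) cochain" where
  "\<kappa> \<alpha> \<omega> = (\<lambda>xs as. \<omega> xs (\<alpha> # as))"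

text \<open>Scalar multiplication of functionals. Their addition is the pointwise addition of functions, so that
  operator identities can be normalised in an abelian group type class.\<close>

definition scale :: "'k::field \<Rightarrow> ('k, 'a, 'b) cochain \<Rightarrow> ('k, 'a, 'b) cochain" where
  "scale c \<omega> = (\<lambda>xs as. c * \<omega> xs as)"

text \<open>Operators between functionals that vanish outside the carriers satisfy their identities as
  equations between functions, which makes these equations available for rewriting under any other
  operator.\<close>

definition supported :: "('k::field, 'a, 'b) hl2a \<Rightarrow> ('k, 'a, 'b) cochain set" where
  "supported L = {\<omega>. \<forall>xs as. \<not> args L xs as \<longrightarrow> \<omega> xs as = 0}"

text \<open>The product of the tautological 1-form \<open>x \<mapsto> x\<close> with a family of functionals indexed by \<open>L\<^sup>0\<close>: one
  argument is taken out, with the sign of moving it to the front, and selects the member of the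
  family.\<close>

definition wedge :: "('k::field, 'a, 'b) hl2a \<Rightarrow> ('b \<Rightarrow> ('k, 'a, 'b) cochain) \<Rightarrow> ('k, 'a, 'b) cochain" where
  "wedge L \<eta> = (\<lambda>xs as. if args L xs as
     then \<Sum>j<length xs. (-1) ^ j * \<eta> (xs ! j) (nths xs (- {j})) as else 0)"

text \<open>The derivation of degree 0 induced by the left action \<open>[x, -]\<close> on both kinds of arguments; the minus
  sign is that of the action on dual spaces.\<close>

definition Lie :: "('k::field, 'a, 'b) hl2a \<Rightarrow> 'b \<Rightarrow> ('k, 'a, 'b) cochain \<Rightarrow> ('k, 'a, 'b) cochain" where
  "Lie L x \<omega> = (\<lambda>xs as. if args L xs as
     then - (\<Sum>j<length xs. \<omega> (xs[j := br L x (xs ! j)]) as)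
          - (\<Sum>j<length as. \<omega> xs (as[j := brR L x (as ! j)])) else 0)"

text \<open>The counterpart of the Lie derivative for an element of degree -1. Its formula is the commutator of
  the contraction with \<open>\<alpha>\<close> and the differential.\<close>

definition Liem :: "('k::field, 'a, 'b) hl2a \<Rightarrow> 'a \<Rightarrow> ('k, 'a, 'b) cochain \<Rightarrow> ('k, 'a, 'b) cochain" where
  "Liem L \<alpha> \<omega> = \<iota> (dd L \<alpha>) \<omega> + wedge L (\<lambda>z. \<kappa> (brL L \<alpha> z) \<omega>)"

lemma supported_eqI:
  assumes "\<omega> \<in> supported L" "\<eta> \<in> supported L" "\<And>xs as. args L xs as \<Longrightarrow> \<omega> xs as = \<eta> xs as"
  shows "\<omega> = \<eta>"
proof (intro ext)
  fix xs as show "\<omega> xs as = \<eta> xs as"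
    using assms unfolding supported_def by (cases "args L xs as") auto
qed

lemma supported_closed [simp]:
  "0 \<in> supported L"
  "\<omega> \<in> supported L \<Longrightarrow> \<eta> \<in> supported L \<Longrightarrow> \<omega> + \<eta> \<in> supported L"
  "\<omega> \<in> supported L \<Longrightarrow> \<eta> \<in> supported L \<Longrightarrow> \<omega> - \<eta> \<in> supported L"
  "\<omega> \<in> supported L \<Longrightarrow> - \<omega> \<in> supported L"
  "\<omega> \<in> supported L \<Longrightarrow> scale c \<omega> \<in> supported L"
  "\<omega> \<in> supported L \<Longrightarrow> \<iota> x \<omega> \<in> supported L"
  "\<omega> \<in> supported L \<Longrightarrow> \<kappa> \<alpha> \<omega> \<in> supported L"
  "wedge L \<zeta> \<in> supported L" "Lie L x \<omega> \<in> supported L" "D L \<omega> \<in> supported L"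
  by (auto simp: supported_def scale_def \<iota>_def \<kappa>_def wedge_def Lie_def D_def)

lemma pullback_supported [simp]: "pullback L f \<omega> \<in> supported L"
  by (simp add: supported_def pullback_def)

lemma Liem_supported [simp]: "\<omega> \<in> supported L \<Longrightarrow> Liem L \<alpha> \<omega> \<in> supported L"
  by (simp add: Liem_def)

lemma scale_simps [simp]:
  "scale 1 \<omega> = \<omega>" "scale (-1) \<omega> = - \<omega>" "scale 0 \<omega> = 0"
  by (simp_all add: scale_def fun_eq_iff)

lemma scale_linear:
  "scale c (\<omega> + \<eta>) = scale c \<omega> + scale c \<eta>" "scale c (\<omega> - \<eta>) = scale c \<omega> - scale c \<eta>"
  "scale c (- \<omega>) = - scale c \<omega>" "scale c 0 = 0"
  by (simp_all add: scale_def fun_eq_iff algebra_simps)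

lemma scale_commute: "scale c (scale d \<omega>) = scale d (scale c \<omega>)"
  by (simp add: scale_def fun_eq_iff algebra_simps)

lemma \<iota>_linear [simp]:
  "\<iota> x (\<omega> + \<eta>) = \<iota> x \<omega> + \<iota> x \<eta>" "\<iota> x (\<omega> - \<eta>) = \<iota> x \<omega> - \<iota> x \<eta>" "\<iota> x (- \<omega>) = - \<iota> x \<omega>"
  "\<iota> x (scale c \<omega>) = scale c (\<iota> x \<omega>)" "\<iota> x 0 = 0"
  by (simp_all add: \<iota>_def scale_def fun_eq_iff)

lemma \<kappa>_linear [simp]:
  "\<kappa> x (\<omega> + \<eta>) = \<kappa> x \<omega> + \<kappa> x \<eta>" "\<kappa> x (\<omega> - \<eta>) = \<kappa> x \<omega> - \<kappa> x \<eta>" "\<kappa> x (- \<omega>) = - \<kappa> x \<omega>"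
  "\<kappa> x (scale c \<omega>) = scale c (\<kappa> x \<omega>)" "\<kappa> x 0 = 0"
  by (simp_all add: \<kappa>_def scale_def fun_eq_iff)

lemma \<iota>_\<kappa>: "\<iota> x (\<kappa> \<alpha> \<omega>) = \<kappa> \<alpha> (\<iota> x \<omega>)"
  by (simp add: \<iota>_def \<kappa>_def)

lemma nths_in_lists: "xs \<in> lists A \<Longrightarrow> nths xs I \<in> lists A"
  using notin_set_nthsI by fastforce

text \<open>As a congruence rule this lets the simplifier use that the index of a family lies in the carrier.\<close>

lemma wedge_cong [cong]:
  assumes "L = L'" "\<And>z. z \<in> carrier (L0 L') \<Longrightarrow> \<eta> z = \<zeta> z"
  shows "wedge L \<eta> = wedge L' \<zeta>"
proof (intro ext)
  fix xs as
  have "\<eta> (xs ! j) = \<zeta> (xs ! j)" if "args L xs as" "j < length xs" for j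
    using assms that by (metis in_listsD nth_mem)
  then show "wedge L \<eta> xs as = wedge L' \<zeta> xs as"
    using assms(1) by (auto simp: wedge_def intro!: sum.cong)
qed

lemma wedge_linear:
  "wedge L (\<lambda>z. \<eta> z + \<zeta> z) = wedge L \<eta> + wedge L \<zeta>" "wedge L (\<lambda>z. \<eta> z - \<zeta> z) = wedge L \<eta> - wedge L \<zeta>"
  "wedge L (\<lambda>z. - \<eta> z) = - wedge L \<eta>" "wedge L (\<lambda>z. scale c (\<eta> z)) = scale c (wedge L \<eta>)" "wedge L (\<lambda>z. 0) = 0"
  by (simp_all add: wedge_def scale_def fun_eq_iff sum.distrib sum_subtractf sum_negf algebra_simps
      sum_distrib_left)

lemma Lie_linear:
  "Lie L x (\<omega> + \<eta>) = Lie L x \<omega> + Lie L x \<eta>" "Lie L x (\<omega> - \<eta>) = Lie L x \<omega> - Lie L x \<eta>"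
  "Lie L x (- \<omega>) = - Lie L x \<omega>" "Lie L x (scale c \<omega>) = scale c (Lie L x \<omega>)" "Lie L x 0 = 0"
  by (simp_all add: Lie_def scale_def fun_eq_iff sum.distrib sum_subtractf sum_negf algebra_simps
      sum_distrib_left)

lemma Liem_linear:
  "Liem L x (\<omega> + \<eta>) = Liem L x \<omega> + Liem L x \<eta>" "Liem L x (\<omega> - \<eta>) = Liem L x \<omega> - Liem L x \<eta>"
  "Liem L x (- \<omega>) = - Liem L x \<omega>" "Liem L x (scale c \<omega>) = scale c (Liem L x \<omega>)" "Liem L x 0 = 0"
  by (simp_all add: Liem_def wedge_linear scale_linear)

lemma D_linear:
  "D L (\<omega> + \<eta>) = D L \<omega> + D L \<eta>" "D L (\<omega> - \<eta>) = D L \<omega> - D L \<eta>"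
  "D L (- \<omega>) = - D L \<omega>" "D L (scale c \<omega>) = scale c (D L \<omega>)" "D L 0 = 0"
  by (simp_all add: D_def scale_def fun_eq_iff sum.distrib sum_subtractf sum_negf algebra_simps
      sum_distrib_left)

lemma pullback_linear:
  "pullback L f (\<omega> + \<eta>) = pullback L f \<omega> + pullback L f \<eta>"
  "pullback L f (\<omega> - \<eta>) = pullback L f \<omega> - pullback L f \<eta>"
  "pullback L f (- \<omega>) = - pullback L f \<omega>" "pullback L f (scale c \<omega>) = scale c (pullback L f \<omega>)"
  "pullback L f 0 = 0"
  by (simp_all add: pullback_def scale_def fun_eq_iff sum.distrib sum_subtractf sum_negf algebra_simps
      sum_distrib_left)

lemma nths_Cons_neg [simp]:
  "nths (x # xs) (- {0}) = xs" "nths (x # xs) (- {Suc j}) = x # nths xs (- {j})"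
proof -
  have "nths xs UNIV = xs" by (simp add: nths_all)
  moreover have "{j. Suc j \<in> - {0}} = UNIV" "{i. Suc i \<in> - {Suc j}} = - {j}" by auto
  ultimately show "nths (x # xs) (- {0}) = xs" "nths (x # xs) (- {Suc j}) = x # nths xs (- {j})"
    by (simp_all add: nths_Cons)
qed

lemma length_nths_neg: "j < length xs \<Longrightarrow> length (nths xs (- {j})) = length xs - 1"
proof (induction xs arbitrary: j)
  case (Cons x xs)
  then show ?case by (cases j; cases xs) auto
qed simp

lemma \<iota>_wedge:
  assumes "x \<in> carrier (L0 L)" "\<eta> x \<in> supported L"
  shows "\<iota> x (wedge L \<eta>) = \<eta> x - wedge L (\<lambda>z. \<iota> x (\<eta> z))"
  using assms
  by (auto simp: \<iota>_def wedge_def supported_def fun_eq_iff sum.lessThan_Suc_shift sum_negf simp del: sum.lessThan_Suc)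

lemma \<kappa>_wedge: "\<alpha> \<in> carrier (Lm L) \<Longrightarrow> \<kappa> \<alpha> (wedge L \<eta>) = wedge L (\<lambda>z. \<kappa> \<alpha> (\<eta> z))"
  by (auto simp: \<kappa>_def wedge_def fun_eq_iff)

lemma wedge_Nil [simp]: "wedge L \<eta> [] as = 0"
  by (simp add: wedge_def)

text \<open>Operators are compared through their difference \<open>E\<close>. If every contraction of \<open>E p\<close> is a combination
  of values of \<open>E\<close> at other admissible parameters, possibly inserted into a wedge product, then all
  values reduce to those at empty lists, by induction on the number of arguments in \<open>L\<^sup>0\<close> and then in
  \<open>L\<^sup>-\<^sup>1\<close>. The parameter may be a functional or a family of functionals. The coefficients are
  arbitrary; coefficient 0 expresses that the contraction vanishes or that the wedge term is absent.
  For contractions in \<open>L\<^sup>-\<^sup>1\<close> it is enough to look at lists without arguments in \<open>L\<^sup>0\<close>.\<close>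

lemma contraction_unique:
  fixes E :: "'p \<Rightarrow> ('k::field, 'a, 'b) cochain"
  assumes P: "P p"
    and off: "\<And>p. P p \<Longrightarrow> E p \<in> supported L"
    and Nil: "\<And>p. P p \<Longrightarrow> E p [] [] = 0"
    and contr_m: "\<And>p \<alpha> as. P p \<Longrightarrow> \<alpha> \<in> carrier (Lm L) \<Longrightarrow> as \<in> lists (carrier (Lm L)) \<Longrightarrow>
      \<exists>q c. P q \<and> \<kappa> \<alpha> (E p) [] as = c * E q [] as"
    and contr_0: "\<And>p x. P p \<Longrightarrow> x \<in> carrier (L0 L) \<Longrightarrow>
      \<exists>q c r c'. P q \<and> (\<forall>z\<in>carrier (L0 L). P (r z)) \<and>
        \<iota> x (E p) = scale c (E q) + scale c' (wedge L (\<lambda>z. E (r z)))"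
  shows "E p = 0"
proof -
  have "E p xs as = 0" if "args L xs as" for xs as
    using that P
  proof (induction "length xs" arbitrary: xs p rule: less_induct)
    case less
    show ?case
    proof (cases xs)
      case Nil': Nil
      have "as \<in> lists (carrier (Lm L))" using less.prems(1) by simp
      then have "E p [] as = 0"
        using less.prems(2)
      proof (induction as arbitrary: p rule: list.induct)
        case (Cons \<alpha> as)
        then have "\<alpha> \<in> carrier (Lm L)" and as: "as \<in> lists (carrier (Lm L))"
          by auto
        from contr_m[OF Cons.prems(2) this] obtain q c
          where "P q" and q: "\<kappa> \<alpha> (E p) [] as = c * E q [] as"
          by (elim exE conjE) (rule that)
        have "E q [] as = 0" by (rule Cons.IH[OF as \<open>P q\<close>])
        with q show ?case by (simp add: \<kappa>_def)
      qed (rule Nil)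
      then show ?thesis by (simp add: Nil')
    next
      case (Cons x ys)
      then have ys: "args L ys as" and x: "x \<in> carrier (L0 L)"
        using less.prems(1) unfolding Cons by auto
      obtain q c r c' where *: "P q" "\<forall>z\<in>carrier (L0 L). P (r z)"
          "\<iota> x (E p) = scale c (E q) + scale c' (wedge L (\<lambda>z. E (r z)))"
        using contr_0[OF less.prems(2) x] by (elim exE conjE) (rule that)
      have "E (r (ys ! j)) (nths ys (- {j})) as = 0" if "j < length ys" for j
      proof (rule less.hyps)
        show "length (nths ys (- {j})) < length xs"
          using that by (simp add: Cons length_nths_neg)
        show "args L (nths ys (- {j})) as" using ys by (simp add: nths_in_lists)
        have "ys ! j \<in> carrier (L0 L)" using ys that by (auto simp: in_lists_conv_set)
        then show "P (r (ys ! j))" by (rule *(2)[rule_format])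
      qed
      then have "wedge L (\<lambda>z. E (r z)) ys as = 0"
        by (simp add: wedge_def)
      moreover have "E q ys as = 0"
        by (rule less.hyps[OF _ ys *(1)]) (simp add: Cons)
      ultimately have "\<iota> x (E p) ys as = 0"
        by (simp add: *(3) scale_def)
      then show ?thesis by (simp add: Cons \<iota>_def)
    qed
  qed
  then show ?thesis
    by (intro supported_eqI[OF off[OF P] supported_closed(1)]) simp
qed

text \<open>The contraction of the left-hand side with \<open>x\<close> is \<open>wedge (\<lambda>w. \<eta> x w) - wedge (\<lambda>z. \<eta> z x)\<close> plus the double
  wedge product of the contracted family, and the first two terms change sign when the factors are
  interchanged.\<close>

lemma wedge_anticommute:
  assumes "\<And>z w. z \<in> carrier (L0 L) \<Longrightarrow> w \<in> carrier (L0 L) \<Longrightarrow> \<eta> z w \<in> supported L"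
  shows "wedge L (\<lambda>z. wedge L (\<lambda>w. \<eta> z w)) = - wedge L (\<lambda>w. wedge L (\<lambda>z. \<eta> z w))"
proof -
  let ?E = "\<lambda>\<eta>. wedge L (\<lambda>z. wedge L (\<lambda>w. \<eta> z w)) + wedge L (\<lambda>w. wedge L (\<lambda>z. \<eta> z w))"
  let ?P = "\<lambda>\<eta>. \<forall>z\<in>carrier (L0 L). \<forall>w\<in>carrier (L0 L). \<eta> z w \<in> supported L"
  have "?E \<eta> = 0"
  proof (rule contraction_unique[where P = ?P and E = ?E and L = L])
    fix \<eta> x assume P: "?P \<eta>" and x: "x \<in> carrier (L0 L)"
    have "\<iota> x (?E \<eta>) = ?E (\<lambda>z w. \<iota> x (\<eta> z w))"
      using P x by (simp add: \<iota>_wedge wedge_linear)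
    then show "\<exists>q c r c'. ?P q \<and> (\<forall>z\<in>carrier (L0 L). ?P (r z)) \<and>
        \<iota> x (?E \<eta>) = scale c (?E q) + scale c' (wedge L (\<lambda>z. ?E (r z)))"
      using P by (intro exI[of _ "\<lambda>z w. \<iota> x (\<eta> z w)"] exI[of _ 1] exI[of _ "\<lambda>_. \<eta>"] exI[of _ 0]) auto
  qed (use assms in \<open>auto simp: \<kappa>_def intro!: exI[of _ \<eta>]\<close>)
  then show ?thesis by (simp add: eq_neg_iff_add_eq_0)
qed

section \<open>Cochains in terms of contractions\<close>

text \<open>From here on identities are handled on the level of operators; evaluation of sums of functionals at
  arguments is requested explicitly by the collection \<open>pointwise\<close>.\<close>

declare plus_fun_apply [simp del] zero_fun_apply [simp del] uminus_apply [simp del] minus_apply [simp del]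

lemmas pointwise = plus_fun_apply zero_fun_apply uminus_apply minus_apply

text \<open>The cochain relations for the leading arguments. The same relations further inside the argument
  lists are the leading relations for contractions of \<open>\<omega>\<close>.\<close>

definition front :: "('k::field, 'a, 'b) hl2a \<Rightarrow> ('k, 'a, 'b) cochain \<Rightarrow> bool" where
  "front L \<omega> \<longleftrightarrow>
     (\<forall>x\<in>carrier (L0 L). \<forall>y\<in>carrier (L0 L). \<iota> (x \<oplus>\<^bsub>L0 L\<^esub> y) \<omega> = \<iota> x \<omega> + \<iota> y \<omega>) \<and>
     (\<forall>c. \<forall>x\<in>carrier (L0 L). \<iota> (c \<odot>\<^bsub>L0 L\<^esub> x) \<omega> = scale c (\<iota> x \<omega>)) \<and>
     (\<forall>\<alpha>\<in>carrier (Lm L). \<forall>\<beta>\<in>carrier (Lm L). \<kappa> (\<alpha> \<oplus>\<^bsub>Lm L\<^esub> \<beta>) \<omega> = \<kappa> \<alpha> \<omega> + \<kappa> \<beta> \<omega>) \<and>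
     (\<forall>c. \<forall>\<alpha>\<in>carrier (Lm L). \<kappa> (c \<odot>\<^bsub>Lm L\<^esub> \<alpha>) \<omega> = scale c (\<kappa> \<alpha> \<omega>)) \<and>
     (\<forall>x\<in>carrier (L0 L). \<forall>y\<in>carrier (L0 L). \<iota> x (\<iota> y \<omega>) + \<iota> y (\<iota> x \<omega>) = - \<kappa> (h2 L x y) \<omega>) \<and>
     (\<forall>\<alpha>\<in>carrier (Lm L). \<forall>\<beta>\<in>carrier (Lm L). \<kappa> \<alpha> (\<kappa> \<beta> \<omega>) = \<kappa> \<beta> (\<kappa> \<alpha> \<omega>))"

lemma frontD:
  assumes "front L \<omega>"
  shows "x \<in> carrier (L0 L) \<Longrightarrow> y \<in> carrier (L0 L) \<Longrightarrow> \<iota> (x \<oplus>\<^bsub>L0 L\<^esub> y) \<omega> = \<iota> x \<omega> + \<iota> y \<omega>"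
    and "x \<in> carrier (L0 L) \<Longrightarrow> \<iota> (c \<odot>\<^bsub>L0 L\<^esub> x) \<omega> = scale c (\<iota> x \<omega>)"
    and "\<alpha> \<in> carrier (Lm L) \<Longrightarrow> \<beta> \<in> carrier (Lm L) \<Longrightarrow> \<kappa> (\<alpha> \<oplus>\<^bsub>Lm L\<^esub> \<beta>) \<omega> = \<kappa> \<alpha> \<omega> + \<kappa> \<beta> \<omega>"
    and "\<alpha> \<in> carrier (Lm L) \<Longrightarrow> \<kappa> (c \<odot>\<^bsub>Lm L\<^esub> \<alpha>) \<omega> = scale c (\<kappa> \<alpha> \<omega>)"
  using assms by (auto simp: front_def)

lemma front_\<iota>\<iota>:
  "front L \<omega> \<Longrightarrow> x \<in> carrier (L0 L) \<Longrightarrow> y \<in> carrier (L0 L) \<Longrightarrow>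
     \<iota> x (\<iota> y \<omega>) = - \<iota> y (\<iota> x \<omega>) - \<kappa> (h2 L x y) \<omega>"
  unfolding front_def by (simp add: eq_diff_eq minus_equation_iff eq_neg_iff_add_eq_0 algebra_simps)

lemma front_\<kappa>\<kappa>:
  "front L \<omega> \<Longrightarrow> \<alpha> \<in> carrier (Lm L) \<Longrightarrow> \<beta> \<in> carrier (Lm L) \<Longrightarrow>
     \<kappa> \<alpha> (\<kappa> \<beta> \<omega>) = \<kappa> \<beta> (\<kappa> \<alpha> \<omega>)"
  by (auto simp: front_def)

lemma front_0 [simp]: "front L 0"
  by (simp add: front_def scale_linear)

lemma front_add [simp]: "front L \<omega> \<Longrightarrow> front L \<eta> \<Longrightarrow> front L (\<omega> + \<eta>)"
  unfolding front_def by (simp add: scale_linear algebra_simps)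

lemma front_scale [simp]:
  assumes "front L \<omega>"
  shows "front L (scale c \<omega>)"
proof -
  have "scale c (\<iota> x (\<iota> y \<omega>)) + scale c (\<iota> y (\<iota> x \<omega>)) = - scale c (\<kappa> (h2 L x y) \<omega>)"
    if "x \<in> carrier (L0 L)" "y \<in> carrier (L0 L)" for x y
    by (simp add: front_\<iota>\<iota>[OF assms that] scale_linear)
  then show ?thesis
    unfolding front_def by (simp add: frontD[OF assms] front_\<kappa>\<kappa>[OF assms] scale_linear scale_commute[of c])
qed

text \<open>The relations for the first \<open>n\<close> contractions. The bound is needed for induction: the contractions of
  a pullback contain wedge products of pullbacks, and wedge products preserve the
  relations depth by depth.\<close>

primrec mixed_upto :: "('k::field, 'a, 'b) hl2a \<Rightarrow> nat \<Rightarrow> ('k, 'a, 'b) cochain \<Rightarrow> bool" where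
  "mixed_upto L 0 \<omega> \<longleftrightarrow> \<omega> \<in> supported L"
| "mixed_upto L (Suc n) \<omega> \<longleftrightarrow> \<omega> \<in> supported L \<and> front L \<omega> \<and>
     (\<forall>x\<in>carrier (L0 L). mixed_upto L n (\<iota> x \<omega>)) \<and> (\<forall>\<alpha>\<in>carrier (Lm L). mixed_upto L n (\<kappa> \<alpha> \<omega>))"

declare mixed_upto.simps [simp del]

lemma mixed_upto_zero [simp]: "mixed_upto L 0 \<omega> \<longleftrightarrow> \<omega> \<in> supported L"
  by (simp add: mixed_upto.simps(1))

lemma mixed_upto_SucI:
  "\<omega> \<in> supported L \<Longrightarrow> front L \<omega> \<Longrightarrow> (\<And>x. x \<in> carrier (L0 L) \<Longrightarrow> mixed_upto L n (\<iota> x \<omega>)) \<Longrightarrow>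
     (\<And>\<alpha>. \<alpha> \<in> carrier (Lm L) \<Longrightarrow> mixed_upto L n (\<kappa> \<alpha> \<omega>)) \<Longrightarrow> mixed_upto L (Suc n) \<omega>"
  by (simp add: mixed_upto.simps(2))

lemma mixed_upto_SucD:
  assumes "mixed_upto L (Suc n) \<omega>"
  shows "\<omega> \<in> supported L" "front L \<omega>" "x \<in> carrier (L0 L) \<Longrightarrow> mixed_upto L n (\<iota> x \<omega>)"
    "\<alpha> \<in> carrier (Lm L) \<Longrightarrow> mixed_upto L n (\<kappa> \<alpha> \<omega>)"
  using assms by (simp_all add: mixed_upto.simps(2))

lemma mixed_upto_supported: "mixed_upto L n \<omega> \<Longrightarrow> \<omega> \<in> supported L"
  by (cases n) (auto dest: mixed_upto_SucD)

lemma mixed_upto_Suc: "mixed_upto L (Suc n) \<omega> \<Longrightarrow> mixed_upto L n \<omega>"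
  by (induction n arbitrary: \<omega>) (auto intro: mixed_upto_SucI mixed_upto_SucD)

lemma mixed_upto_0 [simp]: "mixed_upto L n 0"
proof (induction n)
  case (Suc n)
  show ?case
    by (rule mixed_upto_SucI) (simp_all only: supported_closed front_0 \<iota>_linear \<kappa>_linear Suc)
qed (simp only: mixed_upto_zero supported_closed)

lemma mixed_upto_add [simp]: "mixed_upto L n \<omega> \<Longrightarrow> mixed_upto L n \<eta> \<Longrightarrow> mixed_upto L n (\<omega> + \<eta>)"
proof (induction n arbitrary: \<omega> \<eta>)
  case (Suc n)
  note * = mixed_upto_SucD[OF Suc.prems(1)] mixed_upto_SucD[OF Suc.prems(2)]
  show ?case by (intro mixed_upto_SucI) (simp_all add: * Suc.IH)
qed simp

lemma mixed_upto_scale [simp]: "mixed_upto L n \<omega> \<Longrightarrow> mixed_upto L n (scale c \<omega>)"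
proof (induction n arbitrary: \<omega>)
  case (Suc n)
  note * = mixed_upto_SucD[OF Suc.prems]
  show ?case by (intro mixed_upto_SucI) (simp_all add: * Suc.IH)
qed simp

lemma mixed_upto_minus [simp]: "mixed_upto L n \<omega> \<Longrightarrow> mixed_upto L n (- \<omega>)"
  using mixed_upto_scale[of L n \<omega> "-1"] by simp

lemma mixed_upto_diff [simp]: "mixed_upto L n \<omega> \<Longrightarrow> mixed_upto L n \<eta> \<Longrightarrow> mixed_upto L n (\<omega> - \<eta>)"
  using mixed_upto_add[of L n \<omega> "- \<eta>"] by simp

text \<open>Cochains without a condition on the degree.\<close>

definition mixed :: "('k::field, 'a, 'b) hl2a \<Rightarrow> ('k, 'a, 'b) cochain \<Rightarrow> bool" where
  "mixed L \<omega> \<longleftrightarrow> (\<forall>n. mixed_upto L n \<omega>)"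

lemma mixed_supported [simp]: "mixed L \<omega> \<Longrightarrow> \<omega> \<in> supported L"
  by (auto simp: mixed_def intro: mixed_upto_supported)

lemma mixed_front [simp]: "mixed L \<omega> \<Longrightarrow> front L \<omega>"
  unfolding mixed_def using mixed_upto_SucD(2) by blast

lemma mixed_closed [simp]:
  "mixed L 0"
  "mixed L \<omega> \<Longrightarrow> mixed L \<eta> \<Longrightarrow> mixed L (\<omega> + \<eta>)"
  "mixed L \<omega> \<Longrightarrow> mixed L \<eta> \<Longrightarrow> mixed L (\<omega> - \<eta>)"
  "mixed L \<omega> \<Longrightarrow> mixed L (- \<omega>)"
  "mixed L \<omega> \<Longrightarrow> mixed L (scale c \<omega>)"
  by (simp_all add: mixed_def)

lemma mixed_contr [simp]:
  "mixed L \<omega> \<Longrightarrow> x \<in> carrier (L0 L) \<Longrightarrow> mixed L (\<iota> x \<omega>)"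
  "mixed L \<omega> \<Longrightarrow> \<alpha> \<in> carrier (Lm L) \<Longrightarrow> mixed L (\<kappa> \<alpha> \<omega>)"
  unfolding mixed_def using mixed_upto_SucD(3)[of L _ \<omega> x] mixed_upto_SucD(4)[of L _ \<omega> \<alpha>] by simp_all

text \<open>Families depending linearly on the index; linearity is what makes the wedge product of the family
  linear in the argument that selects the index.\<close>

definition family_upto :: "('k::field, 'a, 'b) hl2a \<Rightarrow> nat \<Rightarrow> ('b \<Rightarrow> ('k, 'a, 'b) cochain) \<Rightarrow> bool" where
  "family_upto L n \<eta> \<longleftrightarrow> (\<forall>x\<in>carrier (L0 L). mixed_upto L n (\<eta> x)) \<and>
     (\<forall>x\<in>carrier (L0 L). \<forall>y\<in>carrier (L0 L). \<eta> (x \<oplus>\<^bsub>L0 L\<^esub> y) = \<eta> x + \<eta> y) \<and>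
     (\<forall>c. \<forall>x\<in>carrier (L0 L). \<eta> (c \<odot>\<^bsub>L0 L\<^esub> x) = scale c (\<eta> x))"

definition family :: "('k::field, 'a, 'b) hl2a \<Rightarrow> ('b \<Rightarrow> ('k, 'a, 'b) cochain) \<Rightarrow> bool" where
  "family L \<eta> \<longleftrightarrow> (\<forall>n. family_upto L n \<eta>)"

lemma family_iff: "family L \<eta> \<longleftrightarrow> (\<forall>x\<in>carrier (L0 L). mixed L (\<eta> x)) \<and>
     (\<forall>x\<in>carrier (L0 L). \<forall>y\<in>carrier (L0 L). \<eta> (x \<oplus>\<^bsub>L0 L\<^esub> y) = \<eta> x + \<eta> y) \<and>
     (\<forall>c. \<forall>x\<in>carrier (L0 L). \<eta> (c \<odot>\<^bsub>L0 L\<^esub> x) = scale c (\<eta> x))"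
  by (auto simp: family_def family_upto_def mixed_def)

context hemistrict_lie_2_algebra
begin

sublocale M0: module scalars "L0 L" by (rule L0_vspace)
sublocale Mm: module scalars "Lm L" by (rule Lm_vspace)

lemma scalars_carrier [simp]: "c \<in> carrier scalars" "\<zero>\<^bsub>scalars\<^esub> = 0" "\<one>\<^bsub>scalars\<^esub> = 1"
  by (simp_all add: scalars_def)

lemma closed [simp]:
  "\<alpha> \<in> carrier (Lm L) \<Longrightarrow> dd L \<alpha> \<in> carrier (L0 L)"
  "x \<in> carrier (L0 L) \<Longrightarrow> y \<in> carrier (L0 L) \<Longrightarrow> br L x y \<in> carrier (L0 L)"
  "x \<in> carrier (L0 L) \<Longrightarrow> \<alpha> \<in> carrier (Lm L) \<Longrightarrow> brR L x \<alpha> \<in> carrier (Lm L)"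
  "x \<in> carrier (L0 L) \<Longrightarrow> \<alpha> \<in> carrier (Lm L) \<Longrightarrow> brL L \<alpha> x \<in> carrier (Lm L)"
  "x \<in> carrier (L0 L) \<Longrightarrow> y \<in> carrier (L0 L) \<Longrightarrow> h2 L x y \<in> carrier (Lm L)"
  using dd_linear br_bilinear brR_bilinear brL_bilinear h2_bilinear
  by (auto simp: bilinear_maps_def linear_maps_def)

lemma lin [simp]:
  "\<alpha> \<in> carrier (Lm L) \<Longrightarrow> \<beta> \<in> carrier (Lm L) \<Longrightarrow> dd L (\<alpha> \<oplus>\<^bsub>Lm L\<^esub> \<beta>) = dd L \<alpha> \<oplus>\<^bsub>L0 L\<^esub> dd L \<beta>"
  "\<alpha> \<in> carrier (Lm L) \<Longrightarrow> dd L (c \<odot>\<^bsub>Lm L\<^esub> \<alpha>) = c \<odot>\<^bsub>L0 L\<^esub> dd L \<alpha>"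
  using dd_linear by (auto simp: linear_maps_def)

lemma bilin_0 [simp]:
  "x \<in> carrier (L0 L) \<Longrightarrow> y \<in> carrier (L0 L) \<Longrightarrow> z \<in> carrier (L0 L) \<Longrightarrow> br L x (y \<oplus>\<^bsub>L0 L\<^esub> z) = br L x y \<oplus>\<^bsub>L0 L\<^esub> br L x z"
  "x \<in> carrier (L0 L) \<Longrightarrow> y \<in> carrier (L0 L) \<Longrightarrow> z \<in> carrier (L0 L) \<Longrightarrow> br L (x \<oplus>\<^bsub>L0 L\<^esub> y) z = br L x z \<oplus>\<^bsub>L0 L\<^esub> br L y z"
  "x \<in> carrier (L0 L) \<Longrightarrow> y \<in> carrier (L0 L) \<Longrightarrow> br L x (c \<odot>\<^bsub>L0 L\<^esub> y) = c \<odot>\<^bsub>L0 L\<^esub> br L x y"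
  "x \<in> carrier (L0 L) \<Longrightarrow> y \<in> carrier (L0 L) \<Longrightarrow> br L (c \<odot>\<^bsub>L0 L\<^esub> x) y = c \<odot>\<^bsub>L0 L\<^esub> br L x y"
  "x \<in> carrier (L0 L) \<Longrightarrow> y \<in> carrier (L0 L) \<Longrightarrow> z \<in> carrier (L0 L) \<Longrightarrow> h2 L x (y \<oplus>\<^bsub>L0 L\<^esub> z) = h2 L x y \<oplus>\<^bsub>Lm L\<^esub> h2 L x z"
  "x \<in> carrier (L0 L) \<Longrightarrow> y \<in> carrier (L0 L) \<Longrightarrow> z \<in> carrier (L0 L) \<Longrightarrow> h2 L (x \<oplus>\<^bsub>L0 L\<^esub> y) z = h2 L x z \<oplus>\<^bsub>Lm L\<^esub> h2 L y z"
  "x \<in> carrier (L0 L) \<Longrightarrow> y \<in> carrier (L0 L) \<Longrightarrow> h2 L x (c \<odot>\<^bsub>L0 L\<^esub> y) = c \<odot>\<^bsub>Lm L\<^esub> h2 L x y"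
  "x \<in> carrier (L0 L) \<Longrightarrow> y \<in> carrier (L0 L) \<Longrightarrow> h2 L (c \<odot>\<^bsub>L0 L\<^esub> x) y = c \<odot>\<^bsub>Lm L\<^esub> h2 L x y"
  using br_bilinear h2_bilinear
  by (auto simp: bilinear_maps_def linear_maps_def)

lemma bilin_m [simp]:
  "x \<in> carrier (L0 L) \<Longrightarrow> \<alpha> \<in> carrier (Lm L) \<Longrightarrow> \<beta> \<in> carrier (Lm L) \<Longrightarrow> brR L x (\<alpha> \<oplus>\<^bsub>Lm L\<^esub> \<beta>) = brR L x \<alpha> \<oplus>\<^bsub>Lm L\<^esub> brR L x \<beta>"
  "x \<in> carrier (L0 L) \<Longrightarrow> y \<in> carrier (L0 L) \<Longrightarrow> \<alpha> \<in> carrier (Lm L) \<Longrightarrow> brR L (x \<oplus>\<^bsub>L0 L\<^esub> y) \<alpha> = brR L x \<alpha> \<oplus>\<^bsub>Lm L\<^esub> brR L y \<alpha>"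
  "x \<in> carrier (L0 L) \<Longrightarrow> \<alpha> \<in> carrier (Lm L) \<Longrightarrow> brR L x (c \<odot>\<^bsub>Lm L\<^esub> \<alpha>) = c \<odot>\<^bsub>Lm L\<^esub> brR L x \<alpha>"
  "x \<in> carrier (L0 L) \<Longrightarrow> \<alpha> \<in> carrier (Lm L) \<Longrightarrow> brR L (c \<odot>\<^bsub>L0 L\<^esub> x) \<alpha> = c \<odot>\<^bsub>Lm L\<^esub> brR L x \<alpha>"
  "x \<in> carrier (L0 L) \<Longrightarrow> y \<in> carrier (L0 L) \<Longrightarrow> \<alpha> \<in> carrier (Lm L) \<Longrightarrow> brL L \<alpha> (x \<oplus>\<^bsub>L0 L\<^esub> y) = brL L \<alpha> x \<oplus>\<^bsub>Lm L\<^esub> brL L \<alpha> y"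
  "x \<in> carrier (L0 L) \<Longrightarrow> \<alpha> \<in> carrier (Lm L) \<Longrightarrow> \<beta> \<in> carrier (Lm L) \<Longrightarrow> brL L (\<alpha> \<oplus>\<^bsub>Lm L\<^esub> \<beta>) x = brL L \<alpha> x \<oplus>\<^bsub>Lm L\<^esub> brL L \<beta> x"
  "x \<in> carrier (L0 L) \<Longrightarrow> \<alpha> \<in> carrier (Lm L) \<Longrightarrow> brL L \<alpha> (c \<odot>\<^bsub>L0 L\<^esub> x) = c \<odot>\<^bsub>Lm L\<^esub> brL L \<alpha> x"
  "x \<in> carrier (L0 L) \<Longrightarrow> \<alpha> \<in> carrier (Lm L) \<Longrightarrow> brL L (c \<odot>\<^bsub>Lm L\<^esub> \<alpha>) x = c \<odot>\<^bsub>Lm L\<^esub> brL L \<alpha> x"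
  using brR_bilinear brL_bilinear
  by (auto simp: bilinear_maps_def linear_maps_def)

lemma smult_minus1:
  "x \<in> carrier (L0 L) \<Longrightarrow> (-1) \<odot>\<^bsub>L0 L\<^esub> x = \<ominus>\<^bsub>L0 L\<^esub> x"
  "\<alpha> \<in> carrier (Lm L) \<Longrightarrow> (-1) \<odot>\<^bsub>Lm L\<^esub> \<alpha> = \<ominus>\<^bsub>Lm L\<^esub> \<alpha>"
proof -
  have "\<ominus>\<^bsub>scalars\<^esub> 1 = (-1 :: 'k)"
    using M0.R.minus_equality[of "-1" 1] by (simp add: scalars_def)
  then show "x \<in> carrier (L0 L) \<Longrightarrow> (-1) \<odot>\<^bsub>L0 L\<^esub> x = \<ominus>\<^bsub>L0 L\<^esub> x"
    "\<alpha> \<in> carrier (Lm L) \<Longrightarrow> (-1) \<odot>\<^bsub>Lm L\<^esub> \<alpha> = \<ominus>\<^bsub>Lm L\<^esub> \<alpha>"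
    using M0.smult_l_minus[of 1 x] Mm.smult_l_minus[of 1 \<alpha>] M0.smult_one[of x] Mm.smult_one[of \<alpha>]
    by simp_all
qed

lemma contraction_linear [simp]:
  assumes "front L \<omega>"
  shows "x \<in> carrier (L0 L) \<Longrightarrow> y \<in> carrier (L0 L) \<Longrightarrow> \<iota> (x \<oplus>\<^bsub>L0 L\<^esub> y) \<omega> = \<iota> x \<omega> + \<iota> y \<omega>"
    and "x \<in> carrier (L0 L) \<Longrightarrow> \<iota> (c \<odot>\<^bsub>L0 L\<^esub> x) \<omega> = scale c (\<iota> x \<omega>)"
    and "\<alpha> \<in> carrier (Lm L) \<Longrightarrow> \<beta> \<in> carrier (Lm L) \<Longrightarrow> \<kappa> (\<alpha> \<oplus>\<^bsub>Lm L\<^esub> \<beta>) \<omega> = \<kappa> \<alpha> \<omega> + \<kappa> \<beta> \<omega>"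
    and "\<alpha> \<in> carrier (Lm L) \<Longrightarrow> \<kappa> (c \<odot>\<^bsub>Lm L\<^esub> \<alpha>) \<omega> = scale c (\<kappa> \<alpha> \<omega>)"
    and "x \<in> carrier (L0 L) \<Longrightarrow> y \<in> carrier (L0 L) \<Longrightarrow> \<iota> (x \<ominus>\<^bsub>L0 L\<^esub> y) \<omega> = \<iota> x \<omega> - \<iota> y \<omega>"
    and "\<alpha> \<in> carrier (Lm L) \<Longrightarrow> \<beta> \<in> carrier (Lm L) \<Longrightarrow> \<kappa> (\<alpha> \<ominus>\<^bsub>Lm L\<^esub> \<beta>) \<omega> = \<kappa> \<alpha> \<omega> - \<kappa> \<beta> \<omega>"
    and "\<iota> \<zero>\<^bsub>L0 L\<^esub> \<omega> = 0" and "\<kappa> \<zero>\<^bsub>Lm L\<^esub> \<omega> = 0"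
  using frontD[OF assms] frontD(2)[OF assms, of "\<zero>\<^bsub>L0 L\<^esub>" 0] frontD(4)[OF assms, of "\<zero>\<^bsub>Lm L\<^esub>" 0]
    frontD(2)[OF assms, of y "-1"] frontD(4)[OF assms, of \<beta> "-1"]
  by (simp_all add: a_minus_def smult_minus1)

text \<open>Two contractions of a wedge product are \<open>\<iota>\<^sub>x \<iota>\<^sub>y (wedge \<eta>) = \<iota>\<^sub>x (\<eta> y) - \<iota>\<^sub>y (\<eta> x) + wedge (\<iota>\<^sub>x \<iota>\<^sub>y \<eta>)\<close>. In the
  symmetrisation the first two terms cancel and the relation for the members of the
  family remains.\<close>

lemma wedge_mixed_upto: "family_upto L n \<eta> \<Longrightarrow> mixed_upto L n (wedge L \<eta>)"
proof (induction n arbitrary: \<eta>)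
  case (Suc n)
  have fr: "front L (\<eta> x)" "\<eta> x \<in> supported L" "mixed_upto L n (\<eta> x)"
      "y \<in> carrier (L0 L) \<Longrightarrow> mixed_upto L n (\<iota> y (\<eta> x))" "\<alpha> \<in> carrier (Lm L) \<Longrightarrow> mixed_upto L n (\<kappa> \<alpha> (\<eta> x))"
    if "x \<in> carrier (L0 L)" for x y \<alpha>
  proof -
    have *: "mixed_upto L (Suc n) (\<eta> x)" using Suc.prems that by (simp add: family_upto_def)
    show "front L (\<eta> x)" "\<eta> x \<in> supported L" "mixed_upto L n (\<eta> x)"
        "y \<in> carrier (L0 L) \<Longrightarrow> mixed_upto L n (\<iota> y (\<eta> x))" "\<alpha> \<in> carrier (Lm L) \<Longrightarrow> mixed_upto L n (\<kappa> \<alpha> (\<eta> x))"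
      using mixed_upto_SucD[OF *] mixed_upto_Suc[OF *] by simp_all
  qed
  have li: "\<eta> (x \<oplus>\<^bsub>L0 L\<^esub> y) = \<eta> x + \<eta> y" "\<eta> (c \<odot>\<^bsub>L0 L\<^esub> y) = scale c (\<eta> y)"
    if "x \<in> carrier (L0 L)" "y \<in> carrier (L0 L)" for x y c
    using Suc.prems that by (simp_all add: family_upto_def)
  have "family_upto L n (\<lambda>z. \<iota> y (\<eta> z))" if "y \<in> carrier (L0 L)" for y
    using that by (simp add: family_upto_def fr li)
  then have 1: "mixed_upto L n (\<iota> y (wedge L \<eta>))" if "y \<in> carrier (L0 L)" for y
    using that Suc.IH by (simp add: \<iota>_wedge fr)
  have "family_upto L n (\<lambda>z. \<kappa> \<alpha> (\<eta> z))" if "\<alpha> \<in> carrier (Lm L)" for \<alpha>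
    using that by (simp add: family_upto_def fr li)
  then have 2: "mixed_upto L n (\<kappa> \<alpha> (wedge L \<eta>))" if "\<alpha> \<in> carrier (Lm L)" for \<alpha>
    using that Suc.IH by (simp add: \<kappa>_wedge)
  have 3: "\<iota> x (\<iota> y (wedge L \<eta>)) + \<iota> y (\<iota> x (wedge L \<eta>)) = - \<kappa> (h2 L x y) (wedge L \<eta>)"
    if xy: "x \<in> carrier (L0 L)" "y \<in> carrier (L0 L)" for x y
  proof -
    have "wedge L (\<lambda>z. \<iota> x (\<iota> y (\<eta> z))) = wedge L (\<lambda>z. - \<iota> y (\<iota> x (\<eta> z)) - \<kappa> (h2 L x y) (\<eta> z))"
      using xy by (intro wedge_cong refl front_\<iota>\<iota> fr)
    then show ?thesis
      using xy by (simp add: \<iota>_wedge \<kappa>_wedge fr wedge_linear)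
  qed
  have 4: "wedge L (\<lambda>z. \<kappa> \<alpha> (\<kappa> \<beta> (\<eta> z))) = wedge L (\<lambda>z. \<kappa> \<beta> (\<kappa> \<alpha> (\<eta> z)))"
    if "\<alpha> \<in> carrier (Lm L)" "\<beta> \<in> carrier (Lm L)" for \<alpha> \<beta>
    using that by (intro wedge_cong refl front_\<kappa>\<kappa>[OF fr(1)])
  have li': "\<eta> (c \<odot>\<^bsub>L0 L\<^esub> x) = scale c (\<eta> x)" if "x \<in> carrier (L0 L)" for x c
    using li(2)[OF that that] .
  have "front L (wedge L \<eta>)"
    unfolding front_def
    by (intro conjI ballI allI) (rule 3, assumption, assumption | simp add: 4 \<iota>_wedge \<kappa>_wedge fr li(1) li' wedge_linear scale_linear)+
  then show ?case using 1 2 by (intro mixed_upto_SucI) simp_all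
qed simp

lemma wedge_mixed: "family L \<eta> \<Longrightarrow> mixed L (wedge L \<eta>)"
  by (simp add: mixed_def family_def wedge_mixed_upto)

end

section \<open>Cartan calculus\<close>

lemma sum_triangle_shift:
  fixes g :: "nat \<Rightarrow> nat \<Rightarrow> 'c::comm_monoid_add"
  shows "(\<Sum>j<Suc n. \<Sum>i<j. g i j) = (\<Sum>j<n. g 0 (Suc j)) + (\<Sum>j<n. \<Sum>i<j. g (Suc i) (Suc j))"
proof -
  have "(\<Sum>j<Suc n. \<Sum>i<j. g i j) = (\<Sum>j<n. \<Sum>i<Suc j. g i (Suc j))"
    by (subst sum.lessThan_Suc_shift) simp
  then show ?thesis
    by (simp only: sum.lessThan_Suc_shift sum.distrib)
qed

text \<open>Symmetry in the arguments from \<open>L\<^sup>-\<^sup>1\<close>: an argument may be replaced in place or at the front.\<close>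

lemma mixed_\<kappa>_replace:
  assumes "mixed L \<omega>" "as \<in> lists (carrier (Lm L))" "j < length as" "\<beta> \<in> carrier (Lm L)"
  shows "\<kappa> \<beta> \<omega> xs (nths as (- {j})) = \<omega> xs (as[j := \<beta>])"
  using assms
proof (induction as arbitrary: \<omega> j rule: list.induct)
  case (Cons \<alpha> as)
  show ?case
  proof (cases j)
    case (Suc i)
    have "\<kappa> \<beta> \<omega> xs (\<alpha> # nths as (- {i})) = \<kappa> \<alpha> (\<kappa> \<beta> \<omega>) xs (nths as (- {i}))"
      by (simp add: \<kappa>_def)
    also have "\<kappa> \<alpha> (\<kappa> \<beta> \<omega>) = \<kappa> \<beta> (\<kappa> \<alpha> \<omega>)"
      using Cons.prems by (intro front_\<kappa>\<kappa>) auto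
    also have "\<dots> xs (nths as (- {i})) = \<kappa> \<alpha> \<omega> xs (as[i := \<beta>])"
      using Cons.prems Suc by (intro Cons.IH) auto
    finally show ?thesis by (simp add: Suc \<kappa>_def)
  qed (simp add: \<kappa>_def)
qed simp

context hemistrict_lie_2_algebra
begin

lemma \<iota>_Lie:
  assumes "x \<in> carrier (L0 L)" "y \<in> carrier (L0 L)" "\<omega> \<in> supported L"
  shows "\<iota> y (Lie L x \<omega>) = Lie L x (\<iota> y \<omega>) - \<iota> (br L x y) \<omega>"
proof (rule supported_eqI[of _ L])
  fix xs as assume "args L xs as"
  then show "\<iota> y (Lie L x \<omega>) xs as = (Lie L x (\<iota> y \<omega>) - \<iota> (br L x y) \<omega>) xs as"
    using assms by (simp add: \<iota>_def Lie_def pointwise sum.lessThan_Suc_shift del: sum.lessThan_Suc)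
qed (use assms in simp_all)

lemma \<kappa>_Lie:
  assumes "x \<in> carrier (L0 L)" "\<alpha> \<in> carrier (Lm L)" "\<omega> \<in> supported L"
  shows "\<kappa> \<alpha> (Lie L x \<omega>) = Lie L x (\<kappa> \<alpha> \<omega>) - \<kappa> (brR L x \<alpha>) \<omega>"
proof (rule supported_eqI[of _ L])
  fix xs as assume "args L xs as"
  then show "\<kappa> \<alpha> (Lie L x \<omega>) xs as = (Lie L x (\<kappa> \<alpha> \<omega>) - \<kappa> (brR L x \<alpha>) \<omega>) xs as"
    using assms by (simp add: \<kappa>_def Lie_def pointwise sum.lessThan_Suc_shift del: sum.lessThan_Suc)
qed (use assms in simp_all)

text \<open>The relation between \<open>\<iota>\<^sub>y\<close> and \<open>\<iota>\<^sub>z\<close> is preserved because the action of \<open>x\<close> is a derivation of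
  \<open>h2\<close>.\<close>

lemma Lie_mixed_upto:
  assumes x: "x \<in> carrier (L0 L)"
  shows "mixed_upto L n \<omega> \<Longrightarrow> mixed_upto L n (Lie L x \<omega>)"
proof (induction n arbitrary: \<omega>)
  case (Suc n)
  note \<omega> [simp] = mixed_upto_SucD[OF Suc.prems]
  note rules = \<iota>_Lie[OF x] \<kappa>_Lie[OF x] Lie_linear
  have 1: "\<iota> y (\<iota> z (Lie L x \<omega>)) + \<iota> z (\<iota> y (Lie L x \<omega>)) = - \<kappa> (h2 L y z) (Lie L x \<omega>)"
    if yz: "y \<in> carrier (L0 L)" "z \<in> carrier (L0 L)" for y z
  proof -
    have "Lie L x (\<iota> y (\<iota> z \<omega>)) = Lie L x (- \<iota> z (\<iota> y \<omega>) - \<kappa> (h2 L y z) \<omega>)"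
      by (simp only: front_\<iota>\<iota>[OF \<omega>(2) yz])
    moreover have "\<iota> (br L x y) (\<iota> z \<omega>) = - \<iota> z (\<iota> (br L x y) \<omega>) - \<kappa> (h2 L (br L x y) z) \<omega>"
      "\<iota> y (\<iota> (br L x z) \<omega>) = - \<iota> (br L x z) (\<iota> y \<omega>) - \<kappa> (h2 L y (br L x z)) \<omega>"
      by (rule front_\<iota>\<iota>[OF \<omega>(2) closed(2)[OF x yz(1)] yz(2)],
          rule front_\<iota>\<iota>[OF \<omega>(2) yz(1) closed(2)[OF x yz(2)]])
    ultimately show ?thesis
      using yz x by (simp add: rules brR_h2)
  qed
  have 2: "\<kappa> \<alpha> (\<kappa> \<beta> (Lie L x \<omega>)) = \<kappa> \<beta> (\<kappa> \<alpha> (Lie L x \<omega>))"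
    if ab: "\<alpha> \<in> carrier (Lm L)" "\<beta> \<in> carrier (Lm L)" for \<alpha> \<beta>
    using ab x front_\<kappa>\<kappa>[OF \<omega>(2), of \<alpha> \<beta>] front_\<kappa>\<kappa>[OF \<omega>(2), of "brR L x \<alpha>" \<beta>]
      front_\<kappa>\<kappa>[OF \<omega>(2), of \<alpha> "brR L x \<beta>"]
    by (simp add: rules)
  have "front L (Lie L x \<omega>)"
    unfolding front_def using x
    by (intro conjI ballI allI)
      (rule 1 2; assumption | simp add: rules scale_linear)+
  then show ?case
    using Suc x by (intro mixed_upto_SucI) (simp_all add: rules)
qed simp

lemma Lie_mixed [simp]: "x \<in> carrier (L0 L) \<Longrightarrow> mixed L \<omega> \<Longrightarrow> mixed L (Lie L x \<omega>)"
  by (simp add: mixed_def Lie_mixed_upto)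

text \<open>The special case of operators that commute with contractions up to a factor.\<close>

lemma contraction_unique_strict:
  fixes E :: "('k, 'a, 'b) cochain \<Rightarrow> ('k, 'a, 'b) cochain"
  assumes "mixed L \<omega>" "\<And>\<omega>. mixed L \<omega> \<Longrightarrow> E \<omega> \<in> supported L" "\<And>\<omega>. mixed L \<omega> \<Longrightarrow> E \<omega> [] [] = 0"
    and "\<And>\<alpha> \<omega>. mixed L \<omega> \<Longrightarrow> \<alpha> \<in> carrier (Lm L) \<Longrightarrow> \<kappa> \<alpha> (E \<omega>) = E (\<kappa> \<alpha> \<omega>)"
    and "\<And>x \<omega>. mixed L \<omega> \<Longrightarrow> x \<in> carrier (L0 L) \<Longrightarrow> \<iota> x (E \<omega>) = scale c (E (\<iota> x \<omega>))"
  shows "E \<omega> = 0"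
proof (rule contraction_unique[where P = "mixed L" and E = E and L = L])
  fix \<omega> x assume \<omega>: "mixed L \<omega>" and x: "x \<in> carrier (L0 L)"
  show "\<exists>q c r c'. mixed L q \<and> (\<forall>z\<in>carrier (L0 L). mixed L (r z)) \<and>
      \<iota> x (E \<omega>) = scale c (E q) + scale c' (wedge L (\<lambda>z. E (r z)))"
    using assms(5)[OF \<omega> x] \<omega> x
    by (intro exI[of _ "\<iota> x \<omega>"] exI[of _ c] exI[of _ "\<lambda>_. \<omega>"] exI[of _ 0]) simp
next
  fix \<omega> \<alpha> as assume \<omega>: "mixed L \<omega>" and \<alpha>: "\<alpha> \<in> carrier (Lm L)"
  show "\<exists>q c. mixed L q \<and> \<kappa> \<alpha> (E \<omega>) [] as = c * E q [] as"
    using assms(4)[OF \<omega> \<alpha>] \<omega> \<alpha> by (intro exI[of _ "\<kappa> \<alpha> \<omega>"] exI[of _ 1]) simp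
qed (use assms in auto)

lemma Lie_add_vec:
  assumes "x \<in> carrier (L0 L)" "y \<in> carrier (L0 L)" "mixed L \<omega>"
  shows "Lie L (x \<oplus>\<^bsub>L0 L\<^esub> y) \<omega> = Lie L x \<omega> + Lie L y \<omega>"
proof -
  have "Lie L (x \<oplus>\<^bsub>L0 L\<^esub> y) \<omega> - Lie L x \<omega> - Lie L y \<omega> = 0"
    by (rule contraction_unique_strict[of _ _ 1])
      (use assms in \<open>simp_all add: \<iota>_Lie \<kappa>_Lie, simp_all add: Lie_def pointwise\<close>)
  then show ?thesis by (simp add: algebra_simps)
qed

lemma Lie_smult_vec:
  assumes "x \<in> carrier (L0 L)" "mixed L \<omega>"
  shows "Lie L (c \<odot>\<^bsub>L0 L\<^esub> x) \<omega> = scale c (Lie L x \<omega>)"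
proof -
  have "Lie L (c \<odot>\<^bsub>L0 L\<^esub> x) \<omega> - scale c (Lie L x \<omega>) = 0"
    by (rule contraction_unique_strict[of _ _ 1])
      (use assms in \<open>simp_all add: \<iota>_Lie \<kappa>_Lie scale_linear, simp_all add: Lie_def scale_def pointwise\<close>)
  then show ?thesis by (simp add: algebra_simps)
qed

lemma Lie_commutator:
  assumes "x \<in> carrier (L0 L)" "y \<in> carrier (L0 L)" "mixed L \<omega>"
  shows "Lie L x (Lie L y \<omega>) - Lie L y (Lie L x \<omega>) = Lie L (br L x y) \<omega>"
proof -
  have "Lie L x (Lie L y \<omega>) - Lie L y (Lie L x \<omega>) - Lie L (br L x y) \<omega> = 0"
    by (rule contraction_unique_strict[of _ _ 1])
      (use assms in \<open>simp_all add: \<iota>_Lie \<kappa>_Lie Lie_linear Leibniz[OF assms(1,2)] Leibniz_3[OF assms(1,2)], simp_all add: Lie_def pointwise\<close>)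
  then show ?thesis by (simp add: algebra_simps)
qed

text \<open>Cartan's formula. The terms of \<open>D \<omega>\<close> in which \<open>x\<close> is merely carried along have opposite signs in
  \<open>D (\<iota>\<^sub>x \<omega>)\<close>, and those in which \<open>x\<close> acts on another element of \<open>L\<^sup>0\<close> are part of the Lie
  derivative. For the arguments \<open>\<alpha>\<close> the sum contains \<open>\<omega>(d\<alpha>, x, \<dots>)\<close> instead of \<open>- \<omega>(x, d\<alpha>, \<dots>)\<close>
  and the right action \<open>[\<alpha>, x]\<close>. Interchanging \<open>d\<alpha>\<close> and \<open>x\<close> costs a term with
  \<open>h2(x, d\<alpha>) = [x, \<alpha>] + [\<alpha>, x]\<close>, which turns the right action into minus the left action.\<close>

lemma \<iota>_D:
  assumes x: "x \<in> carrier (L0 L)" and \<omega>: "mixed L \<omega>"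
  shows "\<iota> x (D L \<omega>) = Lie L x \<omega> - D L (\<iota> x \<omega>)"
proof (rule supported_eqI[of _ L])
  fix xs as assume a: "args L xs as"
  have as: "as ! j \<in> carrier (Lm L)" if "j < length as" for j
    using a that by (auto simp: in_lists_conv_set)
  have 1: "\<omega> (dd L (as ! j) # x # xs) (nths as (- {j})) =
      - \<omega> (x # dd L (as ! j) # xs) (nths as (- {j}))
      - \<omega> xs (as[j := brL L (as ! j) x]) - \<omega> xs (as[j := brR L x (as ! j)])"
    if "j < length as" for j
  proof -
    have "\<kappa> (h2 L x (dd L (as ! j))) \<omega> xs (nths as (- {j})) =
        \<kappa> (brR L x (as ! j)) \<omega> xs (nths as (- {j})) + \<kappa> (brL L (as ! j) x) \<omega> xs (nths as (- {j}))"
      using as[OF that] x \<omega> by (simp flip: brR_brL_anti add: pointwise)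
    moreover have "\<iota> x (\<iota> (dd L (as ! j)) \<omega>) xs (nths as (- {j})) =
        - \<iota> (dd L (as ! j)) (\<iota> x \<omega>) xs (nths as (- {j}))
        - \<kappa> (h2 L x (dd L (as ! j))) \<omega> xs (nths as (- {j}))"
      using as[OF that] x \<omega> by (subst front_\<iota>\<iota>[OF mixed_front[OF \<omega>]]) (simp_all add: pointwise)
    ultimately show ?thesis
      using as[OF that] a that x by (simp add: mixed_\<kappa>_replace[OF \<omega>] \<iota>_def)
  qed
  show "\<iota> x (D L \<omega>) xs as = (Lie L x \<omega> - D L (\<iota> x \<omega>)) xs as"
    using a x
    by (simp add: D_def Lie_def \<iota>_def pointwise sum_triangle_shift sum.lessThan_Suc_shift 1
        sum.distrib sum_subtractf sum_negf algebra_simps del: sum.lessThan_Suc)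
qed (use assms in simp_all)

lemma \<kappa>_D:
  assumes "\<alpha> \<in> carrier (Lm L)" and \<omega>: "\<omega> \<in> supported L"
  shows "\<kappa> \<alpha> (D L \<omega>) = D L (\<kappa> \<alpha> \<omega>) + Liem L \<alpha> \<omega>"
proof (rule supported_eqI[of _ L])
  fix xs as assume a: "args L xs as"
  then show "\<kappa> \<alpha> (D L \<omega>) xs as = (D L (\<kappa> \<alpha> \<omega>) + Liem L \<alpha> \<omega>) xs as"
    using assms
    by (simp add: D_def Liem_def \<kappa>_def \<iota>_def wedge_def pointwise sum.lessThan_Suc_shift
        sum.distrib sum_distrib_left algebra_simps del: sum.lessThan_Suc)
qed (use assms in simp_all)

end

context hemistrict_lie_2_algebra
begin

text \<open>The contraction with \<open>d\<alpha>\<close> and the wedge product both anticommute with \<open>\<iota>\<^sub>y\<close> up to a correction,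
  by \<open>h2(y, d\<alpha>)\<close> and by \<open>[\<alpha>, y]\<close>; their difference is \<open>[y, \<alpha>]\<close>.\<close>

lemma \<iota>_Liem:
  assumes "y \<in> carrier (L0 L)" "\<alpha> \<in> carrier (Lm L)" "mixed L \<omega>"
  shows "\<iota> y (Liem L \<alpha> \<omega>) = - Liem L \<alpha> (\<iota> y \<omega>) - \<kappa> (brR L y \<alpha>) \<omega>"
proof -
  have "\<iota> y (\<iota> (dd L \<alpha>) \<omega>) = - \<iota> (dd L \<alpha>) (\<iota> y \<omega>) - \<kappa> (h2 L y (dd L \<alpha>)) \<omega>"
    using assms by (intro front_\<iota>\<iota>) simp_all
  moreover have "\<kappa> (h2 L y (dd L \<alpha>)) \<omega> = \<kappa> (brR L y \<alpha>) \<omega> + \<kappa> (brL L \<alpha> y) \<omega>"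
    using assms by (simp flip: brR_brL_anti)
  ultimately show ?thesis
    using assms by (simp add: Liem_def \<iota>_wedge \<iota>_\<kappa>)
qed

lemma \<kappa>_Liem:
  assumes "\<alpha> \<in> carrier (Lm L)" "\<beta> \<in> carrier (Lm L)" "mixed L \<omega>"
  shows "\<kappa> \<beta> (Liem L \<alpha> \<omega>) = Liem L \<alpha> (\<kappa> \<beta> \<omega>)"
proof -
  have "wedge L (\<lambda>z. \<kappa> \<beta> (\<kappa> (brL L \<alpha> z) \<omega>)) = wedge L (\<lambda>z. \<kappa> (brL L \<alpha> z) (\<kappa> \<beta> \<omega>))"
    using assms by (intro wedge_cong refl front_\<kappa>\<kappa>[of L]) simp_all
  then show ?thesis
    using assms by (simp add: Liem_def \<kappa>_wedge \<iota>_\<kappa>)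
qed

lemma Liem_mixed [simp]: "\<alpha> \<in> carrier (Lm L) \<Longrightarrow> mixed L \<omega> \<Longrightarrow> mixed L (Liem L \<alpha> \<omega>)"
  unfolding Liem_def by (intro mixed_closed wedge_mixed) (simp_all add: family_iff)

lemma Liem_add_vec:
  "\<alpha> \<in> carrier (Lm L) \<Longrightarrow> \<beta> \<in> carrier (Lm L) \<Longrightarrow> mixed L \<omega> \<Longrightarrow>
    Liem L (\<alpha> \<oplus>\<^bsub>Lm L\<^esub> \<beta>) \<omega> = Liem L \<alpha> \<omega> + Liem L \<beta> \<omega>"
  by (simp add: Liem_def wedge_linear)

lemma Liem_smult_vec:
  "\<alpha> \<in> carrier (Lm L) \<Longrightarrow> mixed L \<omega> \<Longrightarrow> Liem L (c \<odot>\<^bsub>Lm L\<^esub> \<alpha>) \<omega> = scale c (Liem L \<alpha> \<omega>)"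
  by (simp add: Liem_def wedge_linear scale_linear)

lemma Lie_wedge:
  assumes x: "x \<in> carrier (L0 L)" and \<eta>: "\<And>z. z \<in> carrier (L0 L) \<Longrightarrow> \<eta> z \<in> supported L"
  shows "Lie L x (wedge L \<eta>) = wedge L (\<lambda>z. Lie L x (\<eta> z)) - wedge L (\<lambda>z. \<eta> (br L x z))"
proof -
  let ?E = "\<lambda>\<eta>. Lie L x (wedge L \<eta>) - wedge L (\<lambda>z. Lie L x (\<eta> z)) + wedge L (\<lambda>z. \<eta> (br L x z))"
  let ?P = "\<lambda>\<eta>. \<forall>z\<in>carrier (L0 L). \<eta> z \<in> supported L"
  have "?E \<eta> = 0"
  proof (rule contraction_unique[where P = ?P and E = ?E and L = L])
    fix \<eta> y assume P: "?P \<eta>" and y: "y \<in> carrier (L0 L)"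
    have "\<iota> y (?E \<eta>) = - ?E (\<lambda>z. \<iota> y (\<eta> z))"
      using P x y by (simp add: \<iota>_wedge \<iota>_Lie wedge_linear Lie_linear)
    then show "\<exists>q c r c'. ?P q \<and> (\<forall>z\<in>carrier (L0 L). ?P (r z)) \<and>
        \<iota> y (?E \<eta>) = scale c (?E q) + scale c' (wedge L (\<lambda>z. ?E (r z)))"
      using P by (intro exI[of _ "\<lambda>z. \<iota> y (\<eta> z)"] exI[of _ "-1"] exI[of _ "\<lambda>_. \<eta>"] exI[of _ 0]) simp
  next
    fix \<eta> \<alpha> as assume P: "?P \<eta>"
    show "\<exists>q c. ?P q \<and> \<kappa> \<alpha> (?E \<eta>) [] as = c * ?E q [] as"
      using P by (intro exI[of _ \<eta>] exI[of _ 0]) (simp add: \<kappa>_def Lie_def pointwise)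
  qed (use \<eta> in simp_all, simp add: Lie_def pointwise)
  then show ?thesis by (simp add: algebra_simps)
qed

lemma Lie_Liem:
  assumes "y \<in> carrier (L0 L)" "\<alpha> \<in> carrier (Lm L)" "mixed L \<omega>"
  shows "Lie L y (Liem L \<alpha> \<omega>) = Liem L \<alpha> (Lie L y \<omega>) + Liem L (brR L y \<alpha>) \<omega>"
  using assms
  by (simp add: Liem_def Lie_wedge Lie_linear \<iota>_Lie \<kappa>_Lie derivation_R Leibniz_2 wedge_linear)

lemma Lie_D:
  assumes x: "x \<in> carrier (L0 L)" and \<omega>: "mixed L \<omega>"
  shows "Lie L x (D L \<omega>) = D L (Lie L x \<omega>)"
proof -
  have "Lie L x (D L \<omega>) - D L (Lie L x \<omega>) = 0"
  proof (rule contraction_unique_strict[where c = "-1" and E = "\<lambda>\<omega>. Lie L x (D L \<omega>) - D L (Lie L x \<omega>)"])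
    fix y \<omega> assume \<omega>: "mixed L \<omega>" and y: "y \<in> carrier (L0 L)"
    show "\<iota> y (Lie L x (D L \<omega>) - D L (Lie L x \<omega>)) =
        scale (-1) (Lie L x (D L (\<iota> y \<omega>)) - D L (Lie L x (\<iota> y \<omega>)))"
      using x y \<omega> by (simp add: \<iota>_Lie \<iota>_D Lie_linear D_linear flip: Lie_commutator[of x y])
  next
    fix \<alpha> \<omega> assume \<omega>: "mixed L \<omega>" and \<alpha>: "\<alpha> \<in> carrier (Lm L)"
    show "\<kappa> \<alpha> (Lie L x (D L \<omega>) - D L (Lie L x \<omega>)) =
        Lie L x (D L (\<kappa> \<alpha> \<omega>)) - D L (Lie L x (\<kappa> \<alpha> \<omega>))"
      using x \<alpha> \<omega> by (simp add: \<kappa>_Lie \<kappa>_D Lie_linear D_linear Lie_Liem)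
  qed (use \<omega> in simp_all, simp add: Lie_def D_def pointwise)
  then show ?thesis by simp
qed

text \<open>The obstruction \<open>h2(d\<alpha>, d\<beta>) - [d\<alpha>, \<beta>] - [d\<beta>, \<alpha>]\<close> appears at the empty lists. It vanishes because
  \<open>h2(d\<alpha>, d\<beta>) = [d\<alpha>, \<beta>] + [\<beta>, d\<alpha>]\<close> and because \<open>d\<close> is a derivation of \<open>[\<beta>, \<alpha>] = 0\<close>.\<close>

lemma Liem_anticommute:
  assumes a: "\<alpha> \<in> carrier (Lm L)" and b: "\<beta> \<in> carrier (Lm L)" and \<omega>: "mixed L \<omega>"
  shows "Liem L \<alpha> (Liem L \<beta> \<omega>) + Liem L \<beta> (Liem L \<alpha> \<omega>) = 0"
proof (rule contraction_unique_strict[where c = 1 and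
      E = "\<lambda>\<omega>. Liem L \<alpha> (Liem L \<beta> \<omega>) + Liem L \<beta> (Liem L \<alpha> \<omega>)"])
  fix \<omega> assume \<omega>: "mixed L \<omega>"
  have nil: "Liem L \<gamma> \<eta> [] [] = \<iota> (dd L \<gamma>) \<eta> [] []" for \<gamma> \<eta>
    by (simp add: Liem_def pointwise)
  have "\<iota> (dd L \<alpha>) (\<iota> (dd L \<beta>) \<omega>) =
      - \<iota> (dd L \<beta>) (\<iota> (dd L \<alpha>) \<omega>) - \<kappa> (h2 L (dd L \<alpha>) (dd L \<beta>)) \<omega>"
    using a b \<omega> by (intro front_\<iota>\<iota>) simp_all
  moreover have "\<kappa> (h2 L (dd L \<alpha>) (dd L \<beta>)) \<omega> = \<kappa> (brR L (dd L \<alpha>) \<beta>) \<omega> + \<kappa> (brL L \<beta> (dd L \<alpha>)) \<omega>"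
    using a b \<omega> by (simp flip: brR_brL_anti)
  moreover have "\<kappa> (brR L (dd L \<beta>) \<alpha>) \<omega> - \<kappa> (brL L \<beta> (dd L \<alpha>)) \<omega> = 0"
    using a b \<omega> contraction_linear(6)[of \<omega> "brR L (dd L \<beta>) \<alpha>" "brL L \<beta> (dd L \<alpha>)"]
    by (simp flip: derivation_LL)
  ultimately show "(Liem L \<alpha> (Liem L \<beta> \<omega>) + Liem L \<beta> (Liem L \<alpha> \<omega>)) [] [] = 0"
    using a b \<omega> by (simp add: nil pointwise \<iota>_Liem)
next
  fix x \<omega> assume "mixed L \<omega>" "x \<in> carrier (L0 L)"
  then show "\<iota> x (Liem L \<alpha> (Liem L \<beta> \<omega>) + Liem L \<beta> (Liem L \<alpha> \<omega>)) =
      scale 1 (Liem L \<alpha> (Liem L \<beta> (\<iota> x \<omega>)) + Liem L \<beta> (Liem L \<alpha> (\<iota> x \<omega>)))"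
    using a b by (simp add: \<iota>_Liem \<kappa>_Liem Liem_linear)
qed (use assms in \<open>simp_all add: \<kappa>_Liem\<close>)

text \<open>As brackets \<open>[h2(x,y), z]\<close> vanish, only the contraction with \<open>d h2(x,y) = [x,y] + [y,x]\<close> is left.\<close>

lemma Liem_h2:
  assumes "x \<in> carrier (L0 L)" "y \<in> carrier (L0 L)" "mixed L \<omega>"
  shows "Liem L (h2 L x y) \<omega> = \<iota> (br L x y) \<omega> + \<iota> (br L y x) \<omega>"
  using assms by (simp add: Liem_def brL_h2 wedge_linear flip: br_anti)

text \<open>By Cartan's formula the symmetrised double contraction of \<open>D \<omega>\<close> is
  \<open>- \<iota>\<^bsub>[x,y]+[y,x]\<^esub> \<omega> - D (\<kappa>\<^bsub>h2(x,y)\<^esub> \<omega>)\<close>, and this is \<open>- \<kappa>\<^bsub>h2(x,y)\<^esub> (D \<omega>)\<close> by the previous lemma.\<close>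

lemma D_mixed [simp]:
  assumes "mixed L \<omega>"
  shows "mixed L (D L \<omega>)"
proof -
  have "mixed_upto L n (D L \<omega>)" for n
    using assms
  proof (induction n arbitrary: \<omega>)
    case (Suc n)
    note \<omega> [simp] = Suc.prems
    have 1: "\<iota> x (\<iota> y (D L \<omega>)) + \<iota> y (\<iota> x (D L \<omega>)) = - \<kappa> (h2 L x y) (D L \<omega>)"
      if xy: "x \<in> carrier (L0 L)" "y \<in> carrier (L0 L)" for x y
    proof -
      have "D L (\<iota> x (\<iota> y \<omega>)) = D L (- \<iota> y (\<iota> x \<omega>) - \<kappa> (h2 L x y) \<omega>)"
        by (simp only: front_\<iota>\<iota>[OF mixed_front[OF \<omega>] xy])
      then show ?thesis
        using xy by (simp add: \<iota>_D \<iota>_Lie \<kappa>_D D_linear Liem_h2)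
    qed
    have 2: "\<kappa> \<alpha> (\<kappa> \<beta> (D L \<omega>)) = \<kappa> \<beta> (\<kappa> \<alpha> (D L \<omega>))"
      if ab: "\<alpha> \<in> carrier (Lm L)" "\<beta> \<in> carrier (Lm L)" for \<alpha> \<beta>
      using ab front_\<kappa>\<kappa>[OF mixed_front[OF \<omega>] ab] by (simp add: \<kappa>_D \<kappa>_Liem)
    have "front L (D L \<omega>)"
      unfolding front_def
      by (intro conjI ballI allI)
        (rule 1 2; assumption | simp add: \<iota>_D \<kappa>_D D_linear scale_linear Lie_add_vec Lie_smult_vec
          Liem_add_vec Liem_smult_vec)+
    moreover have "mixed_upto L n \<eta>" if "mixed L \<eta>" for \<eta>
      using that by (simp add: mixed_def)
    ultimately show ?case
      using Suc.IH by (intro mixed_upto_SucI) (simp_all add: \<iota>_D \<kappa>_D)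
  qed simp
  then show ?thesis by (simp add: mixed_def)
qed

lemma D_Liem:
  assumes \<alpha>: "\<alpha> \<in> carrier (Lm L)" and \<omega>: "mixed L \<omega>"
  shows "D L (Liem L \<alpha> \<omega>) + Liem L \<alpha> (D L \<omega>) = 0"
proof (rule contraction_unique_strict[where c = 1 and
      E = "\<lambda>\<omega>. D L (Liem L \<alpha> \<omega>) + Liem L \<alpha> (D L \<omega>)"])
  fix x \<omega> assume "mixed L \<omega>" "x \<in> carrier (L0 L)"
  then show "\<iota> x (D L (Liem L \<alpha> \<omega>) + Liem L \<alpha> (D L \<omega>)) =
      scale 1 (D L (Liem L \<alpha> (\<iota> x \<omega>)) + Liem L \<alpha> (D L (\<iota> x \<omega>)))"
    using \<alpha> by (simp add: \<iota>_D \<iota>_Liem \<kappa>_D Liem_linear D_linear Lie_Liem)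
next
  fix \<beta> \<omega> assume "mixed L \<omega>" "\<beta> \<in> carrier (Lm L)"
  then show "\<kappa> \<beta> (D L (Liem L \<alpha> \<omega>) + Liem L \<alpha> (D L \<omega>)) =
      D L (Liem L \<alpha> (\<kappa> \<beta> \<omega>)) + Liem L \<alpha> (D L (\<kappa> \<beta> \<omega>))"
    using \<alpha> Liem_anticommute[of \<alpha> \<beta> \<omega>]
    by (simp add: \<kappa>_D \<kappa>_Liem Liem_linear D_linear eq_neg_iff_add_eq_0 algebra_simps)
next
  fix \<omega> assume "mixed L \<omega>"
  then have "\<iota> (dd L \<alpha>) (D L \<omega>) [] [] = 0"
    using \<alpha> by (simp add: \<iota>_D pointwise) (simp add: Lie_def D_def)
  then show "(D L (Liem L \<alpha> \<omega>) + Liem L \<alpha> (D L \<omega>)) [] [] = 0"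
    by (simp add: pointwise) (simp add: Liem_def pointwise D_def)
qed (use assms in simp_all)

lemma D_D:
  assumes "mixed L \<omega>"
  shows "D L (D L \<omega>) = 0"
proof (rule contraction_unique_strict[where c = 1 and
      E = "\<lambda>\<omega>. D L (D L \<omega>)"])
  fix x \<omega> assume "mixed L \<omega>" "x \<in> carrier (L0 L)"
  then show "\<iota> x (D L (D L \<omega>)) = scale 1 (D L (D L (\<iota> x \<omega>)))"
    by (simp add: \<iota>_D Lie_D D_linear)
next
  fix \<alpha> \<omega> assume "mixed L \<omega>" "\<alpha> \<in> carrier (Lm L)"
  then show "\<kappa> \<alpha> (D L (D L \<omega>)) = D L (D L (\<kappa> \<alpha> \<omega>))"
    using D_Liem[of \<alpha> \<omega>] by (simp add: \<kappa>_D D_linear add.assoc)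
qed (use assms in simp_all, simp add: D_def)

end

section \<open>The standard complex\<close>

definition has_degree :: "int \<Rightarrow> ('k::field, 'a, 'b) cochain \<Rightarrow> bool" where
  "has_degree n \<omega> \<longleftrightarrow> (\<forall>xs as. int (length xs) + 2 * int (length as) \<noteq> n \<longrightarrow> \<omega> xs as = 0)"

lemma linear_functional_iff:
  "f \<in> linear_maps V scalars \<longleftrightarrow>
    (\<forall>x\<in>carrier V. \<forall>y\<in>carrier V. f (x \<oplus>\<^bsub>V\<^esub> y) = f x + f y) \<and>
    (\<forall>c. \<forall>x\<in>carrier V. f (c \<odot>\<^bsub>V\<^esub> x) = c * f x)"
  by (simp add: linear_maps_def scalars_def)

lemma nths_Cons_pair:
  "nths (x # xs) (- {Suc i, Suc (Suc i)}) = x # nths xs (- {i, Suc i})"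
  "nths (x # y # xs) (- {0, Suc 0}) = xs"
proof -
  have "{j. Suc j \<in> - {Suc i, Suc (Suc i)}} = - {i, Suc i}" "{j. Suc j \<in> - {0, Suc 0}} = - {0}"
    by auto
  then show "nths (x # xs) (- {Suc i, Suc (Suc i)}) = x # nths xs (- {i, Suc i})"
    "nths (x # y # xs) (- {0, Suc 0}) = xs"
    by (simp_all add: nths_Cons[of x] nths_Cons_neg(1))
qed

context hemistrict_lie_2_algebra
begin

lemma cochainsD:
  assumes "\<omega> \<in> cochains L n"
  shows "\<not> (args L xs as \<and> int (length xs) + 2 * int (length as) = n) \<Longrightarrow> \<omega> xs as = 0"
    and "args L xs as \<Longrightarrow> i < length xs \<Longrightarrow> (\<lambda>x. \<omega> (xs[i := x]) as) \<in> linear_maps (L0 L) scalars"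
    and "args L xs as \<Longrightarrow> j < length as \<Longrightarrow> (\<lambda>\<alpha>. \<omega> xs (as[j := \<alpha>])) \<in> linear_maps (Lm L) scalars"
    and "args L xs as \<Longrightarrow> mset as = mset bs \<Longrightarrow> \<omega> xs as = \<omega> xs bs"
    and "args L xs as \<Longrightarrow> Suc i < length xs \<Longrightarrow>
      \<omega> xs as + \<omega> (xs[i := xs ! Suc i, Suc i := xs ! i]) as
        = - \<omega> (nths xs (- {i, Suc i})) (h2 L (xs ! i) (xs ! Suc i) # as)"
proof -
  note * = assms[unfolded cochains_def mem_Collect_eq]
  note ** = *[THEN conjunct2] *[THEN conjunct2, THEN conjunct2]
    *[THEN conjunct2, THEN conjunct2, THEN conjunct2]
  show "\<not> (args L xs as \<and> int (length xs) + 2 * int (length as) = n) \<Longrightarrow> \<omega> xs as = 0"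
    by (rule *[THEN conjunct1, rule_format])
  show "args L xs as \<Longrightarrow> i < length xs \<Longrightarrow> (\<lambda>x. \<omega> (xs[i := x]) as) \<in> linear_maps (L0 L) scalars"
    by (rule **(1)[THEN conjunct1, rule_format]) simp
  show "args L xs as \<Longrightarrow> j < length as \<Longrightarrow> (\<lambda>\<alpha>. \<omega> xs (as[j := \<alpha>])) \<in> linear_maps (Lm L) scalars"
    by (rule **(2)[THEN conjunct1, rule_format]) simp
  show "args L xs as \<Longrightarrow> mset as = mset bs \<Longrightarrow> \<omega> xs as = \<omega> xs bs"
    by (rule **(3)[THEN conjunct1, rule_format]) simp
  show "args L xs as \<Longrightarrow> Suc i < length xs \<Longrightarrow>
      \<omega> xs as + \<omega> (xs[i := xs ! Suc i, Suc i := xs ! i]) as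
        = - \<omega> (nths xs (- {i, Suc i})) (h2 L (xs ! i) (xs ! Suc i) # as)"
    by (rule **(3)[THEN conjunct2, rule_format]) simp
qed

lemma cochains_supported: "\<omega> \<in> cochains L n \<Longrightarrow> \<omega> \<in> supported L"
  unfolding supported_def by (auto intro!: cochainsD(1))

lemma cochains_\<iota>:
  assumes \<omega>: "\<omega> \<in> cochains L n" and x: "x \<in> carrier (L0 L)"
  shows "\<iota> x \<omega> \<in> cochains L (n - 1)"
  unfolding cochains_def
proof (intro CollectI conjI allI impI, goal_cases)
  case (1 xs as)
  then show ?case using x cochainsD(1)[OF \<omega>, of "x # xs" as] by (auto simp: \<iota>_def)
next
  case (2 xs as i)
  then show ?case using x cochainsD(2)[OF \<omega>, of "x # xs" as "Suc i"] by (auto simp: \<iota>_def)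
next
  case (3 xs as j)
  then show ?case using x cochainsD(3)[OF \<omega>, of "x # xs" as j] by (auto simp: \<iota>_def)
next
  case (4 xs as bs)
  then show ?case using x cochainsD(4)[OF \<omega>, of "x # xs" as bs] by (auto simp: \<iota>_def)
next
  case (5 xs as i)
  then show ?case
    using x cochainsD(5)[OF \<omega>, of "x # xs" as "Suc i"] by (auto simp: \<iota>_def nths_Cons_pair)
qed

lemma cochains_\<kappa>:
  assumes \<omega>: "\<omega> \<in> cochains L n" and \<alpha>: "\<alpha> \<in> carrier (Lm L)"
  shows "\<kappa> \<alpha> \<omega> \<in> cochains L (n - 2)"
  unfolding cochains_def
proof (intro CollectI conjI allI impI, goal_cases)
  case (1 xs as)
  then show ?case using \<alpha> cochainsD(1)[OF \<omega>, of xs "\<alpha> # as"] by (auto simp: \<kappa>_def)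
next
  case (2 xs as i)
  then show ?case using \<alpha> cochainsD(2)[OF \<omega>, of xs "\<alpha> # as" i] by (auto simp: \<kappa>_def)
next
  case (3 xs as j)
  then show ?case using \<alpha> cochainsD(3)[OF \<omega>, of xs "\<alpha> # as" "Suc j"] by (auto simp: \<kappa>_def)
next
  case (4 xs as bs)
  then show ?case using \<alpha> cochainsD(4)[OF \<omega>, of xs "\<alpha> # as" "\<alpha> # bs"] by (auto simp: \<kappa>_def)
next
  case (5 xs as i)
  let ?h = "h2 L (xs ! i) (xs ! Suc i)"
  have "xs ! i \<in> carrier (L0 L)" "xs ! Suc i \<in> carrier (L0 L)"
    using 5 by (auto simp: in_lists_conv_set)
  then have "\<omega> (nths xs (- {i, Suc i})) (?h # \<alpha> # as) = \<omega> (nths xs (- {i, Suc i})) (\<alpha> # ?h # as)"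
    using 5 \<alpha> by (intro cochainsD(4)[OF \<omega>]) (auto intro: nths_in_lists)
  then show ?case
    using 5 \<alpha> cochainsD(5)[OF \<omega>, of xs "\<alpha> # as" i] by (auto simp: \<kappa>_def)
qed

lemma cochains_front:
  assumes \<omega>: "\<omega> \<in> cochains L n"
  shows "front L \<omega>"
proof -
  note supported [simp] = cochains_supported[OF \<omega>]
  show ?thesis
    unfolding front_def
  proof (intro conjI ballI allI, goal_cases)
    case (1 x y)
    show ?case
    proof (rule supported_eqI[of _ L])
      fix xs as assume "args L xs as"
      then show "\<iota> (x \<oplus>\<^bsub>L0 L\<^esub> y) \<omega> xs as = (\<iota> x \<omega> + \<iota> y \<omega>) xs as"
        using 1 cochainsD(2)[OF \<omega>, of "x # xs" as 0]
        by (simp add: linear_functional_iff \<iota>_def pointwise)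
    qed simp_all
  next
    case (2 c x)
    show ?case
    proof (rule supported_eqI[of _ L])
      fix xs as assume "args L xs as"
      then show "\<iota> (c \<odot>\<^bsub>L0 L\<^esub> x) \<omega> xs as = scale c (\<iota> x \<omega>) xs as"
        using 2 cochainsD(2)[OF \<omega>, of "x # xs" as 0]
        by (simp add: linear_functional_iff \<iota>_def scale_def)
    qed simp_all
  next
    case (3 x y)
    show ?case
    proof (rule supported_eqI[of _ L])
      fix xs as assume "args L xs as"
      then show "\<kappa> (x \<oplus>\<^bsub>Lm L\<^esub> y) \<omega> xs as = (\<kappa> x \<omega> + \<kappa> y \<omega>) xs as"
        using 3 cochainsD(3)[OF \<omega>, of xs "x # as" 0]
        by (simp add: linear_functional_iff \<kappa>_def pointwise)
    qed simp_all
  next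
    case (4 c x)
    show ?case
    proof (rule supported_eqI[of _ L])
      fix xs as assume "args L xs as"
      then show "\<kappa> (c \<odot>\<^bsub>Lm L\<^esub> x) \<omega> xs as = scale c (\<kappa> x \<omega>) xs as"
        using 4 cochainsD(3)[OF \<omega>, of xs "x # as" 0]
        by (simp add: linear_functional_iff \<kappa>_def scale_def)
    qed simp_all
  next
    case (5 x y)
    show ?case
    proof (rule supported_eqI[of _ L])
      fix xs as assume "args L xs as"
      then show "(\<iota> x (\<iota> y \<omega>) + \<iota> y (\<iota> x \<omega>)) xs as = (- \<kappa> (h2 L x y) \<omega>) xs as"
        using 5 cochainsD(5)[OF \<omega>, of "x # y # xs" as 0]
        by (simp add: \<iota>_def \<kappa>_def pointwise nths_Cons_pair add.commute)
    qed simp_all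
  next
    case (6 x y)
    show ?case
    proof (rule supported_eqI[of _ L])
      fix xs as assume "args L xs as"
      then show "\<kappa> x (\<kappa> y \<omega>) xs as = \<kappa> y (\<kappa> x \<omega>) xs as"
        using 6 cochainsD(4)[OF \<omega>, of xs "x # y # as" "y # x # as"]
        by (simp add: \<kappa>_def)
    qed simp_all
  qed
qed

lemma cochains_mixed: "\<omega> \<in> cochains L n \<Longrightarrow> mixed L \<omega>"
  unfolding mixed_def
proof
  fix m
  show "\<omega> \<in> cochains L n \<Longrightarrow> mixed_upto L m \<omega>"
  proof (induction m arbitrary: \<omega> n)
    case (Suc m)
    show ?case
      by (rule mixed_upto_SucI[OF cochains_supported[OF Suc.prems] cochains_front[OF Suc.prems]])
        (rule Suc.IH[OF cochains_\<iota>[OF Suc.prems]] Suc.IH[OF cochains_\<kappa>[OF Suc.prems]]; assumption)+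
  qed (simp add: cochains_supported)
qed

lemma mixed_linear_0:
  "mixed L \<omega> \<Longrightarrow> args L xs as \<Longrightarrow> i < length xs \<Longrightarrow>
    (\<lambda>x. \<omega> (xs[i := x]) as) \<in> linear_maps (L0 L) scalars"
proof (induction xs arbitrary: \<omega> i rule: list.induct)
  case (Cons x xs)
  show ?case
  proof (cases i)
    case 0
    have "(\<lambda>x. \<iota> x \<omega> xs as) \<in> linear_maps (L0 L) scalars"
      using Cons.prems(1) by (auto simp: linear_functional_iff pointwise scale_def)
    then show ?thesis by (simp add: 0 \<iota>_def)
  next
    case (Suc j)
    then have "(\<lambda>y. \<iota> x \<omega> (xs[j := y]) as) \<in> linear_maps (L0 L) scalars"
      using Cons.prems by (intro Cons.IH) auto
    then show ?thesis by (simp add: Suc \<iota>_def)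
  qed
qed simp

lemma mixed_linear_m:
  "mixed L \<omega> \<Longrightarrow> args L xs as \<Longrightarrow> i < length as \<Longrightarrow>
    (\<lambda>\<alpha>. \<omega> xs (as[i := \<alpha>])) \<in> linear_maps (Lm L) scalars"
proof (induction as arbitrary: \<omega> i rule: list.induct)
  case (Cons \<alpha> as)
  show ?case
  proof (cases i)
    case 0
    have "(\<lambda>x. \<kappa> x \<omega> xs as) \<in> linear_maps (Lm L) scalars"
      using Cons.prems(1) by (auto simp: linear_functional_iff pointwise scale_def)
    then show ?thesis by (simp add: 0 \<kappa>_def)
  next
    case (Suc j)
    then have "(\<lambda>\<beta>. \<kappa> \<alpha> \<omega> xs (as[j := \<beta>])) \<in> linear_maps (Lm L) scalars"
      using Cons.prems by (intro Cons.IH) auto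
    then show ?thesis by (simp add: Suc \<kappa>_def)
  qed
qed simp

text \<open>If the leading entries differ, then both lists can be permuted, below their leading entries, so that
  they differ only by an interchange of the first two entries.\<close>

lemma mixed_perm:
  "mixed L \<omega> \<Longrightarrow> as \<in> lists (carrier (Lm L)) \<Longrightarrow> mset as = mset bs \<Longrightarrow> \<omega> xs as = \<omega> xs bs"
proof (induction "length as" arbitrary: \<omega> as bs)
  case (Suc n)
  then obtain a as' b bs' where eq: "as = a # as'" "bs = b # bs'"
    by (metis length_Suc_conv mset_eq_length)
  have bs: "bs \<in> lists (carrier (Lm L))"
    using Suc.prems(2) mset_eq_setD[OF Suc.prems(3)] by (simp add: in_lists_conv_set)
  note c = Suc.prems(2)[unfolded eq] bs[unfolded eq]
  have \<kappa>: "\<kappa> \<gamma> \<omega> xs cs = \<kappa> \<gamma> \<omega> xs ds"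
    if "\<gamma> \<in> carrier (Lm L)" "cs \<in> lists (carrier (Lm L))" "length cs = n" "mset cs = mset ds" for \<gamma> cs ds
    using Suc.hyps(1)[of cs "\<kappa> \<gamma> \<omega>" ds] that Suc.prems(1) by simp
  show ?case
  proof (cases "a = b")
    case True
    then show ?thesis
      using \<kappa>[of a as' bs'] Suc.prems Suc.hyps(2) c by (simp add: eq \<kappa>_def)
  next
    case False
    define cs where "cs = remove1 b as'"
    have mem: "b \<in> set as'"
      using False mset_eq_setD[OF Suc.prems(3)] by (auto simp: eq)
    then have 1: "mset as' = add_mset b (mset cs)" by (simp add: cs_def)
    have 2: "mset bs' = add_mset a (mset cs)"
      using Suc.prems(3) unfolding eq by (simp add: 1 add_mset_commute[of a b])
    have len: "length as' = n" "length bs' = n"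
      using Suc.hyps(2) mset_eq_length[OF Suc.prems(3)] by (simp_all add: eq)
    have cs: "cs \<in> lists (carrier (Lm L))"
      using c(1) set_remove1_subset[of b as'] by (auto simp: in_lists_conv_set cs_def)
    have "\<omega> xs as = \<kappa> a \<omega> xs (b # cs)"
      using \<kappa>[of a as' "b # cs"] c 1 len by (simp add: eq \<kappa>_def)
    also have "\<dots> = \<kappa> b (\<kappa> a \<omega>) xs cs" by (simp add: \<kappa>_def)
    also have "\<dots> = \<kappa> a (\<kappa> b \<omega>) xs cs"
      using c Suc.prems(1) by (subst front_\<kappa>\<kappa>[of L]) simp_all
    also have "\<dots> = \<kappa> b \<omega> xs (a # cs)" by (simp add: \<kappa>_def)
    also have "\<dots> = \<omega> xs bs"
      using \<kappa>[of b bs' "a # cs"] c 2 len by (simp add: eq \<kappa>_def)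
    finally show ?thesis .
  qed
qed simp

lemma mixed_swap:
  "mixed L \<omega> \<Longrightarrow> args L xs as \<Longrightarrow> Suc i < length xs \<Longrightarrow>
    \<omega> xs as + \<omega> (xs[i := xs ! Suc i, Suc i := xs ! i]) as
      = - \<omega> (nths xs (- {i, Suc i})) (h2 L (xs ! i) (xs ! Suc i) # as)"
proof (induction xs arbitrary: \<omega> i rule: list.induct)
  case (Cons x xs)
  show ?case
  proof (cases i)
    case 0
    then obtain y ys where xs: "xs = y # ys" using Cons.prems by (cases xs) auto
    have "\<iota> y (\<iota> x \<omega>) ys as = (- \<iota> x (\<iota> y \<omega>) - \<kappa> (h2 L y x) \<omega>) ys as"
      using Cons.prems xs by (subst front_\<iota>\<iota>[of L]) auto
    then show ?thesis
      using Cons.prems by (simp add: 0 xs \<iota>_def \<kappa>_def pointwise nths_Cons_pair h2_sym)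
  next
    case (Suc j)
    then have "\<iota> x \<omega> xs as + \<iota> x \<omega> (xs[j := xs ! Suc j, Suc j := xs ! j]) as
        = - \<iota> x \<omega> (nths xs (- {j, Suc j})) (h2 L (xs ! j) (xs ! Suc j) # as)"
      using Cons.prems by (intro Cons.IH) auto
    then show ?thesis by (simp add: Suc \<iota>_def nths_Cons_pair)
  qed
qed simp

text \<open>The conditions at arbitrary positions are equivalent to the leading conditions for all iterated
  contractions.\<close>

lemma cochains_iff: "\<omega> \<in> cochains L n \<longleftrightarrow> mixed L \<omega> \<and> has_degree n \<omega>"
proof
  assume "\<omega> \<in> cochains L n"
  then show "mixed L \<omega> \<and> has_degree n \<omega>"
    using cochains_mixed cochainsD(1) unfolding has_degree_def by blast
next
  assume *: "mixed L \<omega> \<and> has_degree n \<omega>"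
  then have "\<omega> xs as = 0" if "\<not> (args L xs as \<and> int (length xs) + 2 * int (length as) = n)" for xs as
    using that mixed_supported[of L \<omega>] unfolding supported_def has_degree_def by blast
  then show "\<omega> \<in> cochains L n"
    unfolding cochains_def mem_Collect_eq
  proof (intro conjI allI impI, goal_cases)
    case (2 xs as i)
    then show ?case using * by (intro mixed_linear_0) simp_all
  next
    case (3 xs as j)
    then show ?case using * by (intro mixed_linear_m) simp_all
  next
    case (4 xs as bs)
    then show ?case using * by (intro mixed_perm) simp_all
  next
    case (5 xs as i)
    then show ?case using * by (intro mixed_swap) simp_all
  qed
qed

lemma has_degree_D:
  assumes "has_degree n \<omega>"
  shows "has_degree (n + 1) (D L \<omega>)"
  unfolding has_degree_def
proof (intro allI impI)
  fix xs :: "'b list" and as :: "'a list"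
  assume len: "int (length xs) + 2 * int (length as) \<noteq> n + 1"
  have z: "\<omega> ys bs = 0" if "int (length ys) + 2 * int (length bs) \<noteq> n" for ys bs
    using assms that by (simp add: has_degree_def)
  have 1: "\<omega> (dd L (as ! j) # xs) (nths as (- {j})) = 0" if "j < length as" for j
    using that len by (intro z) (simp add: length_nths_neg of_nat_diff)
  have 2: "\<omega> (nths (xs[j := y]) (- {i})) as = 0" if "j < length xs" "i < j" for i j y
    using that len by (intro z) (simp add: length_nths_neg of_nat_diff)
  have 3: "\<omega> (nths xs (- {i})) (as[j := \<alpha>]) = 0" if "i < length xs" for i j \<alpha>
    using that len by (intro z) (simp add: length_nths_neg of_nat_diff)
  show "D L \<omega> xs as = 0"
    by (simp add: D_def 1 2 3)
qed

lemma cochains_closed: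
  "0 \<in> cochains L n" "\<omega> \<in> cochains L n \<Longrightarrow> \<eta> \<in> cochains L n \<Longrightarrow> \<omega> + \<eta> \<in> cochains L n"
  "\<omega> \<in> cochains L n \<Longrightarrow> scale c \<omega> \<in> cochains L n" "\<omega> \<in> cochains L n \<Longrightarrow> - \<omega> \<in> cochains L n"
  "\<omega> \<in> cochains L n \<Longrightarrow> D L \<omega> \<in> cochains L (n + 1)"
  by (auto simp: cochains_iff has_degree_D) (auto simp: has_degree_def pointwise scale_def)

lemma cochain_space_simps:
  "carrier (cochain_space L n) = cochains L n" "\<omega> \<oplus>\<^bsub>cochain_space L n\<^esub> \<eta> = \<omega> + \<eta>"
  "c \<odot>\<^bsub>cochain_space L n\<^esub> \<omega> = scale c \<omega>" "\<zero>\<^bsub>cochain_space L n\<^esub> = 0"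
  by (simp_all add: cochain_space_def plus_fun_def zero_fun_def scale_def)

lemma cochain_space_vspace: "vspace (cochain_space L n)"
proof (rule moduleI)
  show "cring (scalars :: ('k, 'k) module)" by (rule M0.R.is_cring)
  show "abelian_group (cochain_space L n)"
    by (rule abelian_groupI)
      (auto simp: cochain_space_simps cochains_closed algebra_simps intro: bexI[of _ "- _"])
qed (auto simp: cochain_space_simps cochains_closed scale_linear,
     auto simp: scalars_def scale_def pointwise fun_eq_iff algebra_simps)

lemma standard_complex: "is_cochain_complex (standard_complex L)"
  by (auto simp: is_cochain_complex_def standard_complex_def cochain_space_vspace linear_maps_def
      cochain_space_simps cochains_closed D_linear D_D cochains_iff has_degree_D)

end

section \<open>The recursion for the pullback\<close>

text \<open>The families of pairs of any length over an arbitrary set of positions. Varying the set allows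
  the families to be decomposed and relabelled.\<close>

definition pairings :: "nat set \<Rightarrow> (nat \<times> nat) list set" where
  "pairings A = {ps. (\<forall>(i, j)\<in>set ps. i < j \<and> i \<in> A \<and> j \<in> A) \<and>
     distinct (map fst ps @ map snd ps) \<and> sorted_wrt (<) (map fst ps)}"

lemma pairings_empty [simp]: "pairings {} = {[]}"
proof -
  have "ps = []" if "\<forall>(i, j)\<in>set ps. i < j \<and> i \<in> {} \<and> j \<in> {}" for ps :: "(nat \<times> nat) list"
    using that by (cases ps) auto
  then show ?thesis by (auto simp: pairings_def)
qed

lemma length_pairings:
  assumes "ps \<in> pairings {..<m}"
  shows "length ps \<le> m div 2"
proof -
  have "card (set (map fst ps @ map snd ps)) \<le> card {..<m}"
    using assms by (intro card_mono) (auto simp: pairings_def)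
  moreover have "card (set (map fst ps @ map snd ps)) = 2 * length ps"
    using assms by (subst distinct_card) (auto simp: pairings_def)
  ultimately show ?thesis by simp
qed

lemma pair_families_eq: "pair_families m q = {ps \<in> pairings {..<m}. length ps = q}"
  by (auto simp: pair_families_def pairings_def)

lemma pairings_eq_UN: "pairings {..<m} = (\<Union>q\<in>{0..m div 2}. pair_families m q)"
  using length_pairings by (auto simp: pair_families_eq)

lemma pairings_mono:
  assumes "A \<subseteq> B" shows "pairings A \<subseteq> pairings B"
proof
  fix ps assume ps: "ps \<in> pairings A"
  then have "\<forall>(i, j)\<in>set ps. i < j \<and> i \<in> B \<and> j \<in> B"
    using assms by (auto simp: pairings_def split_beta)
  then show "ps \<in> pairings B" using ps by (simp add: pairings_def)
qed

lemma finite_pairings: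
  assumes "finite A" shows "finite (pairings A)"
proof -
  from assms obtain m where "A \<subseteq> {..<m}" using finite_nat_set_iff_bounded by auto
  from pairings_mono[OF this] show ?thesis
    by (rule finite_subset) (simp add: pairings_eq_UN finite_pair_families)
qed

lemma map_in_pairings_iff:
  assumes s: "strict_mono (s :: nat \<Rightarrow> nat)"
  shows "map (map_prod s s) ps \<in> pairings (s ` A) \<longleftrightarrow> ps \<in> pairings A"
proof -
  have inj: "inj s" by (rule strict_mono_imp_inj_on[OF s])
  have 1: "map fst (map (map_prod s s) ps) = map s (map fst ps)"
    "map snd (map (map_prod s s) ps) = map s (map snd ps)"
    by simp_all
  have 2: "distinct (map s (map fst ps) @ map s (map snd ps)) \<longleftrightarrow> distinct (map fst ps @ map snd ps)"
    unfolding map_append[symmetric] distinct_map using inj by (auto intro: inj_on_subset)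
  have 3: "sorted_wrt (<) (map s (map fst ps)) \<longleftrightarrow> sorted_wrt (<) (map fst ps)"
    unfolding sorted_wrt_map[of _ s] by (simp add: strict_mono_less[OF s])
  have 4: "(\<forall>(i, j)\<in>set (map (map_prod s s) ps). i < j \<and> i \<in> s ` A \<and> j \<in> s ` A) \<longleftrightarrow>
      (\<forall>(i, j)\<in>set ps. i < j \<and> i \<in> A \<and> j \<in> A)"
    by (simp add: split_beta strict_mono_less[OF s] inj_image_mem_iff[OF inj])
  show ?thesis
    unfolding pairings_def mem_Collect_eq 1 2 3 4 ..
qed

lemma pairings_image:
  assumes s: "strict_mono (s :: nat \<Rightarrow> nat)"
  shows "pairings (s ` A) = map (map_prod s s) ` pairings A"
proof (intro equalityI subsetI)
  fix ps assume ps: "ps \<in> pairings (s ` A)"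
  let ?qs = "map (map_prod (inv_into UNIV s) (inv_into UNIV s)) ps"
  have "map_prod s s (map_prod (inv_into UNIV s) (inv_into UNIV s) p) = p" if "p \<in> set ps" for p
  proof -
    have "fst p \<in> range s" "snd p \<in> range s"
      using ps that by (auto simp: pairings_def split_beta)
    then show ?thesis by (simp add: prod_eq_iff f_inv_into_f)
  qed
  then have "map (map_prod s s) ?qs = ps"
    by (simp add: map_idI comp_def)
  then show "ps \<in> map (map_prod s s) ` pairings A"
    using ps map_in_pairings_iff[OF s, of ?qs A] by (metis imageI)
qed (auto simp: map_in_pairings_iff[OF s])

lemma pairingsD:
  assumes "ps \<in> pairings A" "(i, j) \<in> set ps"
  shows "i < j" "i \<in> A" "j \<in> A"
  using assms by (auto simp: pairings_def)

lemma pairings_iff: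
  "ps \<in> pairings A \<longleftrightarrow> (\<forall>i j. (i, j) \<in> set ps \<longrightarrow> i < j \<and> i \<in> A \<and> j \<in> A) \<and>
     distinct (map fst ps @ map snd ps) \<and> sorted_wrt (<) (map fst ps)"
  by (auto simp: pairings_def)

text \<open>The least position is either unmatched, or it belongs to the first pair because the first
  components are increasing.\<close>

lemma pairings_insert_least:
  assumes a: "\<And>b. b \<in> A \<Longrightarrow> a < b"
  shows "pairings (insert a A) = pairings A \<union> (\<Union>b\<in>A. (#) (a, b) ` pairings (A - {b}))"
proof (intro equalityI subsetI)
  fix ps assume ps: "ps \<in> pairings (insert a A)"
  show "ps \<in> pairings A \<union> (\<Union>b\<in>A. (#) (a, b) ` pairings (A - {b}))"
  proof (cases "a \<in> fst ` set ps")
    case False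
    have "i \<in> A \<and> j \<in> A" if "(i, j) \<in> set ps" for i j
    proof -
      have "i \<in> A" using False pairingsD(2)[OF ps that] that by (auto simp: image_iff)
      moreover from this have "j \<noteq> a" using a[of i] pairingsD(1)[OF ps that] by auto
      ultimately show ?thesis using pairingsD(3)[OF ps that] by simp
    qed
    then have "ps \<in> pairings A"
      using ps pairingsD(1)[OF ps] by (simp add: pairings_iff)
    then show ?thesis by simp
  next
    case True
    obtain p qs where eq: "ps = p # qs" using True by (cases ps) auto
    have "fst p = a"
    proof (rule ccontr)
      assume "fst p \<noteq> a"
      then have qs: "a \<in> set (map fst qs)" and p: "fst p \<in> A"
        using True pairingsD(2)[OF ps, of "fst p" "snd p"] by (simp_all add: eq)
      have "\<forall>i\<in>set (map fst qs). fst p < i"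
        using ps by (simp add: eq pairings_iff)
      then have "fst p < a" using qs by blast
      then show False using a[OF p] by simp
    qed
    then obtain b where p: "p = (a, b)" by (cases p) auto
    have b: "b \<in> A" using pairingsD[OF ps, of a b] by (auto simp: eq p)
    have notin: "a \<notin> set (map fst qs @ map snd qs)" "b \<notin> set (map fst qs @ map snd qs)"
      using ps by (auto simp: eq p pairings_iff)
    have "i \<in> A - {b} \<and> j \<in> A - {b}" if "(i, j) \<in> set qs" for i j
    proof -
      have "i \<in> set (map fst qs @ map snd qs)" "j \<in> set (map fst qs @ map snd qs)"
        using that by force+
      moreover have "i \<in> insert a A" "j \<in> insert a A"
        using pairingsD[OF ps, of i j] that by (simp_all add: eq)
      ultimately show ?thesis using notin by auto
    qed
    then have "qs \<in> pairings (A - {b})"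
      using ps by (simp add: eq p pairings_iff)
    then show ?thesis using b by (auto simp: eq p)
  qed
next
  fix ps assume "ps \<in> pairings A \<union> (\<Union>b\<in>A. (#) (a, b) ` pairings (A - {b}))"
  then consider "ps \<in> pairings A" | b qs where "b \<in> A" "qs \<in> pairings (A - {b})" "ps = (a, b) # qs"
    by auto
  then show "ps \<in> pairings (insert a A)"
  proof cases
    case 1
    then show ?thesis using pairings_mono[of A "insert a A"] by auto
  next
    case 2
    have *: "i \<in> A \<and> j \<in> A \<and> i \<noteq> b \<and> j \<noteq> b \<and> a < i \<and> a < j" if "(i, j) \<in> set qs" for i j
      using pairingsD[OF 2(2) that] a[of i] a[of j] by simp
    then have "a \<notin> fst ` set qs" "a \<notin> snd ` set qs" "b \<notin> fst ` set qs" "b \<notin> snd ` set qs"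
      "\<forall>i\<in>fst ` set qs. a < i"
      by fastforce+
    then show ?thesis
      using a[OF 2(1)] 2 * by (auto simp: pairings_iff)
  qed
qed

text \<open>The increasing enumeration of the positions different from \<open>j\<close>.\<close>

definition skip :: "nat \<Rightarrow> nat \<Rightarrow> nat" where
  "skip j a = (if a < j then a else Suc a)"

lemma strict_mono_skip: "strict_mono (skip j)"
  by (auto simp: strict_mono_def skip_def)

lemma skip_image: "j < m \<Longrightarrow> skip j ` {..<m - 1} = {..<m} - {j}"
proof (intro equalityI subsetI)
  fix a assume "j < m" "a \<in> {..<m} - {j}"
  then show "a \<in> skip j ` {..<m - 1}"
    by (intro image_eqI[of _ _ "if a < j then a else a - 1"]) (auto simp: skip_def)
qed (auto simp: skip_def)

text \<open>The positions \<open>1, \<dots>, m\<close> are relabelled by \<open>Suc\<close> if \<open>0\<close> is unmatched, and those different from the partner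
  \<open>Suc j\<close> of \<open>0\<close> by \<open>Suc \<circ> skip j\<close>.\<close>

lemma sum_pairings_Suc:
  fixes F :: "(nat \<times> nat) list \<Rightarrow> 'c::comm_monoid_add"
  shows "sum F (pairings {..<Suc m}) = (\<Sum>ps\<in>pairings {..<m}. F (map (map_prod Suc Suc) ps)) +
    (\<Sum>j<m. \<Sum>ps\<in>pairings {..<m - 1}.
       F ((0, Suc j) # map (map_prod (Suc \<circ> skip j) (Suc \<circ> skip j)) ps))"
proof -
  let ?A = "Suc ` {..<m}"
  have inj: "inj_on (map (map_prod s s)) B" if "strict_mono s" for s :: "nat \<Rightarrow> nat" and B
  proof -
    have "inj s" by (rule strict_mono_imp_inj_on[OF that])
    then have "inj (map (map_prod s s))" by (intro inj_mapI prod.inj_map)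
    then show ?thesis using inj_on_subset by blast
  qed
  have Suc: "strict_mono Suc" by (simp add: strict_mono_def)
  have "{..<Suc m} = insert 0 ?A" by (rule lessThan_Suc_eq_insert_0)
  then have eq: "pairings {..<Suc m} = pairings ?A \<union> (\<Union>b\<in>?A. (#) (0, b) ` pairings (?A - {b}))"
    using pairings_insert_least[of ?A 0] by auto
  have "pairings ?A \<inter> (\<Union>b\<in>?A. (#) (0, b) ` pairings (?A - {b})) = {}"
    by (auto simp: pairings_def)
  then have "sum F (pairings {..<Suc m}) =
      sum F (pairings ?A) + sum F (\<Union>b\<in>?A. (#) (0, b) ` pairings (?A - {b}))"
    unfolding eq by (intro sum.union_disjoint) (auto simp: finite_pairings)
  also have "sum F (pairings ?A) = (\<Sum>ps\<in>pairings {..<m}. F (map (map_prod Suc Suc) ps))"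
    by (simp add: pairings_image[OF Suc] sum.reindex[OF inj[OF Suc]])
  also have "sum F (\<Union>b\<in>?A. (#) (0, b) ` pairings (?A - {b})) =
      (\<Sum>b\<in>?A. sum F ((#) (0, b) ` pairings (?A - {b})))"
    by (intro sum.UNION_disjoint) (auto simp: finite_pairings)
  also have "\<dots> = (\<Sum>j<m. \<Sum>ps\<in>pairings (?A - {Suc j}). F ((0, Suc j) # ps))"
    by (simp add: sum.reindex)
  also have "\<dots> = (\<Sum>j<m. \<Sum>ps\<in>pairings {..<m - 1}.
      F ((0, Suc j) # map (map_prod (Suc \<circ> skip j) (Suc \<circ> skip j)) ps))"
  proof (rule sum.cong[OF refl])
    fix j assume "j \<in> {..<m}"
    then have "(Suc \<circ> skip j) ` {..<m - 1} = Suc ` ({..<m} - {j})"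
      by (simp only: image_comp[symmetric] skip_image lessThan_iff)
    then have img: "?A - {Suc j} = (Suc \<circ> skip j) ` {..<m - 1}" by auto
    have mono: "strict_mono (Suc \<circ> skip j)"
      using strict_mono_skip by (simp add: strict_mono_def)
    show "(\<Sum>ps\<in>pairings (?A - {Suc j}). F ((0, Suc j) # ps)) = (\<Sum>ps\<in>pairings {..<m - 1}.
      F ((0, Suc j) # map (map_prod (Suc \<circ> skip j) (Suc \<circ> skip j)) ps))"
      unfolding img pairings_image[OF mono] sum.reindex[OF inj[OF mono]] o_apply ..
  qed
  finally show ?thesis .
qed

subsection \<open>Signs\<close>

definition cross :: "nat \<times> nat \<Rightarrow> nat \<times> nat \<Rightarrow> bool" where
  "cross p q \<longleftrightarrow> fst p < fst q \<and> fst q < snd p \<and> snd p < snd q"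

definition crossings :: "(nat \<times> nat) list \<Rightarrow> nat" where
  "crossings ps = card {(a, b). a < b \<and> b < length ps \<and> cross (ps ! a) (ps ! b)}"

lemma pair_sign_eq: "pair_sign ps = (-1) ^ ((\<Sum>(i, j)\<leftarrow>ps. i + j) + crossings ps)"
  by (simp add: pair_sign_def crossings_def cross_def)

lemma crossings_Nil [simp]: "crossings [] = 0"
  by (simp add: crossings_def)

lemma crossings_Cons: "crossings (p # ps) = length (filter (cross p) ps) + crossings ps"
proof -
  let ?S = "{(a, b). a < b \<and> b < length ps \<and> cross (ps ! a) (ps ! b)}"
  let ?T = "{b. b < length ps \<and> cross p (ps ! b)}"
  have "{(a, b). a < b \<and> b < length (p # ps) \<and> cross ((p # ps) ! a) ((p # ps) ! b)} =
      (\<lambda>b. (0, Suc b)) ` ?T \<union> map_prod Suc Suc ` ?S" (is "?U = ?V")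
  proof (intro equalityI subsetI)
    fix c assume "c \<in> ?U"
    then obtain a b where c: "c = (a, Suc b)" "a < Suc b" "b < length ps"
        "cross ((p # ps) ! a) (ps ! b)"
      by (cases c; cases "snd c") auto
    then show "c \<in> ?V" by (cases a) (auto simp: image_iff)
  qed auto
  moreover have "finite ?S"
    by (rule finite_subset[of _ "{..<length ps} \<times> {..<length ps}"]) auto
  then have "card ?V = card ((\<lambda>b. (0 :: nat, Suc b)) ` ?T) + card (map_prod Suc Suc ` ?S)"
    by (intro card_Un_disjoint) auto
  moreover have "card ((\<lambda>b. (0 :: nat, Suc b)) ` ?T) = card ?T" "card (map_prod Suc Suc ` ?S) = card ?S"
    by (intro card_image; auto simp: inj_on_def)+
  ultimately have "crossings (p # ps) = card ?T + card ?S"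
    by (simp only: crossings_def)
  then show ?thesis
    by (simp add: crossings_def length_filter_conv_card)
qed

lemma crossings_map:
  assumes "strict_mono s"
  shows "crossings (map (map_prod s s) ps) = crossings ps"
proof (induction ps)
  case (Cons p ps)
  have "cross (map_prod s s p) (map_prod s s q) = cross p q" for q
    using assms by (simp add: cross_def strict_mono_less)
  then show ?case using Cons by (simp add: crossings_Cons filter_map comp_def)
qed simp

lemma pair_sign_map_Suc: "pair_sign (map (map_prod Suc Suc) ps) = pair_sign ps"
proof -
  have "(\<Sum>(i, j)\<leftarrow>map (map_prod Suc Suc) ps. i + j) = (\<Sum>(i, j)\<leftarrow>ps. i + j) + 2 * length ps"
    by (induction ps) auto
  then show ?thesis
    by (simp add: pair_sign_eq crossings_map strict_mono_def power_add)
qed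

text \<open>Relabelling changes the parity of \<open>a + b\<close> if and only if exactly one of the two positions is moved past
  the removed position \<open>j\<close>, and this is the case if and only if the pair crosses \<open>(0, Suc j)\<close>.\<close>

lemma parity_skip:
  assumes "\<forall>(a, b)\<in>set ps. a < b"
  shows "even ((\<Sum>(a, b)\<leftarrow>map (map_prod (Suc \<circ> skip j) (Suc \<circ> skip j)) ps. a + b) +
      length (filter (cross (0, Suc j)) (map (map_prod (Suc \<circ> skip j) (Suc \<circ> skip j)) ps)))
    \<longleftrightarrow> even (\<Sum>(a, b)\<leftarrow>ps. a + b)"
  using assms
proof (induction ps)
  case (Cons p ps)
  obtain a b where p: "p = (a, b)" by fastforce
  have "a < b" using Cons.prems by (simp add: p)
  then have "even (Suc (skip j a) + Suc (skip j b) +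
      (if cross (0, Suc j) (Suc (skip j a), Suc (skip j b)) then 1 else 0)) \<longleftrightarrow> even (a + b)"
    by (auto simp: skip_def cross_def)
  then show ?case using Cons by (auto simp: p)
qed simp

text \<open>By the preceding lemma the first pair contributes only its own sign, \<open>(-1)\<^bsup>Suc j\<^esup>\<close> from its positions
  and \<open>-1\<close> from the length.\<close>

lemma pair_sign_Cons_skip:
  assumes "\<forall>(a, b)\<in>set ps. a < b"
  shows "(-1) ^ Suc (length ps) *
      pair_sign ((0, Suc j) # map (map_prod (Suc \<circ> skip j) (Suc \<circ> skip j)) ps) =
    ((-1) ^ j * ((-1) ^ length ps * pair_sign ps) :: 'k::field)"
proof -
  have mono: "strict_mono (Suc \<circ> skip j)"
    using strict_mono_skip by (simp add: strict_mono_def)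
  have "(-1 :: 'k) ^ ((\<Sum>(a, b)\<leftarrow>map (map_prod (Suc \<circ> skip j) (Suc \<circ> skip j)) ps. a + b) +
      length (filter (cross (0, Suc j)) (map (map_prod (Suc \<circ> skip j) (Suc \<circ> skip j)) ps)))
    = (-1) ^ (\<Sum>(a, b)\<leftarrow>ps. a + b)"
    using parity_skip[OF assms, of j] by (simp only: minus_one_power_iff)
  then show ?thesis
    unfolding pair_sign_eq crossings_Cons crossings_map[OF mono]
    by (simp add: power_add mult_ac)
qed

subsection \<open>Positions\<close>

lemma nths_neg_nth:
  "j < length xs \<Longrightarrow> a < length xs - 1 \<Longrightarrow> nths xs (- {j}) ! a = xs ! skip j a"
proof (induction xs arbitrary: j a)
  case (Cons x xs)
  show ?case
  proof (cases j)
    case (Suc i)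
    show ?thesis
    proof (cases a)
      case (Suc b)
      then show ?thesis
        using Cons.prems Cons.IH[of i b] \<open>j = Suc i\<close> by (auto simp: skip_def)
    qed (simp add: Suc skip_def)
  qed (simp add: skip_def)
qed simp

lemma nths_neg_nths: "nths (nths xs (- {j})) (- U) = nths xs (- insert j (skip j ` U))"
proof (induction xs arbitrary: j U)
  case (Cons x xs)
  show ?case
  proof (cases j)
    case 0
    have "{k. Suc k \<in> - insert 0 (skip 0 ` U)} = - U"
      by (auto simp: skip_def)
    then show ?thesis by (simp add: 0 nths_Cons[of _ _ "- insert 0 _"] nths_all)
  next
    case (Suc i)
    let ?U = "{k. Suc k \<in> U}"
    have 1: "{k. Suc k \<in> - U} = - ?U" by auto
    have "skip (Suc i) ` U = (if 0 \<in> U then {0} else {}) \<union> Suc ` skip i ` ?U"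
    proof (intro equalityI subsetI)
      fix k assume "k \<in> skip (Suc i) ` U"
      then obtain u where u: "u \<in> U" "k = skip (Suc i) u" by auto
      then show "k \<in> (if 0 \<in> U then {0} else {}) \<union> Suc ` skip i ` ?U"
        by (cases u) (auto simp: skip_def image_iff)
    next
      fix k assume "k \<in> (if 0 \<in> U then {0} else {}) \<union> Suc ` skip i ` ?U"
      then show "k \<in> skip (Suc i) ` U"
        by (fastforce simp: skip_def image_iff split: if_splits)
    qed
    then have 2: "{k. Suc k \<in> - insert (Suc i) (skip (Suc i) ` U)} = - insert i (skip i ` ?U)"
      "0 \<in> - insert (Suc i) (skip (Suc i) ` U) \<longleftrightarrow> 0 \<in> - U"
      by auto
    show ?thesis
      unfolding Suc nths_Cons_neg nths_Cons[of x _ "- U"] nths_Cons[of x _ "- insert _ _"] 1 2 Cons.IH ..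
  qed
qed simp

subsection \<open>Splitting off the first argument\<close>

text \<open>The term of the pullback that belongs to a family of pairs, without its sign.\<close>

definition contracted :: "('a, 'b) hl2a_mor \<Rightarrow> ('k, 'a, 'b) cochain \<Rightarrow> 'b list \<Rightarrow> 'a list
    \<Rightarrow> (nat \<times> nat) list \<Rightarrow> 'k" where
  "contracted f \<omega> xs as ps =
     \<omega> (map (f10 f) (nths xs (- (fst ` set ps \<union> snd ` set ps))))
       (map (\<lambda>(i, j). f2 f (xs ! i) (xs ! j)) ps @ map (f1m f) as)"

lemma pullback_eq_sum_pairings:
  assumes "args L xs as"
  shows "pullback L f \<omega> xs as =
    (\<Sum>ps\<in>pairings {..<length xs}. (-1) ^ length ps * pair_sign ps * contracted f \<omega> xs as ps)"
proof -
  let ?F = "\<lambda>ps. (-1) ^ length ps * pair_sign ps * contracted f \<omega> xs as ps"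
  let ?m = "length xs"
  have "sum ?F (pairings {..<?m}) = (\<Sum>q=0..?m div 2. sum ?F (pair_families ?m q))"
    unfolding pairings_eq_UN by (rule sum.UNION_disjoint) (auto simp: pair_families_eq finite_pairings)
  also have "\<dots> = (\<Sum>q=0..?m div 2. (-1) ^ q * (\<Sum>ps\<in>pair_families ?m q. pair_sign ps * contracted f \<omega> xs as ps))"
    by (intro sum.cong refl) (auto simp: sum_distrib_left pair_families_eq mult.assoc intro!: sum.cong)
  finally show ?thesis
    using assms by (simp add: pullback_def contracted_def)
qed

lemma pullback_Nil:
  assumes "as \<in> lists (carrier (Lm L))"
  shows "pullback L f \<omega> [] as = \<omega> [] (map (f1m f) as)"
proof -
  have "pullback L f \<omega> [] as = (\<Sum>ps\<in>{[]}. (-1) ^ length ps * pair_sign ps * contracted f \<omega> [] as ps)"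
    using assms by (subst pullback_eq_sum_pairings) simp_all
  then show ?thesis by (simp add: pair_sign_eq contracted_def)
qed

text \<open>The families that leave the first position unmatched give the first summand, those that match it
  with \<open>x\<^sub>j\<close> the terms of the wedge product.\<close>

lemma \<iota>_pullback:
  fixes L :: "('k::field, 'a, 'b) hl2a"
  assumes x: "x \<in> carrier (L0 L)"
  shows "\<iota> x (pullback L f \<omega>) =
    pullback L f (\<iota> (f10 f x) \<omega>) + wedge L (\<lambda>z. pullback L f (\<kappa> (f2 f x z) \<omega>))"
proof (rule supported_eqI[of _ L])
  fix xs as assume a: "args L xs as"
  let ?m = "length xs"
  let ?s = "\<lambda>ps. (-1) ^ length ps * pair_sign ps"
  have c1: "contracted f \<omega> (x # xs) as (map (map_prod Suc Suc) ps) = contracted f (\<iota> (f10 f x) \<omega>) xs as ps"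
    for ps
  proof -
    have "fst ` set (map (map_prod Suc Suc) ps) \<union> snd ` set (map (map_prod Suc Suc) ps) =
        Suc ` (fst ` set ps \<union> snd ` set ps)"
      by (auto simp: image_iff) force+
    moreover have "nths (x # xs) (- Suc ` U) = x # nths xs (- U)" for U
    proof -
      have "{j. Suc j \<in> - Suc ` U} = - U" by auto
      then show ?thesis by (simp add: nths_Cons)
    qed
    ultimately show ?thesis
      by (simp add: contracted_def \<iota>_def comp_def split_def)
  qed
  have c2: "contracted f \<omega> (x # xs) as ((0, Suc j) # map (map_prod (Suc \<circ> skip j) (Suc \<circ> skip j)) ps) =
      contracted f (\<kappa> (f2 f x (xs ! j)) \<omega>) (nths xs (- {j})) as ps"
    if j: "j < ?m" and ps: "ps \<in> pairings {..<?m - 1}" for j ps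
  proof -
    let ?ps = "(0, Suc j) # map (map_prod (Suc \<circ> skip j) (Suc \<circ> skip j)) ps"
    let ?U = "fst ` set ps \<union> snd ` set ps"
    have "fst ` set ?ps \<union> snd ` set ?ps = insert 0 (Suc ` insert j (skip j ` ?U))"
      by (auto simp: image_iff) force+
    moreover have "nths (x # xs) (- insert 0 (Suc ` U)) = nths xs (- U)" for U
    proof -
      have "{j. Suc j \<in> - insert 0 (Suc ` U)} = - U" by auto
      then show ?thesis by (simp add: nths_Cons)
    qed
    ultimately have "nths (x # xs) (- (fst ` set ?ps \<union> snd ` set ?ps)) = nths (nths xs (- {j})) (- ?U)"
      by (simp only: nths_neg_nths)
    moreover have "map (\<lambda>(a, b). f2 f ((x # xs) ! a) ((x # xs) ! b)) ?ps =
        f2 f x (xs ! j) # map (\<lambda>(a, b). f2 f (nths xs (- {j}) ! a) (nths xs (- {j}) ! b)) ps"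
      using ps j by (auto simp: pairings_def nths_neg_nth)
    ultimately show ?thesis
      by (simp only: contracted_def \<kappa>_def append_Cons)
  qed
  have "\<iota> x (pullback L f \<omega>) xs as =
      (\<Sum>ps\<in>pairings {..<Suc ?m}. ?s ps * contracted f \<omega> (x # xs) as ps)"
    using a x by (simp add: \<iota>_def pullback_eq_sum_pairings)
  also have "\<dots> = (\<Sum>ps\<in>pairings {..<?m}. ?s ps * contracted f (\<iota> (f10 f x) \<omega>) xs as ps) +
      (\<Sum>j<?m. \<Sum>ps\<in>pairings {..<?m - 1}. (-1) ^ j * (?s ps *
        contracted f (\<kappa> (f2 f x (xs ! j)) \<omega>) (nths xs (- {j})) as ps))"
    unfolding sum_pairings_Suc
  proof (intro arg_cong2[where f = "(+)"] sum.cong[OF refl])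
    fix ps
    show "?s (map (map_prod Suc Suc) ps) * contracted f \<omega> (x # xs) as (map (map_prod Suc Suc) ps) =
        ?s ps * contracted f (\<iota> (f10 f x) \<omega>) xs as ps"
      by (simp only: c1 pair_sign_map_Suc length_map)
  next
    fix j ps assume j: "j \<in> {..<?m}" and ps: "ps \<in> pairings {..<?m - 1}"
    let ?ps = "(0, Suc j) # map (map_prod (Suc \<circ> skip j) (Suc \<circ> skip j)) ps"
    have "\<forall>(a, b)\<in>set ps. a < b" using ps by (auto simp: pairings_def)
    from pair_sign_Cons_skip[OF this, of j]
    have eq: "?s ?ps = (-1) ^ j * (?s ps :: 'k)" by simp
    then show "?s ?ps * contracted f \<omega> (x # xs) as ?ps =
        (-1) ^ j * (?s ps * contracted f (\<kappa> (f2 f x (xs ! j)) \<omega>) (nths xs (- {j})) as ps)"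
      using j by (simp only: eq c2[OF _ ps] lessThan_iff) (simp only: mult.assoc)
  qed
  also have "\<dots> = pullback L f (\<iota> (f10 f x) \<omega>) xs as +
      (\<Sum>j<?m. (-1) ^ j * pullback L f (\<kappa> (f2 f x (xs ! j)) \<omega>) (nths xs (- {j})) as)"
    using a by (simp add: pullback_eq_sum_pairings nths_in_lists length_nths_neg sum_distrib_left)
  finally show "\<iota> x (pullback L f \<omega>) xs as =
    (pullback L f (\<iota> (f10 f x) \<omega>) + wedge L (\<lambda>z. pullback L f (\<kappa> (f2 f x z) \<omega>))) xs as"
    using a by (simp add: wedge_def pointwise)
qed simp_all

lemma \<kappa>_pullback_Nil:
  assumes "\<alpha> \<in> carrier (Lm L)" "as \<in> lists (carrier (Lm L))"
  shows "\<kappa> \<alpha> (pullback L f \<omega>) [] as = pullback L f (\<kappa> (f1m f \<alpha>) \<omega>) [] as"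
  using assms by (simp add: \<kappa>_def pullback_Nil)

section \<open>Pulling back along a morphism\<close>

locale hl2a_hom = src: hemistrict_lie_2_algebra L' + tgt: hemistrict_lie_2_algebra L + hl2a_morphism L' L f
  for L' L :: "('k::field, 'a, 'b) hl2a" and f
begin

abbreviation pull :: "('k, 'a, 'b) cochain \<Rightarrow> ('k, 'a, 'b) cochain" where
  "pull \<equiv> pullback L' f"

lemma f_closed [simp]:
  "x \<in> carrier (L0 L') \<Longrightarrow> f10 f x \<in> carrier (L0 L)"
  "\<alpha> \<in> carrier (Lm L') \<Longrightarrow> f1m f \<alpha> \<in> carrier (Lm L)"
  "x \<in> carrier (L0 L') \<Longrightarrow> y \<in> carrier (L0 L') \<Longrightarrow> f2 f x y \<in> carrier (Lm L)"
  using f10_linear f1m_linear f2_bilinear by (auto simp: bilinear_maps_def linear_maps_def)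

lemma f_lin [simp]:
  "x \<in> carrier (L0 L') \<Longrightarrow> y \<in> carrier (L0 L') \<Longrightarrow> f10 f (x \<oplus>\<^bsub>L0 L'\<^esub> y) = f10 f x \<oplus>\<^bsub>L0 L\<^esub> f10 f y"
  "x \<in> carrier (L0 L') \<Longrightarrow> f10 f (c \<odot>\<^bsub>L0 L'\<^esub> x) = c \<odot>\<^bsub>L0 L\<^esub> f10 f x"
  "\<alpha> \<in> carrier (Lm L') \<Longrightarrow> \<beta> \<in> carrier (Lm L') \<Longrightarrow> f1m f (\<alpha> \<oplus>\<^bsub>Lm L'\<^esub> \<beta>) = f1m f \<alpha> \<oplus>\<^bsub>Lm L\<^esub> f1m f \<beta>"
  "\<alpha> \<in> carrier (Lm L') \<Longrightarrow> f1m f (c \<odot>\<^bsub>Lm L'\<^esub> \<alpha>) = c \<odot>\<^bsub>Lm L\<^esub> f1m f \<alpha>"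
  using f10_linear f1m_linear by (auto simp: linear_maps_def)

lemma f2_lin [simp]:
  "x \<in> carrier (L0 L') \<Longrightarrow> y \<in> carrier (L0 L') \<Longrightarrow> z \<in> carrier (L0 L') \<Longrightarrow> f2 f x (y \<oplus>\<^bsub>L0 L'\<^esub> z) = f2 f x y \<oplus>\<^bsub>Lm L\<^esub> f2 f x z"
  "x \<in> carrier (L0 L') \<Longrightarrow> y \<in> carrier (L0 L') \<Longrightarrow> z \<in> carrier (L0 L') \<Longrightarrow> f2 f (x \<oplus>\<^bsub>L0 L'\<^esub> y) z = f2 f x z \<oplus>\<^bsub>Lm L\<^esub> f2 f y z"
  "x \<in> carrier (L0 L') \<Longrightarrow> y \<in> carrier (L0 L') \<Longrightarrow> f2 f x (c \<odot>\<^bsub>L0 L'\<^esub> y) = c \<odot>\<^bsub>Lm L\<^esub> f2 f x y"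
  "x \<in> carrier (L0 L') \<Longrightarrow> y \<in> carrier (L0 L') \<Longrightarrow> f2 f (c \<odot>\<^bsub>L0 L'\<^esub> x) y = c \<odot>\<^bsub>Lm L\<^esub> f2 f x y"
  using f2_bilinear
  by (auto simp: bilinear_maps_def linear_maps_def)

text \<open>In this and the next three lemmas an axiom of a morphism is contracted into a cochain, so that sums
  in the vector spaces become sums of functionals.\<close>

lemma \<iota>_f1_br:
  assumes "x \<in> carrier (L0 L')" "y \<in> carrier (L0 L')" "mixed L \<omega>"
  shows "\<iota> (br L (f10 f x) (f10 f y)) \<omega> = \<iota> (f10 f (br L' x y)) \<omega> + \<iota> (dd L (f2 f x y)) \<omega>"
  using arg_cong[OF f1_br[OF assms(1,2)], of "\<lambda>u. \<iota> u \<omega>"] assms by (simp add: algebra_simps)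

lemma \<kappa>_f1_brR:
  assumes "x \<in> carrier (L0 L')" "\<alpha> \<in> carrier (Lm L')" "mixed L \<omega>"
  shows "\<kappa> (brR L (f10 f x) (f1m f \<alpha>)) \<omega> = \<kappa> (f1m f (brR L' x \<alpha>)) \<omega> + \<kappa> (f2 f x (dd L' \<alpha>)) \<omega>"
  using arg_cong[OF f1_brR[OF assms(1,2)], of "\<lambda>u. \<kappa> u \<omega>"] assms by (simp add: algebra_simps)

lemma \<kappa>_f1_h2:
  assumes "x \<in> carrier (L0 L')" "y \<in> carrier (L0 L')" "mixed L \<omega>"
  shows "\<kappa> (h2 L (f10 f x) (f10 f y)) \<omega> =
    \<kappa> (f1m f (h2 L' x y)) \<omega> + \<kappa> (f2 f x y) \<omega> + \<kappa> (f2 f y x) \<omega>"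
  using arg_cong[OF f1_h2[OF assms(1,2)], of "\<lambda>u. \<kappa> u \<omega>"] assms by (simp add: algebra_simps)

lemma \<kappa>_f2_br:
  assumes "x \<in> carrier (L0 L')" "y \<in> carrier (L0 L')" "z \<in> carrier (L0 L')" "mixed L \<omega>"
  shows "\<kappa> (brR L (f10 f x) (f2 f y z)) \<omega> - \<kappa> (brR L (f10 f y) (f2 f x z)) \<omega>
      - \<kappa> (brL L (f2 f x y) (f10 f z)) \<omega>
    = \<kappa> (f2 f (br L' x y) z) \<omega> + \<kappa> (f2 f y (br L' x z)) \<omega> - \<kappa> (f2 f x (br L' y z)) \<omega>"
  using arg_cong[OF f2_br[OF assms(1,2,3)], of "\<lambda>u. \<kappa> u \<omega>"] assms by simp

text \<open>Both sides obey the same recursion, since contractions with arguments from \<open>L\<^sup>-\<^sup>1\<close> commute with each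
  other and with \<open>wedge\<close>.\<close>

lemma \<kappa>_pull:
  assumes \<alpha>: "\<alpha> \<in> carrier (Lm L')" and \<omega>: "mixed L \<omega>"
  shows "\<kappa> \<alpha> (pull \<omega>) = pull (\<kappa> (f1m f \<alpha>) \<omega>)"
proof -
  let ?E = "\<lambda>\<omega>. \<kappa> \<alpha> (pull \<omega>) - pull (\<kappa> (f1m f \<alpha>) \<omega>)"
  have "?E \<omega> = 0"
  proof (rule contraction_unique[where P = "mixed L" and E = ?E and L = L'])
    fix \<omega> assume "mixed L \<omega>"
    show "?E \<omega> [] [] = 0" using \<alpha> by (simp add: pointwise \<kappa>_pullback_Nil)
  next
    fix \<omega> \<beta> as assume "mixed L \<omega>" and "\<beta> \<in> carrier (Lm L')" "as \<in> lists (carrier (Lm L'))"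
    then show "\<exists>q c. mixed L q \<and> \<kappa> \<beta> (?E \<omega>) [] as = c * ?E q [] as"
      using \<alpha> by (intro exI[of _ \<omega>] exI[of _ 0])
        (simp add: \<kappa>_def[of \<beta>] pointwise \<kappa>_pullback_Nil)
  next
    fix \<omega> x assume \<omega>: "mixed L \<omega>" and x: "x \<in> carrier (L0 L')"
    have "wedge L' (\<lambda>z. pull (\<kappa> (f2 f x z) (\<kappa> (f1m f \<alpha>) \<omega>))) = wedge L' (\<lambda>z. pull (\<kappa> (f1m f \<alpha>) (\<kappa> (f2 f x z) \<omega>)))"
      using \<omega> x \<alpha> by (intro wedge_cong refl arg_cong[of _ _ pull] front_\<kappa>\<kappa>[of L]) simp_all
    then have "\<iota> x (?E \<omega>) = ?E (\<iota> (f10 f x) \<omega>) + wedge L' (\<lambda>z. ?E (\<kappa> (f2 f x z) \<omega>))"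
      using \<omega> x \<alpha> by (simp add: \<iota>_\<kappa> \<iota>_pullback \<kappa>_wedge wedge_linear)
    then show "\<exists>q c r c'. mixed L q \<and> (\<forall>z\<in>carrier (L0 L'). mixed L (r z)) \<and>
        \<iota> x (?E \<omega>) = scale c (?E q) + scale c' (wedge L' (\<lambda>z. ?E (r z)))"
      using \<omega> x
      by (intro exI[of _ "\<iota> (f10 f x) \<omega>"] exI[of _ 1] exI[of _ "\<lambda>z. \<kappa> (f2 f x z) \<omega>"]) simp
  qed (use \<omega> in simp_all)
  then show ?thesis by simp
qed

lemma wedge_wedge_cancel:
  assumes "x \<in> carrier (L0 L')" "y \<in> carrier (L0 L')" "mixed L \<omega>"
  shows "wedge L' (\<lambda>z. wedge L' (\<lambda>w. pull (\<kappa> (f2 f y w) (\<kappa> (f2 f x z) \<omega>)))) =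
    - wedge L' (\<lambda>z. wedge L' (\<lambda>w. pull (\<kappa> (f2 f x w) (\<kappa> (f2 f y z) \<omega>))))"
proof -
  have "wedge L' (\<lambda>z. wedge L' (\<lambda>w. pull (\<kappa> (f2 f y w) (\<kappa> (f2 f x z) \<omega>)))) =
      - wedge L' (\<lambda>w. wedge L' (\<lambda>z. pull (\<kappa> (f2 f y w) (\<kappa> (f2 f x z) \<omega>))))"
    by (rule wedge_anticommute) simp
  also have "wedge L' (\<lambda>w. wedge L' (\<lambda>z. pull (\<kappa> (f2 f y w) (\<kappa> (f2 f x z) \<omega>)))) =
      wedge L' (\<lambda>w. wedge L' (\<lambda>z. pull (\<kappa> (f2 f x z) (\<kappa> (f2 f y w) \<omega>))))"
    using assms by (intro wedge_cong refl arg_cong[of _ _ pull] front_\<kappa>\<kappa>[of L]) simp_all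
  finally show ?thesis .
qed

text \<open>In the symmetrised double contraction of the pullback the double wedge products cancel, and
  so do the terms with one contraction of each kind. What remains is \<open>- f\<^sup>* \<kappa>\<close> at \<open>h2(f(x), f(y)) - f2(x,y) - f2(y,x)\<close>, which is
  \<open>f(h2(x,y))\<close>.\<close>

lemma pull_mixed [simp]:
  assumes "mixed L \<omega>"
  shows "mixed L' (pull \<omega>)"
proof -
  have "mixed_upto L' n (pull \<omega>)" for n
    using assms
  proof (induction n arbitrary: \<omega>)
    case (Suc n)
    note \<omega> [simp] = Suc.prems
    have 1: "\<iota> x (\<iota> y (pull \<omega>)) + \<iota> y (\<iota> x (pull \<omega>)) = - \<kappa> (h2 L' x y) (pull \<omega>)"
      if xy: "x \<in> carrier (L0 L')" "y \<in> carrier (L0 L')" for x y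
    proof -
      have "pull (\<iota> (f10 f x) (\<iota> (f10 f y) \<omega>)) =
          pull (- \<iota> (f10 f y) (\<iota> (f10 f x) \<omega>) - \<kappa> (h2 L (f10 f x) (f10 f y)) \<omega>)"
        using xy by (intro arg_cong[of _ _ pull] front_\<iota>\<iota>) simp_all
      then have "pull (\<iota> (f10 f x) (\<iota> (f10 f y) \<omega>)) + pull (\<iota> (f10 f y) (\<iota> (f10 f x) \<omega>))
          + pull (\<kappa> (f2 f x y) \<omega>) + pull (\<kappa> (f2 f y x) \<omega>) = - pull (\<kappa> (f1m f (h2 L' x y)) \<omega>)"
        using xy by (simp add: pullback_linear \<kappa>_f1_h2)
      moreover have "\<iota> x (\<iota> y (pull \<omega>)) + \<iota> y (\<iota> x (pull \<omega>)) =
          pull (\<iota> (f10 f x) (\<iota> (f10 f y) \<omega>)) + pull (\<iota> (f10 f y) (\<iota> (f10 f x) \<omega>))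
          + pull (\<kappa> (f2 f x y) \<omega>) + pull (\<kappa> (f2 f y x) \<omega>)"
        using xy wedge_wedge_cancel[OF xy \<omega>]
        by (simp add: \<iota>_pullback \<iota>_wedge \<iota>_\<kappa> wedge_linear)
      ultimately show ?thesis
        using xy by (simp add: \<kappa>_pull)
    qed
    have 2: "\<kappa> \<alpha> (\<kappa> \<beta> (pull \<omega>)) = \<kappa> \<beta> (\<kappa> \<alpha> (pull \<omega>))"
      if ab: "\<alpha> \<in> carrier (Lm L')" "\<beta> \<in> carrier (Lm L')" for \<alpha> \<beta>
      using ab front_\<kappa>\<kappa>[OF mixed_front[OF \<omega>], of "f1m f \<alpha>" "f1m f \<beta>"] by (simp add: \<kappa>_pull)
    have "front L' (pull \<omega>)"
      unfolding front_def
      by (intro conjI ballI allI)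
        (rule 1 2; assumption | simp add: \<iota>_pullback \<kappa>_pull pullback_linear wedge_linear scale_linear)+
    moreover have "family_upto L' n (\<lambda>z. pull (\<kappa> (f2 f x z) \<omega>))" if "x \<in> carrier (L0 L')" for x
      using that Suc.IH by (simp add: family_upto_def pullback_linear)
    ultimately show ?case
      using Suc.IH src.wedge_mixed_upto by (intro mixed_upto_SucI) (simp_all add: \<iota>_pullback \<kappa>_pull)
  qed simp
  then show ?thesis by (simp add: mixed_def)
qed

end

context hemistrict_lie_2_algebra
begin

text \<open>The failure of the differential to anticommute with the wedge product: up to sign the wedge product with
  the differential of the tautological 1-form.\<close>

definition wedge_defect :: "('b \<Rightarrow> ('k, 'a, 'b) cochain) \<Rightarrow> ('k, 'a, 'b) cochain" where
  "wedge_defect \<eta> = D L (wedge L \<eta>) + wedge L (\<lambda>z. D L (\<eta> z))"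

lemma wedge_defect_cong: "(\<And>z. z \<in> carrier (L0 L) \<Longrightarrow> \<eta> z = \<zeta> z) \<Longrightarrow> wedge_defect \<eta> = wedge_defect \<zeta>"
  by (simp add: wedge_defect_def)

lemma wedge_defect_linear: "wedge_defect (\<lambda>z. \<eta> z + \<zeta> z) = wedge_defect \<eta> + wedge_defect \<zeta>" "wedge_defect (\<lambda>z. \<eta> z - \<zeta> z) = wedge_defect \<eta> - wedge_defect \<zeta>"
  by (simp_all add: wedge_defect_def wedge_linear D_linear)

lemma wedge_defect_supported [simp]: "wedge_defect \<eta> \<in> supported L"
  by (simp add: wedge_defect_def)

lemma familyD:
  assumes "family L \<eta>"
  shows "x \<in> carrier (L0 L) \<Longrightarrow> mixed L (\<eta> x)"
    "x \<in> carrier (L0 L) \<Longrightarrow> y \<in> carrier (L0 L) \<Longrightarrow> \<eta> (x \<oplus>\<^bsub>L0 L\<^esub> y) = \<eta> x + \<eta> y"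
    "x \<in> carrier (L0 L) \<Longrightarrow> \<eta> (c \<odot>\<^bsub>L0 L\<^esub> x) = scale c (\<eta> x)"
  using assms by (auto simp: family_iff)

lemma \<iota>_wedge_defect:
  assumes "y \<in> carrier (L0 L)" and \<eta>: "family L \<eta>"
  shows "\<iota> y (wedge_defect \<eta>) = wedge_defect (\<lambda>z. \<iota> y (\<eta> z)) - wedge L (\<lambda>z. \<eta> (br L y z))"
  using assms by (simp add: wedge_defect_def \<iota>_D wedge_mixed \<iota>_wedge familyD[OF \<eta>] Lie_wedge D_linear wedge_linear)

lemma wedge_defect_Nil:
  assumes "as \<in> lists (carrier (Lm L))"
  shows "wedge_defect \<eta> [] as = (\<Sum>j<length as. \<eta> (dd L (as ! j)) [] (nths as (- {j})))"
proof -
  have "as ! j \<in> carrier (Lm L)" if "j < length as" for j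
    using assms that by (auto simp: in_lists_conv_set)
  moreover have "nths as I \<in> lists (carrier (Lm L))" for I
    using assms by (rule nths_in_lists)
  ultimately show ?thesis
    using assms by (simp add: wedge_defect_def pointwise D_def wedge_def)
qed

text \<open>The defect is a multiplication by a 2-form and therefore commutes with the wedge product, a
  multiplication by a 1-form.\<close>

lemma wedge_defect_wedge:
  assumes "\<And>z. z \<in> carrier (L0 L) \<Longrightarrow> family L (\<lambda>w. \<eta> z w)"
    and "\<And>w. w \<in> carrier (L0 L) \<Longrightarrow> family L (\<lambda>z. \<eta> z w)"
  shows "wedge_defect (\<lambda>z. wedge L (\<lambda>w. \<eta> z w)) = wedge L (\<lambda>w. wedge_defect (\<lambda>z. \<eta> z w))"
proof -
  let ?P = "\<lambda>\<eta>. (\<forall>z\<in>carrier (L0 L). family L (\<lambda>w. \<eta> z w)) \<and> (\<forall>w\<in>carrier (L0 L). family L (\<lambda>z. \<eta> z w))"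
  let ?E = "\<lambda>\<eta>. wedge_defect (\<lambda>z. wedge L (\<lambda>w. \<eta> z w)) - wedge L (\<lambda>w. wedge_defect (\<lambda>z. \<eta> z w))"
  have nil: "?E \<eta> [] as = 0" if "as \<in> lists (carrier (Lm L))" for \<eta> as
    using that by (simp add: pointwise wedge_defect_Nil)
  have "?E \<eta> = 0"
  proof (rule contraction_unique[where P = ?P and E = ?E and L = L])
    fix \<eta> y assume P: "?P \<eta>" and y: "y \<in> carrier (L0 L)"
    have f1: "family L (\<lambda>w. \<eta> z w)" if "z \<in> carrier (L0 L)" for z using P that by blast
    have f2: "family L (\<lambda>z. \<eta> z w)" if "w \<in> carrier (L0 L)" for w using P that by blast
    have wedge: "family L (\<lambda>z. wedge L (\<lambda>w. \<eta> z w))"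
      unfolding family_iff using f1 by (simp add: wedge_mixed familyD[OF f2] wedge_linear)
    have s: "\<eta> z w \<in> supported L" if "z \<in> carrier (L0 L)" "w \<in> carrier (L0 L)" for z w
      using familyD(1)[OF f1[OF that(1)] that(2)] by simp
    have "wedge_defect (\<lambda>z. \<iota> y (wedge L (\<lambda>w. \<eta> z w))) = wedge_defect (\<lambda>z. \<eta> z y - wedge L (\<lambda>w. \<iota> y (\<eta> z w)))"
      using y by (intro wedge_defect_cong \<iota>_wedge s)
    moreover have "wedge L (\<lambda>z. wedge L (\<lambda>w. \<eta> (br L y z) w)) = - wedge L (\<lambda>w. wedge L (\<lambda>z. \<eta> (br L y z) w))"
      using y by (intro wedge_anticommute s) simp_all
    ultimately have "\<iota> y (?E \<eta>) = - ?E (\<lambda>z w. \<iota> y (\<eta> z w))"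
      using y by (simp add: \<iota>_wedge_defect wedge f2 \<iota>_wedge wedge_defect_linear wedge_linear)
    moreover have "?P (\<lambda>z w. \<iota> y (\<eta> z w))"
      using f1 f2 y by (simp add: family_iff)
    ultimately show "\<exists>q c r c'. ?P q \<and> (\<forall>z\<in>carrier (L0 L). ?P (r z)) \<and>
        \<iota> y (?E \<eta>) = scale c (?E q) + scale c' (wedge L (\<lambda>z. ?E (r z)))"
      using P by (intro exI[of _ "\<lambda>z w. \<iota> y (\<eta> z w)"] exI[of _ "-1"] exI[of _ "\<lambda>_. \<eta>"] exI[of _ 0]) simp
  next
    fix \<eta> \<alpha> as assume "?P \<eta>" "\<alpha> \<in> carrier (Lm L)" "as \<in> lists (carrier (Lm L))"
    then show "\<exists>q c. ?P q \<and> \<kappa> \<alpha> (?E \<eta>) [] as = c * ?E q [] as"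
      using nil[of "\<alpha> # as" \<eta>] by (intro exI[of _ \<eta>] exI[of _ 0]) (simp add: \<kappa>_def)
  next
    fix \<eta> show "?E \<eta> [] [] = 0" by (rule nil) simp
  qed (use assms in simp_all)
  then show ?thesis by simp
qed

end

context hl2a_hom
begin

text \<open>The tautological 1-form of \<open>L\<close> pulls back to \<open>f\<close>. The terms that arise from the \<open>f2\<close>-part of the
  recursion on the two sides differ by the order of two wedge products.\<close>

lemma pull_wedge:
  assumes "\<And>z. z \<in> carrier (L0 L) \<Longrightarrow> \<eta> z \<in> supported L"
  shows "pull (wedge L \<eta>) = wedge L' (\<lambda>z. pull (\<eta> (f10 f z)))"
proof -
  let ?P = "\<lambda>\<eta>. \<forall>z\<in>carrier (L0 L). \<eta> z \<in> supported L"
  let ?E = "\<lambda>\<eta>. pull (wedge L \<eta>) - wedge L' (\<lambda>z. pull (\<eta> (f10 f z)))"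
  have nil: "?E \<eta> [] as = 0" if "as \<in> lists (carrier (Lm L'))" for \<eta> as
    using that by (simp add: pointwise pullback_Nil)
  have "?E \<eta> = 0"
  proof (rule contraction_unique[where P = ?P and E = ?E and L = L'])
    fix \<eta> x assume P: "?P \<eta>" and x: "x \<in> carrier (L0 L')"
    have "wedge L' (\<lambda>z. wedge L' (\<lambda>w. pull (\<kappa> (f2 f x w) (\<eta> (f10 f z))))) =
        - wedge L' (\<lambda>w. wedge L' (\<lambda>z. pull (\<kappa> (f2 f x w) (\<eta> (f10 f z)))))"
      by (intro wedge_anticommute) simp
    then have "\<iota> x (?E \<eta>) = - ?E (\<lambda>u. \<iota> (f10 f x) (\<eta> u)) + wedge L' (\<lambda>z. ?E (\<lambda>u. \<kappa> (f2 f x z) (\<eta> u)))"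
      using P x by (simp add: \<iota>_pullback \<iota>_wedge \<kappa>_wedge pullback_linear wedge_linear)
    then show "\<exists>q c r c'. ?P q \<and> (\<forall>z\<in>carrier (L0 L'). ?P (r z)) \<and>
        \<iota> x (?E \<eta>) = scale c (?E q) + scale c' (wedge L' (\<lambda>z. ?E (r z)))"
      using P by (intro exI[of _ "\<lambda>u. \<iota> (f10 f x) (\<eta> u)"] exI[of _ "-1"]
          exI[of _ "\<lambda>z u. \<kappa> (f2 f x z) (\<eta> u)"] exI[of _ 1]) simp
  next
    fix \<eta> \<alpha> as assume "?P \<eta>" "\<alpha> \<in> carrier (Lm L')" "as \<in> lists (carrier (Lm L'))"
    then show "\<exists>q c. ?P q \<and> \<kappa> \<alpha> (?E \<eta>) [] as = c * ?E q [] as"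
      using nil[of "\<alpha> # as" \<eta>] by (intro exI[of _ \<eta>] exI[of _ 0]) (simp add: \<kappa>_def)
  next
    fix \<eta> show "?E \<eta> [] [] = 0" by (rule nil) simp
  qed (use assms in simp_all)
  then show ?thesis by simp
qed

lemma pull_Liem:
  assumes "\<beta> \<in> carrier (Lm L)" "\<omega> \<in> supported L"
  shows "pull (Liem L \<beta> \<omega>) = pull (\<iota> (dd L \<beta>) \<omega>) + wedge L' (\<lambda>z. pull (\<kappa> (brL L \<beta> (f10 f z)) \<omega>))"
  using assms by (simp add: Liem_def pullback_linear pull_wedge)

lemma map_f1m_lists: "as \<in> lists (carrier (Lm L')) \<Longrightarrow> map (f1m f) as \<in> lists (carrier (Lm L))"
  by (auto simp: in_lists_conv_set)

text \<open>The failure of the pullback to commute with Lie derivatives. The two summands are those that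
  Cartan's formula produces when \<open>D\<close> passes through the term \<open>wedge (\<lambda>z. f\<^sup>* \<kappa>\<^bsub>f2(x,z)\<^esub> \<omega>)\<close> of
  the recursion.\<close>

definition Lie_defect :: "'b \<Rightarrow> ('k, 'a, 'b) cochain \<Rightarrow> ('k, 'a, 'b) cochain" where
  "Lie_defect x \<omega> = wedge L' (\<lambda>z. pull (Liem L (f2 f x z) \<omega>)) + src.wedge_defect (\<lambda>z. pull (\<kappa> (f2 f x z) \<omega>))"

text \<open>Without arguments from \<open>L\<^sup>0\<close> the statement is the compatibility of \<open>f\<close> with the action of \<open>x\<close> on
  \<open>L\<^sup>-\<^sup>1\<close>, whose correction \<open>f2(x, d\<alpha>)\<close> is what the defect contributes.\<close>

lemma Lie_pull_Nil:
  assumes x: "x \<in> carrier (L0 L')" and \<omega>: "mixed L \<omega>" and as: "as \<in> lists (carrier (Lm L'))"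
  shows "Lie L' x (pull \<omega>) [] as = pull (Lie L (f10 f x) \<omega>) [] as + Lie_defect x \<omega> [] as"
proof -
  let ?as = "map (f1m f) as"
  have mem: "as ! j \<in> carrier (Lm L')" if "j < length as" for j
    using as that by (auto simp: in_lists_conv_set)
  have lists: "as[j := \<alpha>] \<in> lists (carrier (Lm L'))" if "\<alpha> \<in> carrier (Lm L')" for j \<alpha>
    using as that set_update_subset_insert[of as j \<alpha>] by (auto simp: in_lists_conv_set)
  have 1: "\<omega> [] (?as[j := brR L (f10 f x) (f1m f (as ! j))]) =
      \<omega> [] (?as[j := f1m f (brR L' x (as ! j))]) +
      \<kappa> (f2 f x (dd L' (as ! j))) \<omega> [] (nths ?as (- {j}))" if j: "j < length as" for j
    using fun_cong[OF fun_cong[OF \<kappa>_f1_brR[OF x mem[OF j] \<omega>], of "[]"], of "nths ?as (- {j})"]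
      j x mem[OF j] \<omega> map_f1m_lists[OF as]
    by (simp add: pointwise mixed_\<kappa>_replace[OF \<omega>])
  have "Lie_defect x \<omega> [] as = (\<Sum>j<length as. \<kappa> (f2 f x (dd L' (as ! j))) \<omega> [] (nths ?as (- {j})))"
    using as by (simp add: Lie_defect_def pointwise src.wedge_defect_Nil pullback_Nil nths_in_lists nths_map)
  moreover have "Lie L' x (pull \<omega>) [] as = - (\<Sum>j<length as. \<omega> [] (?as[j := f1m f (brR L' x (as ! j))]))"
    using as x mem by (simp add: Lie_def pullback_Nil lists map_update)
  moreover have "pull (Lie L (f10 f x) \<omega>) [] as =
      - (\<Sum>j<length as. \<omega> [] (?as[j := brR L (f10 f x) (f1m f (as ! j))]))"
    using as map_f1m_lists[OF as] by (simp add: pullback_Nil Lie_def)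
  ultimately show ?thesis by (simp add: 1 sum.distrib)
qed

text \<open>The first two terms have the shape of the recursion for the pullback. The other three are the
  inhomogeneous terms that also arise when the commutator of pullback and Lie derivative is contracted,
  see lemma \<open>Lie_pull\<close>.\<close>

lemma \<iota>_Lie_defect:
  assumes x [simp]: "x \<in> carrier (L0 L')" and y [simp]: "y \<in> carrier (L0 L')" and \<omega> [simp]: "mixed L \<omega>"
  shows "\<iota> y (Lie_defect x \<omega>) = Lie_defect x (\<iota> (f10 f y) \<omega>) + wedge L' (\<lambda>z. Lie_defect x (\<kappa> (f2 f y z) \<omega>))
    + pull (Liem L (f2 f x y) \<omega>) + wedge L' (\<lambda>z. pull (\<kappa> (brR L (f10 f y) (f2 f x z)) \<omega>))
    - wedge L' (\<lambda>z. pull (\<kappa> (f2 f x (br L' y z)) \<omega>))"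
proof -
  let ?A = "\<lambda>z w. pull (Liem L (f2 f x z) (\<kappa> (f2 f y w) \<omega>))"
  let ?B = "\<lambda>z w. pull (\<kappa> (f2 f x z) (\<kappa> (f2 f y w) \<omega>))"
  have k: "\<kappa> (f2 f y w) (\<kappa> (f2 f x z) \<omega>) = \<kappa> (f2 f x z) (\<kappa> (f2 f y w) \<omega>)"
    if "z \<in> carrier (L0 L')" "w \<in> carrier (L0 L')" for z w
    using that by (intro front_\<kappa>\<kappa>[of L]) simp_all
  have "wedge L' (\<lambda>z. wedge L' (\<lambda>w. ?A z w)) = - wedge L' (\<lambda>w. wedge L' (\<lambda>z. ?A z w))"
    by (intro wedge_anticommute) simp
  then have 1: "\<iota> y (wedge L' (\<lambda>z. pull (Liem L (f2 f x z) \<omega>))) =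
      wedge L' (\<lambda>z. pull (Liem L (f2 f x z) (\<iota> (f10 f y) \<omega>))) + wedge L' (\<lambda>w. wedge L' (\<lambda>z. ?A z w))
      + pull (Liem L (f2 f x y) \<omega>) + wedge L' (\<lambda>z. pull (\<kappa> (brR L (f10 f y) (f2 f x z)) \<omega>))"
    by (simp add: \<iota>_wedge \<iota>_pullback tgt.\<iota>_Liem tgt.\<kappa>_Liem pullback_linear wedge_linear)
  have family: "family L' (\<lambda>z. pull (\<kappa> (f2 f x z) \<omega>))"
    by (simp add: family_iff pullback_linear)
  have "src.wedge_defect (\<lambda>z. \<iota> y (pull (\<kappa> (f2 f x z) \<omega>))) =
      src.wedge_defect (\<lambda>z. pull (\<kappa> (f2 f x z) (\<iota> (f10 f y) \<omega>)) + wedge L' (\<lambda>w. ?B z w))"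
    by (intro src.wedge_defect_cong) (simp add: \<iota>_pullback \<iota>_\<kappa> k)
  also have "\<dots> = src.wedge_defect (\<lambda>z. pull (\<kappa> (f2 f x z) (\<iota> (f10 f y) \<omega>))) + wedge L' (\<lambda>w. src.wedge_defect (\<lambda>z. ?B z w))"
    unfolding src.wedge_defect_linear
    by (subst src.wedge_defect_wedge) (simp_all add: family_iff pullback_linear)
  finally have 2: "\<iota> y (src.wedge_defect (\<lambda>z. pull (\<kappa> (f2 f x z) \<omega>))) =
      src.wedge_defect (\<lambda>z. pull (\<kappa> (f2 f x z) (\<iota> (f10 f y) \<omega>))) + wedge L' (\<lambda>w. src.wedge_defect (\<lambda>z. ?B z w))
      - wedge L' (\<lambda>z. pull (\<kappa> (f2 f x (br L' y z)) \<omega>))"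
    by (simp add: src.\<iota>_wedge_defect family)
  show ?thesis
    by (simp add: Lie_defect_def 1 2 wedge_linear)
qed

text \<open>Under \<open>\<iota>\<^sub>y\<close> the left-hand side produces the element \<open>d f2(x,y)\<close> by which \<open>f\<close> fails to respect
  brackets, together with a wedge product of three terms in \<open>f2\<close> and \<open>[f(x), -]\<close>. The coherence axiom for
  \<open>f2\<close> rewrites these into the inhomogeneous terms of the defect.\<close>

lemma Lie_pull:
  assumes x [simp]: "x \<in> carrier (L0 L')" and \<omega>: "mixed L \<omega>"
  shows "Lie L' x (pull \<omega>) = pull (Lie L (f10 f x) \<omega>) + Lie_defect x \<omega>"
proof -
  let ?E = "\<lambda>\<omega>. Lie L' x (pull \<omega>) - pull (Lie L (f10 f x) \<omega>) - Lie_defect x \<omega>"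
  have nil: "?E \<omega> [] as = 0" if "as \<in> lists (carrier (Lm L'))" "mixed L \<omega>" for \<omega> as
    using Lie_pull_Nil[OF x that(2,1)] by (simp add: pointwise)
  have "?E \<omega> = 0"
  proof (rule contraction_unique[where P = "mixed L" and E = ?E and L = L'])
    fix \<omega> y assume \<omega> [simp]: "mixed L \<omega>" and y [simp]: "y \<in> carrier (L0 L')"
    have "wedge L' (\<lambda>z. pull (\<kappa> (brR L (f10 f x) (f2 f y z)) \<omega> - \<kappa> (brR L (f10 f y) (f2 f x z)) \<omega>
          - \<kappa> (brL L (f2 f x y) (f10 f z)) \<omega>)) =
        wedge L' (\<lambda>z. pull (\<kappa> (f2 f (br L' x y) z) \<omega> + \<kappa> (f2 f y (br L' x z)) \<omega> - \<kappa> (f2 f x (br L' y z)) \<omega>))"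
      by (intro wedge_cong refl arg_cong[of _ _ pull] \<kappa>_f2_br) simp_all
    then have rel: "wedge L' (\<lambda>z. pull (\<kappa> (brR L (f10 f x) (f2 f y z)) \<omega>)) =
        wedge L' (\<lambda>z. pull (\<kappa> (brR L (f10 f y) (f2 f x z)) \<omega>))
        + wedge L' (\<lambda>z. pull (\<kappa> (brL L (f2 f x y) (f10 f z)) \<omega>))
        + wedge L' (\<lambda>z. pull (\<kappa> (f2 f (br L' x y) z) \<omega>)) + wedge L' (\<lambda>z. pull (\<kappa> (f2 f y (br L' x z)) \<omega>))
        - wedge L' (\<lambda>z. pull (\<kappa> (f2 f x (br L' y z)) \<omega>))"
      by (simp add: pullback_linear wedge_linear algebra_simps)
    have "\<iota> y (?E \<omega>) = ?E (\<iota> (f10 f y) \<omega>) + wedge L' (\<lambda>z. ?E (\<kappa> (f2 f y z) \<omega>))"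
      by (simp add: \<iota>_Lie_defect src.\<iota>_Lie tgt.\<iota>_Lie tgt.\<kappa>_Lie \<iota>_pullback src.Lie_wedge Lie_linear pullback_linear
          wedge_linear \<iota>_f1_br pull_Liem rel)
    then show "\<exists>q c r c'. mixed L q \<and> (\<forall>z\<in>carrier (L0 L'). mixed L (r z)) \<and>
        \<iota> y (?E \<omega>) = scale c (?E q) + scale c' (wedge L' (\<lambda>z. ?E (r z)))"
      by (intro exI[of _ "\<iota> (f10 f y) \<omega>"] exI[of _ 1] exI[of _ "\<lambda>z. \<kappa> (f2 f y z) \<omega>"]) simp
  next
    fix \<omega> \<alpha> as assume "mixed L \<omega>" "\<alpha> \<in> carrier (Lm L')" "as \<in> lists (carrier (Lm L'))"
    then show "\<exists>q c. mixed L q \<and> \<kappa> \<alpha> (?E \<omega>) [] as = c * ?E q [] as"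
      using nil[of "\<alpha> # as" \<omega>] by (intro exI[of _ \<omega>] exI[of _ 0]) (simp add: \<kappa>_def)
  next
    fix \<omega> assume "mixed L \<omega>"
    then show "?E \<omega> [] [] = 0" by (intro nil) simp_all
  qed (use \<omega> in \<open>simp_all add: Lie_defect_def\<close>)
  then show ?thesis by (simp add: algebra_simps)
qed

text \<open>In the recursion under \<open>\<iota>\<^sub>x\<close>, Cartan's formula yields the difference of \<open>L\<^sub>x f\<^sup>*\<close> and \<open>f\<^sup>* L\<^bsub>f(x)\<^esub>\<close>, and the
  \<open>f2\<close>-part yields the defect.\<close>

theorem D_pull:
  assumes \<omega>: "mixed L \<omega>"
  shows "D L' (pull \<omega>) = pull (D L \<omega>)"
proof -
  let ?E = "\<lambda>\<omega>. D L' (pull \<omega>) - pull (D L \<omega>)"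
  have nil: "?E \<omega> [] as = 0" if as: "as \<in> lists (carrier (Lm L'))" for \<omega> as
  proof -
    have mem: "as ! j \<in> carrier (Lm L')" if "j < length as" for j
      using as that by (auto simp: in_lists_conv_set)
    have "pull \<omega> [dd L' (as ! j)] (nths as (- {j})) =
        \<omega> [dd L (map (f1m f) as ! j)] (nths (map (f1m f) as) (- {j}))" if j: "j < length as" for j
    proof -
      have "\<iota> (dd L' (as ! j)) (pull \<omega>) [] (nths as (- {j})) =
          \<iota> (f10 f (dd L' (as ! j))) \<omega> [] (map (f1m f) (nths as (- {j})))"
        using mem[OF j] as by (simp add: \<iota>_pullback pointwise pullback_Nil nths_in_lists)
      then show ?thesis
        using j by (simp add: \<iota>_def f1_dd[OF mem[OF j]] nths_map)
    qed
    then show ?thesis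
      using as map_f1m_lists[OF as] by (simp add: pointwise pullback_Nil) (simp add: D_def)
  qed
  have "?E \<omega> = 0"
  proof (rule contraction_unique[where P = "mixed L" and E = ?E and L = L'])
    fix \<omega> x assume \<omega> [simp]: "mixed L \<omega>" and x [simp]: "x \<in> carrier (L0 L')"
    have "\<iota> x (?E \<omega>) = - ?E (\<iota> (f10 f x) \<omega>) + wedge L' (\<lambda>z. ?E (\<kappa> (f2 f x z) \<omega>))"
      by (simp add: src.\<iota>_D tgt.\<iota>_D tgt.\<kappa>_D \<iota>_pullback Lie_pull Lie_defect_def src.wedge_defect_def D_linear pullback_linear wedge_linear)
    then show "\<exists>q c r c'. mixed L q \<and> (\<forall>z\<in>carrier (L0 L'). mixed L (r z)) \<and>
        \<iota> x (?E \<omega>) = scale c (?E q) + scale c' (wedge L' (\<lambda>z. ?E (r z)))"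
      by (intro exI[of _ "\<iota> (f10 f x) \<omega>"] exI[of _ "-1"] exI[of _ "\<lambda>z. \<kappa> (f2 f x z) \<omega>"] exI[of _ 1]) simp
  next
    fix \<omega> \<alpha> as assume "mixed L \<omega>" "\<alpha> \<in> carrier (Lm L')" "as \<in> lists (carrier (Lm L'))"
    then show "\<exists>q c. mixed L q \<and> \<kappa> \<alpha> (?E \<omega>) [] as = c * ?E q [] as"
      using nil[of "\<alpha> # as" \<omega>] by (intro exI[of _ \<omega>] exI[of _ 0]) (simp add: \<kappa>_def)
  next
    fix \<omega> show "?E \<omega> [] [] = 0" by (rule nil) simp
  qed (use \<omega> in simp_all)
  then show ?thesis by simp
qed

end

section \<open>The category of cochain complexes\<close>

lemma linear_mapsD:
  assumes "f \<in> linear_maps U V"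
  shows "x \<in> carrier U \<Longrightarrow> f x \<in> carrier V"
    "x \<in> carrier U \<Longrightarrow> y \<in> carrier U \<Longrightarrow> f (x \<oplus>\<^bsub>U\<^esub> y) = f x \<oplus>\<^bsub>V\<^esub> f y"
    "x \<in> carrier U \<Longrightarrow> f (c \<odot>\<^bsub>U\<^esub> x) = c \<odot>\<^bsub>V\<^esub> f x"
  using assms by (auto simp: linear_maps_def)

lemma linear_mapsI:
  assumes "\<And>x. x \<in> carrier U \<Longrightarrow> f x \<in> carrier V"
    "\<And>x y. x \<in> carrier U \<Longrightarrow> y \<in> carrier U \<Longrightarrow> f (x \<oplus>\<^bsub>U\<^esub> y) = f x \<oplus>\<^bsub>V\<^esub> f y"
    "\<And>c x. x \<in> carrier U \<Longrightarrow> f (c \<odot>\<^bsub>U\<^esub> x) = c \<odot>\<^bsub>V\<^esub> f x"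
  shows "f \<in> linear_maps U V"
  using assms by (auto simp: linear_maps_def)

lemma vspace_closed:
  assumes "vspace V"
  shows "x \<in> carrier V \<Longrightarrow> y \<in> carrier V \<Longrightarrow> x \<oplus>\<^bsub>V\<^esub> y \<in> carrier V"
    "x \<in> carrier V \<Longrightarrow> c \<odot>\<^bsub>V\<^esub> x \<in> carrier V" "\<zero>\<^bsub>V\<^esub> \<in> carrier V"
    "x \<in> carrier V \<Longrightarrow> 0 \<odot>\<^bsub>V\<^esub> x = \<zero>\<^bsub>V\<^esub>" "c \<odot>\<^bsub>V\<^esub> \<zero>\<^bsub>V\<^esub> = \<zero>\<^bsub>V\<^esub>"
    "\<zero>\<^bsub>V\<^esub> \<oplus>\<^bsub>V\<^esub> \<zero>\<^bsub>V\<^esub> = \<zero>\<^bsub>V\<^esub>"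
proof -
  interpret V: module scalars V by (rule assms)
  have s: "c \<in> carrier scalars" "\<zero>\<^bsub>scalars\<^esub> = 0" for c by (simp_all add: scalars_def)
  show "x \<in> carrier V \<Longrightarrow> y \<in> carrier V \<Longrightarrow> x \<oplus>\<^bsub>V\<^esub> y \<in> carrier V"
    "x \<in> carrier V \<Longrightarrow> c \<odot>\<^bsub>V\<^esub> x \<in> carrier V" "\<zero>\<^bsub>V\<^esub> \<in> carrier V"
    "x \<in> carrier V \<Longrightarrow> 0 \<odot>\<^bsub>V\<^esub> x = \<zero>\<^bsub>V\<^esub>" "c \<odot>\<^bsub>V\<^esub> \<zero>\<^bsub>V\<^esub> = \<zero>\<^bsub>V\<^esub>"
    "\<zero>\<^bsub>V\<^esub> \<oplus>\<^bsub>V\<^esub> \<zero>\<^bsub>V\<^esub> = \<zero>\<^bsub>V\<^esub>"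
    using V.smult_l_null[of x] by (simp_all add: s)
qed

lemma linear_zero:
  assumes "f \<in> linear_maps U V" "vspace U" "vspace V"
  shows "f \<zero>\<^bsub>U\<^esub> = \<zero>\<^bsub>V\<^esub>"
  using linear_mapsD(3)[OF assms(1), of "\<zero>\<^bsub>U\<^esub>" 0] linear_mapsD(1)[OF assms(1), of "\<zero>\<^bsub>U\<^esub>"]
    vspace_closed[OF assms(2)] vspace_closed[OF assms(3)] by simp

lemma restrict_linear:
  assumes "vspace U"
  shows "restrict f (carrier U) \<in> linear_maps U V \<longleftrightarrow> f \<in> linear_maps U V"
  using vspace_closed[OF assms] by (simp add: linear_maps_def Pi_iff)

lemma compose_linear:
  "f \<in> linear_maps U V \<Longrightarrow> g \<in> linear_maps V Z \<Longrightarrow> (\<lambda>x. g (f x)) \<in> linear_maps U Z"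
  by (simp add: linear_maps_def Pi_iff)

lemma cochain_mapsD:
  assumes "\<phi> \<in> cochain_maps A B"
  shows "\<phi> n \<in> linear_maps (space A n) (space B n)" "\<phi> n \<in> extensional (carrier (space A n))"
    "x \<in> carrier (space A n) \<Longrightarrow> \<phi> (n + 1) (diff A n x) = diff B n (\<phi> n x)"
  using assms by (simp_all add: cochain_maps_def)

lemma is_cochain_complexD:
  assumes "is_cochain_complex A"
  shows "vspace (space A n)" "x \<in> carrier (space A n) \<Longrightarrow> diff A n x \<in> carrier (space A (n + 1))"
proof -
  show "vspace (space A n)" using assms by (simp add: is_cochain_complex_def)
  have "diff A n \<in> linear_maps (space A n) (space A (n + 1))"
    using assms by (simp add: is_cochain_complex_def)
  then show "x \<in> carrier (space A n) \<Longrightarrow> diff A n x \<in> carrier (space A (n + 1))"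
    by (rule linear_mapsD)
qed

lemma category_cochain_complexes: "category (cochain_complexes :: (('k::field, 'w) cochain_complex, _) category)"
proof
  fix A :: "('k, 'w) cochain_complex"
  assume "A \<in> Obj cochain_complexes"
  then show "Id cochain_complexes A \<in> Hom cochain_complexes A A"
    by (auto simp: cochain_complexes_def cochain_maps_def is_cochain_complex_def restrict_linear
        intro!: linear_mapsI dest: linear_mapsD)
next
  fix A B C :: "('k, 'w) cochain_complex" and f g
  assume "A \<in> Obj cochain_complexes" "f \<in> Hom cochain_complexes A B" "g \<in> Hom cochain_complexes B C"
  then have A: "is_cochain_complex A" and f: "f \<in> cochain_maps A B" and g: "g \<in> cochain_maps B C"
    by (simp_all add: cochain_complexes_def)
  have "(\<lambda>n. \<lambda>x\<in>carrier (space A n). g n (f n x)) \<in> cochain_maps A C"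
    unfolding cochain_maps_def
  proof (intro CollectI conjI allI ballI IntI restrict_extensional)
    fix n
    show "(\<lambda>x\<in>carrier (space A n). g n (f n x)) \<in> linear_maps (space A n) (space C n)"
      unfolding restrict_linear[OF is_cochain_complexD(1)[OF A]]
      by (rule compose_linear[OF cochain_mapsD(1)[OF f] cochain_mapsD(1)[OF g]])
    fix x assume x: "x \<in> carrier (space A n)"
    then show "(\<lambda>x\<in>carrier (space A (n + 1)). g (n + 1) (f (n + 1) x)) (diff A n x) =
        diff C n ((\<lambda>x\<in>carrier (space A n). g n (f n x)) x)"
      using is_cochain_complexD(2)[OF A x] linear_mapsD(1)[OF cochain_mapsD(1)[OF f] x]
      by (simp add: cochain_mapsD(3)[OF f] cochain_mapsD(3)[OF g])
  qed
  then show "Cmp cochain_complexes A B C g f \<in> Hom cochain_complexes A C"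
    by (simp add: cochain_complexes_def)
next
  fix A B :: "('k, 'w) cochain_complex" and f
  assume "A \<in> Obj cochain_complexes" "B \<in> Obj cochain_complexes" "f \<in> Hom cochain_complexes A B"
  then have f: "f \<in> cochain_maps A B" by (simp add: cochain_complexes_def)
  have "f n x \<in> carrier (space B n)" if "x \<in> carrier (space A n)" for n x
    using linear_mapsD(1)[OF cochain_mapsD(1)[OF f] that] .
  then show "Cmp cochain_complexes A A B f (Id cochain_complexes A) = f"
    "Cmp cochain_complexes A B B (Id cochain_complexes B) f = f"
    using extensional_arb[OF cochain_mapsD(2)[OF f]]
    by (simp_all add: cochain_complexes_def fun_eq_iff restrict_def)
next
  fix A B C E :: "('k, 'w) cochain_complex" and f g h
  assume "f \<in> Hom cochain_complexes A B"
  then have "f n x \<in> carrier (space B n)" if "x \<in> carrier (space A n)" for n x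
    using that linear_mapsD(1)[OF cochain_mapsD(1)] by (simp add: cochain_complexes_def)
  then show "Cmp cochain_complexes A C E h (Cmp cochain_complexes A B C g f) =
     Cmp cochain_complexes A B E (Cmp cochain_complexes B C E h g) f"
    by (auto simp: cochain_complexes_def fun_eq_iff restrict_def)
qed

section \<open>The category of hemistrict Lie 2-algebras\<close>

text \<open>Equations between differences are turned into equations between sums, which have a normal form under
  associativity and commutativity.\<close>

lemma (in abelian_group) diff_eq_iff:
  "a \<in> carrier G \<Longrightarrow> b \<in> carrier G \<Longrightarrow> c \<in> carrier G \<Longrightarrow> a \<ominus> b = c \<longleftrightarrow> a = c \<oplus> b"
  by (metis a_minus_def add.inv_solve_right a_closed a_inv_closed)

lemma (in abelian_group) diff3_eq_iff:
  assumes "a \<in> carrier G" "b \<in> carrier G" "c \<in> carrier G" "p \<in> carrier G" "q \<in> carrier G" "r \<in> carrier G"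
  shows "(a \<ominus> b) \<ominus> c = (p \<oplus> q) \<ominus> r \<longleftrightarrow> a \<oplus> r = p \<oplus> (q \<oplus> (c \<oplus> b))"
proof -
  have "(a \<ominus> b) \<ominus> c = (p \<oplus> q) \<ominus> r \<longleftrightarrow> a = (((p \<oplus> q) \<ominus> r) \<oplus> c) \<oplus> b"
    using assms by (simp add: diff_eq_iff)
  also have "(((p \<oplus> q) \<ominus> r) \<oplus> c) \<oplus> b = (p \<oplus> (q \<oplus> (c \<oplus> b))) \<ominus> r"
    using assms by (simp add: a_minus_def a_ac)
  also have "a = (p \<oplus> (q \<oplus> (c \<oplus> b))) \<ominus> r \<longleftrightarrow> (p \<oplus> (q \<oplus> (c \<oplus> b))) \<ominus> r = a" by auto
  also have "\<dots> \<longleftrightarrow> p \<oplus> (q \<oplus> (c \<oplus> b)) = a \<oplus> r"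
    using assms by (subst diff_eq_iff) simp_all
  finally show ?thesis by auto
qed

context hl2a_hom
begin

lemma f_lin_zero [simp]: "f1m f \<zero>\<^bsub>Lm L'\<^esub> = \<zero>\<^bsub>Lm L\<^esub>"
  using linear_zero[OF f1m_linear src.Lm_vspace tgt.Lm_vspace] .

lemma f1_br_add:
  assumes "x \<in> carrier (L0 L')" "y \<in> carrier (L0 L')"
  shows "br L (f10 f x) (f10 f y) = dd L (f2 f x y) \<oplus>\<^bsub>L0 L\<^esub> f10 f (br L' x y)"
  using f1_br[OF assms] assms by (simp add: tgt.M0.diff_eq_iff)

lemma f1_brL_add:
  assumes "\<alpha> \<in> carrier (Lm L')" "y \<in> carrier (L0 L')"
  shows "brL L (f1m f \<alpha>) (f10 f y) = f2 f (dd L' \<alpha>) y \<oplus>\<^bsub>Lm L\<^esub> f1m f (brL L' \<alpha> y)"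
  using f1_brL[OF assms] assms by (simp add: tgt.Mm.diff_eq_iff)

lemma f1_brR_add:
  assumes "x \<in> carrier (L0 L')" "\<alpha> \<in> carrier (Lm L')"
  shows "brR L (f10 f x) (f1m f \<alpha>) = f2 f x (dd L' \<alpha>) \<oplus>\<^bsub>Lm L\<^esub> f1m f (brR L' x \<alpha>)"
  using f1_brR[OF assms] assms by (simp add: tgt.Mm.diff_eq_iff)

lemma f1_h2_add:
  assumes "x \<in> carrier (L0 L')" "y \<in> carrier (L0 L')"
  shows "h2 L (f10 f x) (f10 f y) = (f2 f x y \<oplus>\<^bsub>Lm L\<^esub> f2 f y x) \<oplus>\<^bsub>Lm L\<^esub> f1m f (h2 L' x y)"
  using f1_h2[OF assms] assms by (simp add: tgt.Mm.diff_eq_iff)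

lemma f2_br_add:
  assumes "x \<in> carrier (L0 L')" "y \<in> carrier (L0 L')" "z \<in> carrier (L0 L')"
  shows "brR L (f10 f x) (f2 f y z) \<oplus>\<^bsub>Lm L\<^esub> f2 f x (br L' y z) =
    f2 f (br L' x y) z \<oplus>\<^bsub>Lm L\<^esub> (f2 f y (br L' x z) \<oplus>\<^bsub>Lm L\<^esub>
      (brL L (f2 f x y) (f10 f z) \<oplus>\<^bsub>Lm L\<^esub> brR L (f10 f y) (f2 f x z)))"
  using f2_br[OF assms] assms by (simp add: tgt.Mm.diff3_eq_iff)

end

locale hl2a_hom_comp = F': hl2a_hom L'' L' f' + F: hl2a_hom L' L f
  for L'' L' L :: "('k::field, 'a, 'b) hl2a" and f' f
begin

abbreviation h :: "('a, 'b) hl2a_mor" where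
  "h \<equiv> hl2a_comp L'' L' L f f'"

lemma h_simps [simp]:
  "x \<in> carrier (L0 L'') \<Longrightarrow> f10 h x = f10 f (f10 f' x)"
  "\<alpha> \<in> carrier (Lm L'') \<Longrightarrow> f1m h \<alpha> = f1m f (f1m f' \<alpha>)"
  "x \<in> carrier (L0 L'') \<Longrightarrow> y \<in> carrier (L0 L'') \<Longrightarrow>
    f2 h x y = f2 f (f10 f' x) (f10 f' y) \<oplus>\<^bsub>Lm L\<^esub> f1m f (f2 f' x y)"
  by (simp_all add: hl2a_comp_def)

lemma h_closed:
  "x \<in> carrier (L0 L'') \<Longrightarrow> f10 h x \<in> carrier (L0 L)"
  "\<alpha> \<in> carrier (Lm L'') \<Longrightarrow> f1m h \<alpha> \<in> carrier (Lm L)"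
  "x \<in> carrier (L0 L'') \<Longrightarrow> y \<in> carrier (L0 L'') \<Longrightarrow> f2 h x y \<in> carrier (Lm L)"
  by simp_all

lemma h_linear:
  "f1m h \<in> linear_maps (Lm L'') (Lm L)" "f10 h \<in> linear_maps (L0 L'') (L0 L)"
  "f2 h \<in> bilinear_maps (L0 L'') (L0 L'') (Lm L)"
  by (auto simp: bilinear_maps_def F.tgt.Mm.smult_r_distr F.tgt.Mm.a_ac intro!: linear_mapsI)

text \<open>The sum of the coherence axiom for \<open>f\<close> at \<open>f'(x), f'(y), f'(z)\<close> and the image under \<open>f\<close> of
  the coherence axiom for \<open>f'\<close>.\<close>

lemma h_f2_br:
  assumes [simp]: "x \<in> carrier (L0 L'')" "y \<in> carrier (L0 L'')" "z \<in> carrier (L0 L'')"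
  shows "brR L (f10 h x) (f2 h y z) \<oplus>\<^bsub>Lm L\<^esub> f2 h x (br L'' y z) =
    f2 h (br L'' x y) z \<oplus>\<^bsub>Lm L\<^esub> (f2 h y (br L'' x z) \<oplus>\<^bsub>Lm L\<^esub>
      (brL L (f2 h x y) (f10 h z) \<oplus>\<^bsub>Lm L\<^esub> brR L (f10 h y) (f2 h x z)))"
proof -
  let ?X = "f10 f' x" and ?Y = "f10 f' y" and ?Z = "f10 f' z"
  have "brR L (f10 h x) (f2 h y z) \<oplus>\<^bsub>Lm L\<^esub> f2 h x (br L'' y z) =
    (brR L (f10 f ?X) (f2 f ?Y ?Z) \<oplus>\<^bsub>Lm L\<^esub> f2 f ?X (br L' ?Y ?Z)) \<oplus>\<^bsub>Lm L\<^esub>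
    f1m f (brR L' ?X (f2 f' y z) \<oplus>\<^bsub>Lm L'\<^esub> f2 f' x (br L'' y z))"
    by (simp add: F.f1_brR_add F'.f1_br_add F.tgt.Mm.a_ac)
  also have "\<dots> = f2 h (br L'' x y) z \<oplus>\<^bsub>Lm L\<^esub> (f2 h y (br L'' x z) \<oplus>\<^bsub>Lm L\<^esub>
      (brL L (f2 h x y) (f10 h z) \<oplus>\<^bsub>Lm L\<^esub> brR L (f10 h y) (f2 h x z)))"
    unfolding F.f2_br_add[OF F'.f_closed(1) F'.f_closed(1) F'.f_closed(1), OF assms]
      F'.f2_br_add[OF assms]
    by (simp add: F.f1_brR_add F.f1_brL_add F'.f1_br_add F.tgt.Mm.a_ac)
  finally show ?thesis .
qed

lemma hl2a_morphism_comp: "hl2a_morphism L'' L h"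
proof (unfold_locales, goal_cases)
  case (5 \<alpha>)
  then show ?case by (simp add: F.f1_dd F'.f1_dd)
next
  case (8 x y)
  then show ?case
    by (simp add: F.tgt.M0.diff_eq_iff F.f1_br_add F'.f1_br_add F.f1_dd F.tgt.M0.a_ac)
next
  case (9 \<alpha> y)
  then show ?case
    by (simp add: F.tgt.Mm.diff_eq_iff F.f1_brL_add F'.f1_brL_add F'.f1_dd F.tgt.Mm.a_ac)
next
  case (10 x \<alpha>)
  then show ?case
    by (simp add: F.tgt.Mm.diff_eq_iff F.f1_brR_add F'.f1_brR_add F'.f1_dd F.tgt.Mm.a_ac)
next
  case (11 x y)
  then show ?case
    by (simp add: F.tgt.Mm.diff_eq_iff F.f1_h2_add F'.f1_h2_add F.tgt.Mm.a_ac)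
next
  case (12 x y z)
  then show ?case
    using h_f2_br[OF 12] by (subst F.tgt.Mm.diff3_eq_iff) (simp_all del: h_simps add: h_closed)
qed (use h_linear in \<open>auto simp: hl2a_comp_def\<close>)

text \<open>Both sides obey the same recursion: in the composite of the pullbacks the terms with \<open>f2(f'(x), f'(z))\<close>
  come from passing the wedge product of the inner recursion through the outer pullback, and those with
  \<open>f(f2'(x,z))\<close> from the outer recursion.\<close>

lemma pullback_comp:
  assumes \<omega>: "mixed L \<omega>"
  shows "pullback L'' h \<omega> = pullback L'' f' (pullback L' f \<omega>)"
proof -
  let ?E = "\<lambda>\<omega>. pullback L'' h \<omega> - F'.pull (F.pull \<omega>)"
  have nil: "?E \<omega> [] as = 0" if as: "as \<in> lists (carrier (Lm L''))" for \<omega> as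
  proof -
    have eq: "map (f1m h) as = map (f1m f) (map (f1m f') as)"
      using as by (auto simp: in_lists_conv_set)
    show ?thesis
      using as F'.map_f1m_lists[OF as] by (simp add: pointwise pullback_Nil eq del: map_map)
  qed
  have "?E \<omega> = 0"
  proof (rule contraction_unique[where P = "mixed L" and E = ?E and L = L''])
    fix \<omega> x assume \<omega> [simp]: "mixed L \<omega>" and x [simp]: "x \<in> carrier (L0 L'')"
    have "\<iota> x (?E \<omega>) = ?E (\<iota> (f10 h x) \<omega>) + wedge L'' (\<lambda>z. ?E (\<kappa> (f2 h x z) \<omega>))"
      by (simp add: \<iota>_pullback F'.pull_wedge F.\<kappa>_pull pullback_linear wedge_linear)
    then show "\<exists>q c r c'. mixed L q \<and> (\<forall>z\<in>carrier (L0 L''). mixed L (r z)) \<and>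
        \<iota> x (?E \<omega>) = scale c (?E q) + scale c' (wedge L'' (\<lambda>z. ?E (r z)))"
      by (intro exI[of _ "\<iota> (f10 h x) \<omega>"] exI[of _ 1] exI[of _ "\<lambda>z. \<kappa> (f2 h x z) \<omega>"]) simp
  next
    fix \<omega> \<alpha> as assume "mixed L \<omega>" "\<alpha> \<in> carrier (Lm L'')" "as \<in> lists (carrier (Lm L''))"
    then show "\<exists>q c. mixed L q \<and> \<kappa> \<alpha> (?E \<omega>) [] as = c * ?E q [] as"
      using nil[of "\<alpha> # as" \<omega>] by (intro exI[of _ \<omega>] exI[of _ 0]) (simp add: \<kappa>_def)
  next
    fix \<omega> show "?E \<omega> [] [] = 0" by (rule nil) simp
  qed (use \<omega> in simp_all)
  then show ?thesis by simp
qed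

end

context hemistrict_lie_2_algebra
begin

lemma zero_simps [simp]:
  "dd L \<zero>\<^bsub>Lm L\<^esub> = \<zero>\<^bsub>L0 L\<^esub>"
  "x \<in> carrier (L0 L) \<Longrightarrow> brR L x \<zero>\<^bsub>Lm L\<^esub> = \<zero>\<^bsub>Lm L\<^esub>"
  "x \<in> carrier (L0 L) \<Longrightarrow> brL L \<zero>\<^bsub>Lm L\<^esub> x = \<zero>\<^bsub>Lm L\<^esub>"
  using linear_zero[OF dd_linear Lm_vspace L0_vspace]
    linear_zero[of "brR L x", OF _ Lm_vspace Lm_vspace]
    linear_zero[of "\<lambda>\<alpha>. brL L \<alpha> x", OF _ Lm_vspace Lm_vspace]
    brR_bilinear brL_bilinear
  by (auto simp: bilinear_maps_def)

lemma hl2a_id_simps [simp]: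
  "x \<in> carrier (L0 L) \<Longrightarrow> f10 (hl2a_id L) x = x"
  "\<alpha> \<in> carrier (Lm L) \<Longrightarrow> f1m (hl2a_id L) \<alpha> = \<alpha>"
  "x \<in> carrier (L0 L) \<Longrightarrow> y \<in> carrier (L0 L) \<Longrightarrow> f2 (hl2a_id L) x y = \<zero>\<^bsub>Lm L\<^esub>"
  by (simp_all add: hl2a_id_def)

lemma hl2a_id_linear:
  "f1m (hl2a_id L) \<in> linear_maps (Lm L) (Lm L)" "f10 (hl2a_id L) \<in> linear_maps (L0 L) (L0 L)"
  "f2 (hl2a_id L) \<in> bilinear_maps (L0 L) (L0 L) (Lm L)"
  by (auto simp: bilinear_maps_def vspace_closed[OF Lm_vspace] intro!: linear_mapsI)

lemma hl2a_morphism_id: "hl2a_morphism L L (hl2a_id L)"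
proof (unfold_locales, goal_cases)
  case (12 x y z)
  then show ?case by (simp add: a_minus_def)
qed (use hl2a_id_linear in \<open>auto simp: hl2a_id_def M0.diff_eq_iff Mm.diff_eq_iff\<close>)

lemma pullback_id:
  assumes \<omega>: "mixed L \<omega>"
  shows "pullback L (hl2a_id L) \<omega> = \<omega>"
proof -
  let ?E = "\<lambda>\<omega>. pullback L (hl2a_id L) \<omega> - \<omega>"
  have nil: "?E \<omega> [] as = 0" if as: "as \<in> lists (carrier (Lm L))" for \<omega> as
  proof -
    have "map (f1m (hl2a_id L)) as = as"
      using as by (intro map_idI) (simp add: in_lists_conv_set)
    then show ?thesis using as by (simp add: pointwise pullback_Nil)
  qed
  have "?E \<omega> = 0"
  proof (rule contraction_unique[where P = "mixed L" and E = ?E and L = L])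
    fix \<omega> x assume \<omega> [simp]: "mixed L \<omega>" and x [simp]: "x \<in> carrier (L0 L)"
    have "\<iota> x (?E \<omega>) = ?E (\<iota> x \<omega>)"
      by (simp add: \<iota>_pullback pullback_linear wedge_linear)
    then show "\<exists>q c r c'. mixed L q \<and> (\<forall>z\<in>carrier (L0 L). mixed L (r z)) \<and>
        \<iota> x (?E \<omega>) = scale c (?E q) + scale c' (wedge L (\<lambda>z. ?E (r z)))"
      by (intro exI[of _ "\<iota> x \<omega>"] exI[of _ 1] exI[of _ "\<lambda>z. \<omega>"] exI[of _ 0]) simp
  next
    fix \<omega> \<alpha> as assume "mixed L \<omega>" "\<alpha> \<in> carrier (Lm L)" "as \<in> lists (carrier (Lm L))"
    then show "\<exists>q c. mixed L q \<and> \<kappa> \<alpha> (?E \<omega>) [] as = c * ?E q [] as"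
      using nil[of "\<alpha> # as" \<omega>] by (intro exI[of _ \<omega>] exI[of _ 0]) (simp add: \<kappa>_def)
  next
    fix \<omega> show "?E \<omega> [] [] = 0" by (rule nil) simp
  qed (use \<omega> in simp_all)
  then show ?thesis by simp
qed

end

section \<open>The functor\<close>

text \<open>A term with \<open>q\<close> pairs trades \<open>2 q\<close> arguments of degree 1 for \<open>q\<close> arguments of degree 2.\<close>

lemma has_degree_pullback:
  assumes "has_degree n \<omega>"
  shows "has_degree n (pullback L f \<omega>)"
proof -
  have "pullback L f \<omega> xs as = 0" if "int (length xs) + 2 * int (length as) \<noteq> n" for xs as
    using assms that
  proof (induction "length xs" arbitrary: n \<omega> xs rule: less_induct)
    case less
    show ?case
    proof (cases "args L xs as")
      case args: True
      show ?thesis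
      proof (cases xs)
        case Nil
        then show ?thesis using less.prems args by (simp add: pullback_Nil has_degree_def)
      next
        case (Cons x ys)
        have "pullback L f (\<iota> (f10 f x) \<omega>) ys as = 0"
          using less.prems by (intro less.hyps[of ys "n - 1"]) (auto simp: Cons has_degree_def \<iota>_def)
        moreover have "pullback L f (\<kappa> (f2 f x (ys ! j)) \<omega>) (nths ys (- {j})) as = 0"
          if "j < length ys" for j
          using less.prems that
          by (intro less.hyps[of _ "n - 2"])
            (auto simp: Cons has_degree_def \<kappa>_def length_nths_neg of_nat_diff)
        ultimately have "\<iota> x (pullback L f \<omega>) ys as = 0"
          using args by (subst \<iota>_pullback) (simp_all add: Cons pointwise wedge_def)
        then show ?thesis by (simp add: Cons \<iota>_def)
      qed
    qed (auto simp: pullback_def)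
  qed
  then show ?thesis by (auto simp: has_degree_def)
qed

lemma (in hl2a_hom) pullback_cochains: "\<omega> \<in> cochains L n \<Longrightarrow> pull \<omega> \<in> cochains L' n"
  by (simp add: src.cochains_iff tgt.cochains_iff has_degree_pullback)

lemma category_hemistrict_lie_2_algebras:
  "category (hemistrict_lie_2_algebras :: (('k::field, 'a, 'b) hl2a, ('a, 'b) hl2a_mor) category)"
proof
  fix L :: "('k, 'a, 'b) hl2a"
  assume "L \<in> Obj hemistrict_lie_2_algebras"
  then show "Id hemistrict_lie_2_algebras L \<in> Hom hemistrict_lie_2_algebras L L"
    by (simp add: hemistrict_lie_2_algebras_def hemistrict_lie_2_algebra.hl2a_morphism_id)
next
  fix L'' L' L :: "('k, 'a, 'b) hl2a" and f' f
  assume "L'' \<in> Obj hemistrict_lie_2_algebras" "L' \<in> Obj hemistrict_lie_2_algebras"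
    "L \<in> Obj hemistrict_lie_2_algebras"
    "f' \<in> Hom hemistrict_lie_2_algebras L'' L'" "f \<in> Hom hemistrict_lie_2_algebras L' L"
  then have "hl2a_hom_comp L'' L' L f' f"
    by (simp add: hemistrict_lie_2_algebras_def hl2a_hom_comp_def hl2a_hom_def)
  then show "Cmp hemistrict_lie_2_algebras L'' L' L f f' \<in> Hom hemistrict_lie_2_algebras L'' L"
    by (simp add: hemistrict_lie_2_algebras_def hl2a_hom_comp.hl2a_morphism_comp)
next
  fix L' L :: "('k, 'a, 'b) hl2a" and f
  assume "L' \<in> Obj hemistrict_lie_2_algebras" "L \<in> Obj hemistrict_lie_2_algebras"
    "f \<in> Hom hemistrict_lie_2_algebras L' L"
  then interpret hl2a_hom L' L f
    by (simp add: hemistrict_lie_2_algebras_def hl2a_hom_def)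
  have ext: "f2 f x = undefined" if "x \<notin> carrier (L0 L')" for x
    using f2_ext that by (auto simp: PiE_def extensional_def)
  have ext2: "f2 f x y = undefined" if "x \<in> carrier (L0 L')" "y \<notin> carrier (L0 L')" for x y
    using f2_ext that by (auto simp: PiE_def Pi_def extensional_def)
  show "Cmp hemistrict_lie_2_algebras L' L' L f (Id hemistrict_lie_2_algebras L') = f"
    "Cmp hemistrict_lie_2_algebras L' L L (Id hemistrict_lie_2_algebras L) f = f"
    using f10_ext f1m_ext
    by (auto simp: hemistrict_lie_2_algebras_def hl2a_comp_def hl2a_id_def fun_eq_iff restrict_def
        extensional_def ext ext2 intro!: hl2a_mor.equality)
next
  fix K L M N :: "('k, 'a, 'b) hl2a" and f g h
  assume obj: "K \<in> Obj hemistrict_lie_2_algebras" "L \<in> Obj hemistrict_lie_2_algebras"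
    "M \<in> Obj hemistrict_lie_2_algebras" "N \<in> Obj hemistrict_lie_2_algebras"
    and "f \<in> Hom hemistrict_lie_2_algebras K L" "g \<in> Hom hemistrict_lie_2_algebras L M"
    "h \<in> Hom hemistrict_lie_2_algebras M N"
  then interpret f: hl2a_hom K L f + g: hl2a_hom L M g + h: hl2a_hom M N h
    by (simp_all add: hemistrict_lie_2_algebras_def hl2a_hom_def)
  show "Cmp hemistrict_lie_2_algebras K M N h (Cmp hemistrict_lie_2_algebras K L M g f) =
     Cmp hemistrict_lie_2_algebras K L N (Cmp hemistrict_lie_2_algebras L M N h g) f"
    by (auto simp: hemistrict_lie_2_algebras_def hl2a_comp_def fun_eq_iff restrict_def
        h.tgt.Mm.a_assoc intro!: hl2a_mor.equality)
qed

lemma contravariant_functor_standard_complex: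
  "contravariant_functor
     (hemistrict_lie_2_algebras :: (('k::field, 'a, 'b) hl2a, ('a, 'b) hl2a_mor) category)
     cochain_complexes standard_complex pullback_map"
proof (intro contravariant_functor.intro category_hemistrict_lie_2_algebras
    category_cochain_complexes contravariant_functor_axioms.intro)
  fix L :: "('k, 'a, 'b) hl2a"
  assume "L \<in> Obj hemistrict_lie_2_algebras"
  then interpret hemistrict_lie_2_algebra L by (simp add: hemistrict_lie_2_algebras_def)
  show "standard_complex L \<in> Obj cochain_complexes"
    by (simp add: cochain_complexes_def standard_complex)
  show "pullback_map L L (Id hemistrict_lie_2_algebras L) = Id cochain_complexes (standard_complex L)"
    by (auto simp: hemistrict_lie_2_algebras_def cochain_complexes_def pullback_map_def
        standard_complex_def cochain_space_simps pullback_id cochains_iff fun_eq_iff restrict_def)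
next
  fix L' L :: "('k, 'a, 'b) hl2a" and f
  assume "L' \<in> Obj hemistrict_lie_2_algebras" "L \<in> Obj hemistrict_lie_2_algebras"
    "f \<in> Hom hemistrict_lie_2_algebras L' L"
  then interpret hl2a_hom L' L f
    by (simp add: hemistrict_lie_2_algebras_def hl2a_hom_def)
  show "pullback_map L' L f \<in> Hom cochain_complexes (standard_complex L) (standard_complex L')"
    by (auto simp: cochain_complexes_def cochain_maps_def pullback_map_def standard_complex_def
        restrict_linear tgt.cochain_space_vspace src.cochain_space_simps tgt.cochain_space_simps
        pullback_cochains pullback_linear tgt.cochains_closed D_pull tgt.cochains_mixed
        restrict_linear[OF tgt.cochain_space_vspace, unfolded tgt.cochain_space_simps]
        intro!: linear_mapsI)
next
  fix L'' L' L :: "('k, 'a, 'b) hl2a" and f' f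
  assume "L'' \<in> Obj hemistrict_lie_2_algebras" "L' \<in> Obj hemistrict_lie_2_algebras"
    "L \<in> Obj hemistrict_lie_2_algebras"
    "f' \<in> Hom hemistrict_lie_2_algebras L'' L'" "f \<in> Hom hemistrict_lie_2_algebras L' L"
  then interpret hl2a_hom_comp L'' L' L f' f
    by (simp add: hemistrict_lie_2_algebras_def hl2a_hom_comp_def hl2a_hom_def)
  show "pullback_map L'' L (Cmp hemistrict_lie_2_algebras L'' L' L f f') =
      Cmp cochain_complexes (standard_complex L) (standard_complex L') (standard_complex L'')
        (pullback_map L'' L' f') (pullback_map L' L f)"
    by (auto simp: hemistrict_lie_2_algebras_def cochain_complexes_def pullback_map_def
        standard_complex_def F.tgt.cochain_space_simps F.pullback_cochains pullback_comp
        F.tgt.cochains_mixed fun_eq_iff restrict_def)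
qed

theorem theorem3p23:
  shows "contravariant_functor
           (hemistrict_lie_2_algebras :: ((real, 'a, 'b) hl2a, ('a, 'b) hl2a_mor) category)
           cochain_complexes standard_complex pullback_map
       \<and> contravariant_functor
           (hemistrict_lie_2_algebras :: ((complex, 'a, 'b) hl2a, ('a, 'b) hl2a_mor) category)
           cochain_complexes standard_complex pullback_map"
  by (intro conjI contravariant_functor_standard_complex)

end
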